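(* Let $X$ and $Y$ be based, connected, countable CW complexes with non-degenerate basepoints. Let $A \colon G \times Y \to Y$ be a homotopy-associative action of a group-like space $G$ on $Y$. Let $\mathcal{O}$ be the set of orbits of the induced action of the group $[X, G]$ on $\langle X,Y\rangle$. Then: (A) There is a surjection of sets $$\mathcal{O} \twoheadrightarrow \frac{\{\text{components of } \mathrm{map}(X,Y)\}}{\simeq}.$$ (B) If $X$ is a finite complex, then there is a surjection of sets $$\mathcal{O} \twoheadrightarrow \frac{\{\text{components of } \mathrm{map}(X,Y)\}}{\simeq_*}.$$ (C) If $X$ is a finite complex and the group-like action on $Y$ is strictly unital, then there is a surjection of sets $$\mathcal{O} \twoheadrightarrow \frac{\{\text{evaluation fibrations } \omega_f \colon \mathrm{map}(X,Y;f)\to Y\}}{\text{fibre-homotopy equivalence}}.$$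
   Context: $\mathrm{map}(X,Y)$ is the space of all continuous (not necessarily based) maps with the compact-open topology; "component" means path component, and $\mathrm{map}(X,Y;f)$ is the path component containing $f\colon X\to Y$. With $x_0\in X$ the basepoint, $\omega_f\colon \mathrm{map}(X,Y;f)\to Y$ is the evaluation map $\omega_f(h)=h(x_0)$, a Hurewicz fibration. $\langle X,Y\rangle$ is the set of free homotopy classes of maps $X\to Y$, and $[X,G]$ is the set of based homotopy classes of based maps $X \to G$, a group under pointwise multiplication when $G$ is group-like. The symbol $\simeq$ denotes (free) homotopy equivalence, $\simeq_*$ denotes based homotopy equivalence, and $\sim_*$ denotes based homotopy. The surjections send the orbit of the class of $f\colon X\to Y$ to the class of $\mathrm{map}(X,Y;f)$ in (A) and (B), and to the class of $\omega_f$ in (C). An H-space is a based space $G$ with a based map $m \colon G\times G\to G$ such that $m\circ J\sim_*\nabla\colon G\vee G\to G$, where $J\colon G\vee G\to G\times G$ is the inclusion and $\nabla$ is the folding map. It is homotopy-associative if $m\circ(m\times 1)\sim_* m\circ(1\times m)\colon G\times G\times G\to G$. A group-like space is a homotopy-associative H-space $G$ together with a based map $\iota\colon G\to G$ such that $m\circ(\iota\times 1)\circ\Delta\sim_* 0$ and $m\circ(1\times\iota)\circ\Delta\sim_* 0$, where $\Delta\colon G\to G\times G$ is the diagonal map and $0$ is the constant map at the basepoint. A homotopy-associative action of $G$ on a based space $Y$ is a based map $A\colon G\times Y\to Y$ such that $A\circ i_2\sim_* 1\colon Y\to Y$ and $A\circ(1\times A)\sim_* A\circ(m\times 1)\colon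 G\times G\times Y\to Y$, where $i_2\colon Y\to G\times Y$ is the inclusion. It is strictly unital if $A\circ i_2=1$. The induced action of $[X,G]$ on $\langle X,Y\rangle$ sends the classes of a based map $\gamma\colon X\to G$ and a map $f\colon X\to Y$ to the class of $\gamma\cdot f$, where $(\gamma\cdot f)(x)=A(\gamma(x),f(x))$. For fibrations $p_1\colon E_1\to B$ and $p_2\colon E_2\to B$ over a space $B$, a based map $h\colon E_1\to E_2$ is a fibre-homotopy equivalence if there exists $k\colon E_2\to E_1$ such that $k\circ h$ and $h\circ k$ are homotopic to the respective identities by based homotopies $F$ and $K$ satisfying $p_1\circ F(x,t)=p_1(x)$ and $p_2\circ K(y,t)=p_2(y)$ for $x\in E_1$, $y\in E_2$ and $t\in [0,1]$. *)

theory Defs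
  imports "HOL-Analysis.Analysis" "HOL-Algebra.Group_Action"
begin

section \<open>CW complexes and non-degenerate basepoints\<close>

definition disc :: "nat \<Rightarrow> (nat \<Rightarrow> real) topology" where
  "disc n = subtopology (Euclidean_space n) {x. (\<Sum>i<n. x i ^ 2) \<le> 1}"

definition disc_interior :: "nat \<Rightarrow> (nat \<Rightarrow> real) set" where
  "disc_interior n = topspace (disc n) \<inter> {x. (\<Sum>i<n. x i ^ 2) < 1}"

definition disc_boundary :: "nat \<Rightarrow> (nat \<Rightarrow> real) set" where
  "disc_boundary n = topspace (disc n) \<inter> {x. (\<Sum>i<n. x i ^ 2) = 1}"

text \<open>A CW structure on the space \<open>X\<close>: \<open>E\<close> is the set of open cells, \<open>d c\<close> the dimension and
  \<open>\<Phi> c\<close> the characteristic map of the cell \<open>c\<close>. The last two clauses are closure-finiteness and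
  the weak topology.\<close>

definition CW_complex ::
  "'a topology \<Rightarrow> 'a set set \<Rightarrow> ('a set \<Rightarrow> nat) \<Rightarrow> ('a set \<Rightarrow> (nat \<Rightarrow> real) \<Rightarrow> 'a) \<Rightarrow> bool" where
  "CW_complex X E d \<Phi> \<longleftrightarrow>
     Hausdorff_space X \<and>
     \<Union>E = topspace X \<and> pairwise disjnt E \<and>
     (\<forall>c\<in>E. continuous_map (disc (d c)) X (\<Phi> c) \<and>
        homeomorphic_map (subtopology (disc (d c)) (disc_interior (d c))) (subtopology X c) (\<Phi> c)) \<and>
     (\<forall>c\<in>E. \<exists>F. finite F \<and> F \<subseteq> E \<and> (\<forall>c'\<in>F. d c' < d c) \<and> \<Phi> c ` disc_boundary (d c) \<subseteq> \<Union>F) \<and>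
     (\<forall>S. S \<subseteq> topspace X \<longrightarrow>
        (closedin X S \<longleftrightarrow>
          (\<forall>c\<in>E. closedin (disc (d c)) {x \<in> topspace (disc (d c)). \<Phi> c x \<in> S})))"

text \<open>The inclusion of \<open>x0\<close> has the homotopy extension property. A definition cannot quantify over
  targets \<open>Z\<close> of all types, but for a closed point the targets of type \<^typ>\<open>'a \<times> real\<close> suffice: one of
  them is the subspace \<open>(X \<times> {0}) \<union> ({x0} \<times> [0,1])\<close> of \<open>X \<times> [0,1]\<close>, and the extension property for it
  yields a retraction of \<open>X \<times> [0,1]\<close> onto it, hence the extension property for every target.\<close>

definition nondegenerate_basepoint :: "'a topology \<Rightarrow> 'a \<Rightarrow> bool" where
  "nondegenerate_basepoint X x0 \<longleftrightarrow>
     x0 \<in> topspace X \<and>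
     (\<forall>(Z :: ('a \<times> real) topology) f p.
        continuous_map X Z f \<and> pathin Z p \<and> p 0 = f x0 \<longrightarrow>
        (\<exists>K. continuous_map (prod_topology (top_of_set {0..1::real}) X) Z K \<and>
             (\<forall>x\<in>topspace X. K (0, x) = f x) \<and> (\<forall>t\<in>{0..1}. K (t, x0) = p t)))"

section \<open>Mapping spaces and homotopy classes\<close>

text \<open>Maps are normalised to be \<^const>\<open>undefined\<close> outside the domain, so that equality of maps is
  equality of functions.\<close>

definition maps :: "'a topology \<Rightarrow> 'b topology \<Rightarrow> ('a \<Rightarrow> 'b) set" where
  "maps X Y = {f \<in> extensional (topspace X). continuous_map X Y f}"

text \<open>Compact-open topology.\<close>

definition mapping_space :: "'a topology \<Rightarrow> 'b topology \<Rightarrow> ('a \<Rightarrow> 'b) topology" where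
  "mapping_space X Y =
     topology_generated_by {{f \<in> maps X Y. f ` K \<subseteq> U} | K U. compactin X K \<and> openin Y U}"

abbreviation map_component :: "'a topology \<Rightarrow> 'b topology \<Rightarrow> ('a \<Rightarrow> 'b) \<Rightarrow> ('a \<Rightarrow> 'b) set" where
  "map_component X Y f \<equiv> path_component_of_set (mapping_space X Y) f"

definition free_homotopy :: "'a topology \<Rightarrow> 'b topology \<Rightarrow> (('a \<Rightarrow> 'b) \<times> ('a \<Rightarrow> 'b)) set" where
  "free_homotopy X Y =
     {(f, g). f \<in> maps X Y \<and> g \<in> maps X Y \<and> homotopic_with (\<lambda>_. True) X Y f g}"

definition free_classes :: "'a topology \<Rightarrow> 'b topology \<Rightarrow> ('a \<Rightarrow> 'b) set set" where
  "free_classes X Y = maps X Y // free_homotopy X Y"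

definition based_maps :: "'a topology \<Rightarrow> 'a \<Rightarrow> 'b topology \<Rightarrow> 'b \<Rightarrow> ('a \<Rightarrow> 'b) set" where
  "based_maps X x0 Y y0 = {f \<in> maps X Y. f x0 = y0}"

abbreviation based_homotopic ::
  "'a topology \<Rightarrow> 'a \<Rightarrow> 'b topology \<Rightarrow> 'b \<Rightarrow> ('a \<Rightarrow> 'b) \<Rightarrow> ('a \<Rightarrow> 'b) \<Rightarrow> bool" where
  "based_homotopic X x0 Y y0 f g \<equiv> homotopic_with (\<lambda>h. h x0 = y0) X Y f g"

definition based_homotopy ::
  "'a topology \<Rightarrow> 'a \<Rightarrow> 'b topology \<Rightarrow> 'b \<Rightarrow> (('a \<Rightarrow> 'b) \<times> ('a \<Rightarrow> 'b)) set" where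
  "based_homotopy X x0 Y y0 =
     {(f, g). f \<in> based_maps X x0 Y y0 \<and> g \<in> based_maps X x0 Y y0 \<and> based_homotopic X x0 Y y0 f g}"

section \<open>Group-like spaces and their actions\<close>

text \<open>The wedge \<open>G \<or> G\<close> is the subspace \<open>(G \<times> {e}) \<union> ({e} \<times> G)\<close> of \<open>G \<times> G\<close> (to which the quotient
  of the disjoint union is homeomorphic for every \<open>G\<close>), so that \<open>J\<close> is the inclusion.\<close>

definition wedge_square :: "'g topology \<Rightarrow> 'g \<Rightarrow> ('g \<times> 'g) topology" where
  "wedge_square G e = subtopology (prod_topology G G) {(g, h). g = e \<or> h = e}"

definition folding :: "'g \<Rightarrow> 'g \<times> 'g \<Rightarrow> 'g" where
  "folding e = (\<lambda>(g, h). if h = e then g else h)"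

definition H_space :: "'g topology \<Rightarrow> 'g \<Rightarrow> ('g \<times> 'g \<Rightarrow> 'g) \<Rightarrow> bool" where
  "H_space G e m \<longleftrightarrow>
     e \<in> topspace G \<and> continuous_map (prod_topology G G) G m \<and> m (e, e) = e \<and>
     based_homotopic (wedge_square G e) (e, e) G e m (folding e)"

definition homotopy_associative :: "'g topology \<Rightarrow> 'g \<Rightarrow> ('g \<times> 'g \<Rightarrow> 'g) \<Rightarrow> bool" where
  "homotopy_associative G e m \<longleftrightarrow>
     based_homotopic (prod_topology G (prod_topology G G)) (e, e, e) G e
       (\<lambda>(a, b, c). m (m (a, b), c)) (\<lambda>(a, b, c). m (a, m (b, c)))"

definition group_like :: "'g topology \<Rightarrow> 'g \<Rightarrow> ('g \<times> 'g \<Rightarrow> 'g) \<Rightarrow> ('g \<Rightarrow> 'g) \<Rightarrow> bool" where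
  "group_like G e m \<iota> \<longleftrightarrow>
     H_space G e m \<and> homotopy_associative G e m \<and>
     continuous_map G G \<iota> \<and> \<iota> e = e \<and>
     based_homotopic G e G e (\<lambda>g. m (\<iota> g, g)) (\<lambda>_. e) \<and>
     based_homotopic G e G e (\<lambda>g. m (g, \<iota> g)) (\<lambda>_. e)"

definition homotopy_associative_action ::
  "'g topology \<Rightarrow> 'g \<Rightarrow> ('g \<times> 'g \<Rightarrow> 'g) \<Rightarrow> 'b topology \<Rightarrow> 'b \<Rightarrow> ('g \<times> 'b \<Rightarrow> 'b) \<Rightarrow> bool" where
  "homotopy_associative_action G e m Y y0 A \<longleftrightarrow>
     continuous_map (prod_topology G Y) Y A \<and> A (e, y0) = y0 \<and>
     based_homotopic Y y0 Y y0 (\<lambda>y. A (e, y)) id \<and>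
     based_homotopic (prod_topology G (prod_topology G Y)) (e, e, y0) Y y0
       (\<lambda>(a, b, y). A (a, A (b, y))) (\<lambda>(a, b, y). A (m (a, b), y))"

definition strictly_unital :: "'g \<Rightarrow> 'b topology \<Rightarrow> ('g \<times> 'b \<Rightarrow> 'b) \<Rightarrow> bool" where
  "strictly_unital e Y A \<longleftrightarrow> (\<forall>y\<in>topspace Y. A (e, y) = y)"

text \<open>The group \<open>[X, G]\<close>. The product of two classes is the class of the pointwise product of
  arbitrary representatives.\<close>

definition class_group ::
  "'a topology \<Rightarrow> 'a \<Rightarrow> 'g topology \<Rightarrow> 'g \<Rightarrow> ('g \<times> 'g \<Rightarrow> 'g) \<Rightarrow> ('a \<Rightarrow> 'g) set monoid" where
  "class_group X x0 G e m =
     \<lparr>carrier = based_maps X x0 G e // based_homotopy X x0 G e,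
      mult = (\<lambda>a b. based_homotopy X x0 G e `` {\<lambda>x\<in>topspace X. m (\<gamma> x, \<delta> x) | \<gamma> \<delta>. \<gamma> \<in> a \<and> \<delta> \<in> b}),
      one = based_homotopy X x0 G e `` {\<lambda>x\<in>topspace X. e}\<rparr>"

definition class_action ::
  "'a topology \<Rightarrow> 'b topology \<Rightarrow> ('g \<times> 'b \<Rightarrow> 'b) \<Rightarrow> ('a \<Rightarrow> 'g) set \<Rightarrow> ('a \<Rightarrow> 'b) set \<Rightarrow> ('a \<Rightarrow> 'b) set" where
  "class_action X Y A a = (\<lambda>b\<in>free_classes X Y.
     free_homotopy X Y `` {\<lambda>x\<in>topspace X. A (\<gamma> x, f x) | \<gamma> f. \<gamma> \<in> a \<and> f \<in> b})"

section \<open>Equivalences of components and of evaluation fibrations\<close>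

definition component_equiv :: "'a topology \<Rightarrow> 'b topology \<Rightarrow> (('a \<Rightarrow> 'b) set \<times> ('a \<Rightarrow> 'b) set) set" where
  "component_equiv X Y =
     {(C, D). C \<in> path_components_of (mapping_space X Y) \<and> D \<in> path_components_of (mapping_space X Y) \<and>
        subtopology (mapping_space X Y) C homotopy_equivalent_space subtopology (mapping_space X Y) D}"

definition based_homotopy_equivalent :: "'a topology \<Rightarrow> 'a \<Rightarrow> 'b topology \<Rightarrow> 'b \<Rightarrow> bool" where
  "based_homotopy_equivalent X x0 Y y0 \<longleftrightarrow>
     (\<exists>f g. continuous_map X Y f \<and> continuous_map Y X g \<and> f x0 = y0 \<and> g y0 = x0 \<and>
        based_homotopic X x0 X x0 (g \<circ> f) id \<and> based_homotopic Y y0 Y y0 (f \<circ> g) id)"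

text \<open>Based homotopy type refers to a basepoint, so the objects classified are the components
  \<open>map(X,Y;f)\<close> based at \<open>f\<close>, one for each map \<open>f\<close>.\<close>

definition based_components :: "'a topology \<Rightarrow> 'b topology \<Rightarrow> (('a \<Rightarrow> 'b) set \<times> ('a \<Rightarrow> 'b)) set" where
  "based_components X Y = (\<lambda>f. (map_component X Y f, f)) ` maps X Y"

definition based_component_equiv ::
  "'a topology \<Rightarrow> 'b topology \<Rightarrow>
     ((('a \<Rightarrow> 'b) set \<times> ('a \<Rightarrow> 'b)) \<times> (('a \<Rightarrow> 'b) set \<times> ('a \<Rightarrow> 'b))) set" where
  "based_component_equiv X Y =
     {((C, f), (D, g)). (C, f) \<in> based_components X Y \<and> (D, g) \<in> based_components X Y \<and>
        based_homotopy_equivalent (subtopology (mapping_space X Y) C) f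
                                  (subtopology (mapping_space X Y) D) g}"

text \<open>\<open>h\<close> is a based fibre-homotopy equivalence between \<open>p1\<close> and \<open>p2\<close>; as usual, \<open>h\<close> is required to
  be a map over the base. That \<open>k\<close> is based and over the base as well then follows from the
  conditions on the homotopies.\<close>

definition fibre_homotopy_equivalence ::
  "'e topology \<Rightarrow> 'e \<Rightarrow> ('e \<Rightarrow> 'b) \<Rightarrow> 'f topology \<Rightarrow> 'f \<Rightarrow> ('f \<Rightarrow> 'b) \<Rightarrow> ('e \<Rightarrow> 'f) \<Rightarrow> bool" where
  "fibre_homotopy_equivalence E1 e1 p1 E2 e2 p2 h \<longleftrightarrow>
     continuous_map E1 E2 h \<and> h e1 = e2 \<and> (\<forall>x\<in>topspace E1. p2 (h x) = p1 x) \<and>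
     (\<exists>k. continuous_map E2 E1 k \<and>
        homotopic_with (\<lambda>F. F e1 = e1 \<and> (\<forall>x\<in>topspace E1. p1 (F x) = p1 x)) E1 E1 (k \<circ> h) id \<and>
        homotopic_with (\<lambda>K. K e2 = e2 \<and> (\<forall>y\<in>topspace E2. p2 (K y) = p2 y)) E2 E2 (h \<circ> k) id)"

text \<open>An evaluation fibration is given by its total space and its projection to \<open>Y\<close>.\<close>

definition evaluation_fibration ::
  "'a topology \<Rightarrow> 'a \<Rightarrow> 'b topology \<Rightarrow> ('a \<Rightarrow> 'b) \<Rightarrow> ('a \<Rightarrow> 'b) topology \<times> (('a \<Rightarrow> 'b) \<Rightarrow> 'b)" where
  "evaluation_fibration X x0 Y f =
     (subtopology (mapping_space X Y) (map_component X Y f), \<lambda>h. h x0)"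

definition evaluation_fibrations ::
  "'a topology \<Rightarrow> 'a \<Rightarrow> 'b topology \<Rightarrow> (('a \<Rightarrow> 'b) topology \<times> (('a \<Rightarrow> 'b) \<Rightarrow> 'b)) set" where
  "evaluation_fibrations X x0 Y = evaluation_fibration X x0 Y ` maps X Y"

text \<open>The fibration \<open>\<omega>\<^sub>f\<close> depends only on the component of \<open>f\<close> and has no preferred basepoint: a
  fibre-homotopy equivalence can only relate points with the same image in \<open>Y\<close>, and even for
  homotopic based maps \<open>f\<close> and \<open>f'\<close> there need not be one taking \<open>f\<close> to \<open>f'\<close>. Hence the basepoint
  on either side may be prescribed arbitrarily, and the one on the other side is to be found.\<close>

definition evaluation_fibration_equiv ::
  "'a topology \<Rightarrow> 'a \<Rightarrow> 'b topology \<Rightarrow>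
     ((('a \<Rightarrow> 'b) topology \<times> (('a \<Rightarrow> 'b) \<Rightarrow> 'b)) \<times> (('a \<Rightarrow> 'b) topology \<times> (('a \<Rightarrow> 'b) \<Rightarrow> 'b))) set" where
  "evaluation_fibration_equiv X x0 Y =
     {((E1, p1), (E2, p2)).
        (E1, p1) \<in> evaluation_fibrations X x0 Y \<and> (E2, p2) \<in> evaluation_fibrations X x0 Y \<and>
        (\<forall>e1\<in>topspace E1. \<exists>e2\<in>topspace E2. \<exists>h. fibre_homotopy_equivalence E1 e1 p1 E2 e2 p2 h) \<and>
        (\<forall>e2\<in>topspace E2. \<exists>e1\<in>topspace E1. \<exists>h. fibre_homotopy_equivalence E1 e1 p1 E2 e2 p2 h)}"

end

theory Submission
  imports Defs
begin

text \<open>Acting by \<open>\<gamma>\<close> maps the component of \<open>f\<close> to that of \<open>\<gamma> \<cdot> f\<close>, and acting by \<open>\<iota> \<circ> \<gamma>\<close> is a homotopy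
  inverse; this gives (A). For (B) and (C) the homotopy equivalence has to be made based, respectively
  based and vertical, as in Dold's theorem. This needs the points of the mapping space to be
  non-degenerate. A map \<open>f\<close> from a finite complex has image in a finite subcomplex \<open>Z\<close> of \<open>Y\<close>, and the
  diagonal of \<open>Z\<close> is a cofibration in \<open>Y \<times> Z\<close>, by induction on the cells; the resulting paths between
  nearby points, applied pointwise, contract a neighbourhood of \<open>f\<close> to \<open>f\<close>.\<close>

section \<open>Cofibrations\<close>

text \<open>Associativity, inverse and unit of the action hold only up to homotopy, so the homotopy
  from acting by \<open>\<gamma>\<close> and then by \<open>\<iota> \<circ> \<gamma>\<close> to the
  identity moves base points. At \<open>x0\<close> it traces a homotopy of self-maps of
  \<open>Y\<close>; for a strictly unital action this is a loop at the identity, but it need not be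
  constant. Hence neither base points nor fibres are preserved, and the homotopy inverse is
  corrected by lifting that loop. To keep the base point at the same time, the lifts must have
  prescribed values over it, and this is where non-degeneracy enters.

  (B) and (C) share one argument: a based equivalence is a based fibre-homotopy equivalence over a
  one-point base. So the lifting lemmas and Dold's theorem are stated for an arbitrary projection
  \<open>p\<close>, and evaluation at \<open>x0\<close> is only one instance.

  The diagonal is treated in \<open>Y x Z\<close> with finite \<open>Z\<close> because
  \<open>f\<close> has its values in \<open>Z\<close> while the nearby maps do not. It also spares
  any comparison of the product topology on \<open>Y x Y\<close> with a weak topology: infinite
  unions of cells meet only products with the interval.\<close>

abbreviation unit_interval :: "real topology" where
  "unit_interval \<equiv> top_of_set {0..1}"

lemma continuous_map_compose':
  "continuous_map X Y f \<Longrightarrow> continuous_map Y Z g \<Longrightarrow> continuous_map X Z (\<lambda>x. g (f x))"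
  using continuous_map_compose[of X Y f Z g] by (simp add: o_def)

lemma continuous_map_fst':
  "continuous_map Z (prod_topology X Y) f \<Longrightarrow> continuous_map Z X (\<lambda>x. fst (f x))"
  by (rule continuous_map_compose'[OF _ continuous_map_fst])

lemma continuous_map_snd':
  "continuous_map Z (prod_topology X Y) f \<Longrightarrow> continuous_map Z Y (\<lambda>x. snd (f x))"
  by (rule continuous_map_compose'[OF _ continuous_map_snd])

lemma continuous_map_mem: "continuous_map X Y f \<Longrightarrow> x \<in> topspace X \<Longrightarrow> f x \<in> topspace Y"
  by (auto simp: continuous_map_def)

lemma continuous_map_pasting2:
  assumes "closedin X S" "closedin X T" "topspace X \<subseteq> S \<union> T"
    and "continuous_map (subtopology X S) Y f" "continuous_map (subtopology X T) Y g"
    and "\<And>x. x \<in> S \<Longrightarrow> x \<in> T \<Longrightarrow> f x = g x"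
  shows "continuous_map X Y (\<lambda>x. if x \<in> S then f x else g x)"
proof (rule pasting_lemma_closed[of "UNIV::bool set" X "\<lambda>b. if b then S else T" Y "\<lambda>b. if b then f else g"])
  show "\<exists>j. j \<in> (UNIV::bool set) \<and> x \<in> (if j then S else T) \<and> (if x \<in> S then f x else g x) = (if j then f else g) x"
    if "x \<in> topspace X" for x
    using that assms(3) by (intro exI[of _ "x \<in> S"]) auto
qed (use assms in \<open>auto split: if_splits\<close>)

lemma continuous_map_into_prod_fulltopology:
  "continuous_map Z (prod_topology X (subtopology Y S)) f \<Longrightarrow> continuous_map Z (prod_topology X Y) f"
  unfolding continuous_map_pairwise by (blast intro: continuous_map_into_fulltopology)

lemma compact_space_unit_interval: "compact_space unit_interval"
  using compactin_subspace[of euclidean "{0..1::real}"] by simp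

lemma Hausdorff_space_unit_interval: "Hausdorff_space unit_interval"
  by (rule Hausdorff_space_subtopology) simp

text \<open>A retraction of the cylinder \<open>[0,1] x W\<close> onto
  \<open>({0} x W) \<union> ([0,1] x A)\<close>. For closed \<open>A\<close> its existence amounts
  to the homotopy extension property for every target, so working with \<open>R\<close> avoids a
  quantifier over target types. The interval comes first to match
  \<open>homotopic_with\<close>.\<close>

definition cofibration_retraction :: "'a topology \<Rightarrow> 'a set \<Rightarrow> (real \<times> 'a \<Rightarrow> real \<times> 'a) \<Rightarrow> bool" where
  "cofibration_retraction W A R \<longleftrightarrow>
     continuous_map (prod_topology unit_interval W) (prod_topology unit_interval W) R \<and>
     (\<forall>t\<in>{0..1}. \<forall>w\<in>topspace W. fst (R (t, w)) = 0 \<or> snd (R (t, w)) \<in> A) \<and>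
     (\<forall>w\<in>topspace W. R (0, w) = (0, w)) \<and> (\<forall>t\<in>{0..1}. \<forall>a\<in>A. R (t, a) = (t, a))"

lemma cofibration_retractionD:
  assumes "cofibration_retraction W A R"
  shows "continuous_map (prod_topology unit_interval W) (prod_topology unit_interval W) R"
    and "\<And>t w. t \<in> {0..1} \<Longrightarrow> w \<in> topspace W \<Longrightarrow> fst (R (t, w)) = 0 \<or> snd (R (t, w)) \<in> A"
    and "\<And>w. w \<in> topspace W \<Longrightarrow> R (0, w) = (0, w)"
    and "\<And>t a. t \<in> {0..1} \<Longrightarrow> a \<in> A \<Longrightarrow> R (t, a) = (t, a)"
  using assms by (simp_all add: cofibration_retraction_def)

definition closed_cofibration :: "'a topology \<Rightarrow> 'a set \<Rightarrow> bool" where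
  "closed_cofibration W A \<longleftrightarrow> closedin W A \<and> (\<exists>R. cofibration_retraction W A R)"

lemma closed_cofibration_refl: "closed_cofibration W (topspace W)"
  unfolding closed_cofibration_def cofibration_retraction_def
  by (intro conjI exI[of _ id]) auto

text \<open>\<open>R1\<close> pushes the cylinder into \<open>V\<close>, its bottom together with
  the part over \<open>B\<close>; then \<open>R2\<close> acts over \<open>B\<close> and the identity
  on the bottom. Since \<open>R1\<close> fixes the cylinder over \<open>B\<close>, the composite
  restricts there to exactly \<open>R2\<close>, which allows retractions to be glued along an
  infinite filtration.\<close>

lemma cofibration_retraction_extend:
  assumes B: "closed_cofibration W B" and R2: "cofibration_retraction (subtopology W B) A R2"
    and AB: "A \<subseteq> B"
  obtains R where "cofibration_retraction W A R" "\<And>t b. t \<in> {0..1} \<Longrightarrow> b \<in> B \<Longrightarrow> R (t, b) = R2 (t, b)"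
proof -
  obtain R1 where clB: "closedin W B" and R1: "cofibration_retraction W B R1"
    using B by (auto simp: closed_cofibration_def)
  have BW: "B \<subseteq> topspace W" using clB by (rule closedin_subset)
  let ?P = "prod_topology unit_interval W"
  define V where "V = {z \<in> topspace ?P. fst z = 0 \<or> snd z \<in> B}"
  let ?S = "\<lambda>z. if z \<in> {z \<in> topspace ?P. snd z \<in> B} then R2 z else z"
  have contS: "continuous_map (subtopology ?P V) ?P ?S"
  proof (rule continuous_map_pasting2[where T = "{z \<in> topspace ?P. fst z = 0}"])
    have "closedin ?P {z \<in> topspace ?P. snd z \<in> B}"
      by (rule closedin_continuous_map_preimage[OF continuous_map_snd clB])
    then show "closedin (subtopology ?P V) {z \<in> topspace ?P. snd z \<in> B}"
      by (rule closedin_subset_topspace) (auto simp: V_def)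
    have "closedin ?P {z \<in> topspace ?P. fst z \<in> {0}}"
      by (rule closedin_continuous_map_preimage[OF continuous_map_fst])
         (auto intro: closed_subset)
    then show "closedin (subtopology ?P V) {z \<in> topspace ?P. fst z = 0}"
      by (intro closedin_subset_topspace) (auto simp: V_def)
    show "topspace (subtopology ?P V) \<subseteq> {z \<in> topspace ?P. snd z \<in> B} \<union> {z \<in> topspace ?P. fst z = 0}"
      by (auto simp: V_def)
    have eq: "subtopology (subtopology ?P V) {z \<in> topspace ?P. snd z \<in> B}
              = prod_topology unit_interval (subtopology W B)"
    proof -
      have "V \<inter> {z \<in> topspace ?P. snd z \<in> B} = {0..1} \<times> B"
        using BW by (auto simp: V_def)
      then show ?thesis
        by (simp add: subtopology_subtopology subtopology_Times)
    qed
    show "continuous_map (subtopology (subtopology ?P V) {z \<in> topspace ?P. snd z \<in> B}) ?P R2"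
      unfolding eq by (rule continuous_map_into_prod_fulltopology[OF cofibration_retractionD(1)[OF R2]])
    show "continuous_map (subtopology (subtopology ?P V) {z \<in> topspace ?P. fst z = 0}) ?P (\<lambda>z. z)"
      by (simp add: continuous_map_from_subtopology)
    show "R2 z = z" if "z \<in> {z \<in> topspace ?P. snd z \<in> B}" "z \<in> {z \<in> topspace ?P. fst z = 0}" for z
      using that R2 unfolding cofibration_retraction_def
      by (cases z) auto
  qed
  have mem: "R1 (t, w) \<in> topspace ?P" if "t \<in> {0..1}" "w \<in> topspace W" for t w
    using R1 that unfolding cofibration_retraction_def
    by (intro continuous_map_mem[of ?P ?P R1]) auto
  have contR1: "continuous_map ?P (subtopology ?P V) R1"
  proof (rule continuous_map_into_subtopology)
    show "continuous_map ?P ?P R1" using R1 by (simp add: cofibration_retraction_def)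
    show "R1 \<in> topspace ?P \<rightarrow> V"
    proof
      fix z assume "z \<in> topspace ?P"
      then obtain t w where z: "z = (t, w)" "t \<in> {0..1}" "w \<in> topspace W" by auto
      then have "fst (R1 z) = 0 \<or> snd (R1 z) \<in> B"
        using R1 unfolding cofibration_retraction_def by blast
      then show "R1 z \<in> V" using mem[OF z(2,3)] z(1) by (simp add: V_def)
    qed
  qed
  show ?thesis
  proof (rule that[of "\<lambda>z. ?S (R1 z)"])
    show "cofibration_retraction W A (\<lambda>z. ?S (R1 z))"
      unfolding cofibration_retraction_def
    proof (intro conjI ballI)
      show "continuous_map ?P ?P (\<lambda>z. ?S (R1 z))"
        by (rule continuous_map_compose'[OF contR1 contS])
    next
      fix t :: real and w assume tw: "t \<in> {0..1}" "w \<in> topspace W"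
      have "fst (R1 (t, w)) = 0 \<or> snd (R1 (t, w)) \<in> B"
        using R1 tw unfolding cofibration_retraction_def by blast
      moreover have "fst (R2 (R1 (t, w))) = 0 \<or> snd (R2 (R1 (t, w))) \<in> A"
        if "snd (R1 (t, w)) \<in> B"
        using R2 that mem[OF tw] BW unfolding cofibration_retraction_def
        by (cases "R1 (t, w)") auto
      ultimately show "fst (?S (R1 (t, w))) = 0 \<or> snd (?S (R1 (t, w))) \<in> A"
        using mem[OF tw] by (cases "snd (R1 (t, w)) \<in> B") auto
    next
      fix w assume w: "w \<in> topspace W"
      show "?S (R1 (0, w)) = (0, w)"
      proof (cases "w \<in> B")
        case True
        then have "R2 (0, w) = (0, w)" using cofibration_retractionD(3)[OF R2] w by simp
        then show ?thesis using cofibration_retractionD(3)[OF R1 w] by simp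
      qed (simp add: cofibration_retractionD(3)[OF R1 w])
    next
      fix t :: real and a assume t: "t \<in> {0..1}" and a: "a \<in> A"
      then have "a \<in> B" using AB by blast
      then show "?S (R1 (t, a)) = (t, a)"
        using cofibration_retractionD(4)[OF R1 t] cofibration_retractionD(4)[OF R2 t a] by simp
    qed
    show "?S (R1 (t, b)) = R2 (t, b)" if "t \<in> {0..1}" "b \<in> B" for t b
      using cofibration_retractionD(4)[OF R1 that] that BW by auto
  qed
qed

lemma closed_cofibration_trans:
  assumes "closed_cofibration W B" "closed_cofibration (subtopology W B) A"
  shows "closed_cofibration W A"
proof -
  have "closedin W B" using assms by (auto simp: closed_cofibration_def)
  then have cl: "closedin W A" and "A \<subseteq> B"
    using assms(2) by (auto simp: closed_cofibration_def closedin_closed_subtopology)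
  obtain R2 where "cofibration_retraction (subtopology W B) A R2"
    using assms(2) by (auto simp: closed_cofibration_def)
  from cofibration_retraction_extend[OF assms(1) this \<open>A \<subseteq> B\<close>]
  obtain R where "cofibration_retraction W A R" by metis
  with cl show ?thesis by (auto simp: closed_cofibration_def)
qed

text \<open>The retraction over \<open>W1\<close> is continued by the identity over
  \<open>W2\<close>; it fixes the cylinder over the intersection, so the two agree there.\<close>

lemma closed_cofibration_excision:
  assumes W1: "closedin W W1" and W2: "closedin W W2" and un: "W1 \<union> W2 = topspace W"
    and cof: "closed_cofibration (subtopology W W1) (W1 \<inter> W2)"
  shows "closed_cofibration W W2"
proof -
  obtain R1 where R1: "cofibration_retraction (subtopology W W1) (W1 \<inter> W2) R1"
    using cof by (auto simp: closed_cofibration_def)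
  have sub: "W1 \<subseteq> topspace W" "W2 \<subseteq> topspace W" using W1 W2 by (auto dest: closedin_subset)
  let ?P = "prod_topology unit_interval W"
  let ?R = "\<lambda>z. if z \<in> {0..1} \<times> W1 then R1 z else z"
  have "continuous_map ?P ?P ?R"
  proof (rule continuous_map_pasting2[where T = "{0..1} \<times> W2"])
    show "closedin ?P ({0..1} \<times> W1)" "closedin ?P ({0..1} \<times> W2)"
      using W1 W2 by (auto simp: closedin_prod_Times_iff)
    show "topspace ?P \<subseteq> {0..1} \<times> W1 \<union> {0..1} \<times> W2"
      using un by auto
    have eq: "subtopology ?P ({0..1} \<times> W1) = prod_topology unit_interval (subtopology W W1)"
      by (simp add: subtopology_Times subtopology_subtopology)
    show "continuous_map (subtopology ?P ({0..1} \<times> W1)) ?P R1"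
      unfolding eq by (rule continuous_map_into_prod_fulltopology[OF cofibration_retractionD(1)[OF R1]])
    show "continuous_map (subtopology ?P ({0..1} \<times> W2)) ?P (\<lambda>z. z)"
      by (simp add: continuous_map_from_subtopology)
    show "R1 z = z" if "z \<in> {0..1} \<times> W1" "z \<in> {0..1} \<times> W2" for z
      using that cofibration_retractionD(4)[OF R1, of "fst z" "snd z"] by (simp add: mem_Times_iff)
  qed
  moreover have "fst (?R (t, w)) = 0 \<or> snd (?R (t, w)) \<in> W2" "?R (0, w) = (0, w)"
    if t: "t \<in> {0..1}" and w: "w \<in> topspace W" for t w
    using cofibration_retractionD(2)[OF R1 t, of w] cofibration_retractionD(3)[OF R1, of w] t w un
    by (cases "w \<in> W1"; auto)+
  moreover have "?R (t, a) = (t, a)" if "t \<in> {0..1}" "a \<in> W2" for t a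
    using cofibration_retractionD(4)[OF R1, of t a] that by simp
  moreover have "(0::real) \<in> {0..1}" by simp
  ultimately have "cofibration_retraction W W2 ?R"
    unfolding cofibration_retraction_def by blast
  then show ?thesis using W2 by (auto simp: closed_cofibration_def)
qed

lemma closed_cofibration_times_right:
  assumes "closed_cofibration W A"
  shows "closed_cofibration (prod_topology W V) (A \<times> topspace V)"
proof -
  obtain R where cl: "closedin W A" and R: "cofibration_retraction W A R"
    using assms by (auto simp: closed_cofibration_def)
  have AW: "A \<subseteq> topspace W" using cl by (rule closedin_subset)
  let ?P = "prod_topology unit_interval (prod_topology W V)"
  let ?R = "\<lambda>z. (fst (R (fst z, fst (snd z))), snd (R (fst z, fst (snd z))), snd (snd z))"
  have "continuous_map ?P (prod_topology unit_interval W) (\<lambda>z. R (fst z, fst (snd z)))"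
    by (intro cofibration_retractionD(1)[OF R] continuous_map_compose'[of _ "prod_topology unit_interval W" _ _ R] continuous_map_pairedI continuous_map_fst
        continuous_map_fst'[OF continuous_map_snd]) auto
  then have "continuous_map ?P ?P ?R"
    by (intro continuous_map_pairedI continuous_map_fst'[where Y = W]
        continuous_map_snd'[where X = unit_interval and Y = W]
        continuous_map_snd'[OF continuous_map_snd])
  moreover have "fst (?R (t, z)) = 0 \<or> snd (?R (t, z)) \<in> A \<times> topspace V" "?R (0, z) = (0, z)"
    if t: "t \<in> {0..1}" and z: "z \<in> topspace (prod_topology W V)" for t z
    using cofibration_retractionD(2)[OF R t, of "fst z"] cofibration_retractionD(3)[OF R, of "fst z"] z
    by (simp_all add: mem_Times_iff)
  moreover have "?R (t, z) = (t, z)" if "t \<in> {0..1}" "z \<in> A \<times> topspace V" for t z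
    using cofibration_retractionD(4)[OF R, of t "fst z"] that by (simp add: mem_Times_iff)
  moreover have "(0::real) \<in> {0..1}" by simp
  ultimately have "cofibration_retraction (prod_topology W V) (A \<times> topspace V) ?R"
    unfolding cofibration_retraction_def by blast
  moreover have "closedin (prod_topology W V) (A \<times> topspace V)"
    using cl by (simp add: closedin_prod_Times_iff)
  ultimately show ?thesis by (auto simp: closed_cofibration_def)
qed

lemma closed_cofibration_times_left:
  assumes "closed_cofibration W A"
  shows "closed_cofibration (prod_topology V W) (topspace V \<times> A)"
proof -
  obtain R where cl: "closedin W A" and R: "cofibration_retraction W A R"
    using assms by (auto simp: closed_cofibration_def)
  have AW: "A \<subseteq> topspace W" using cl by (rule closedin_subset)
  let ?P = "prod_topology unit_interval (prod_topology V W)"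
  let ?R = "\<lambda>z. (fst (R (fst z, snd (snd z))), fst (snd z), snd (R (fst z, snd (snd z))))"
  have "continuous_map ?P (prod_topology unit_interval W) (\<lambda>z. R (fst z, snd (snd z)))"
    by (intro cofibration_retractionD(1)[OF R] continuous_map_compose'[of _ "prod_topology unit_interval W" _ _ R] continuous_map_pairedI continuous_map_fst
        continuous_map_snd'[OF continuous_map_snd]) auto
  then have "continuous_map ?P ?P ?R"
    by (intro continuous_map_pairedI continuous_map_fst'[where Y = W]
        continuous_map_snd'[where X = unit_interval and Y = W]
        continuous_map_fst'[OF continuous_map_snd])
  moreover have "fst (?R (t, z)) = 0 \<or> snd (?R (t, z)) \<in> topspace V \<times> A" "?R (0, z) = (0, z)"
    if t: "t \<in> {0..1}" and z: "z \<in> topspace (prod_topology V W)" for t z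
    using cofibration_retractionD(2)[OF R t, of "snd z"] cofibration_retractionD(3)[OF R, of "snd z"] z
    by (simp_all add: mem_Times_iff)
  moreover have "?R (t, z) = (t, z)" if "t \<in> {0..1}" "z \<in> topspace V \<times> A" for t z
    using cofibration_retractionD(4)[OF R, of t "snd z"] that by (simp add: mem_Times_iff)
  moreover have "(0::real) \<in> {0..1}" by simp
  ultimately have "cofibration_retraction (prod_topology V W) (topspace V \<times> A) ?R"
    unfolding cofibration_retraction_def by blast
  moreover have "closedin (prod_topology V W) (topspace V \<times> A)"
    using cl by (simp add: closedin_prod_Times_iff)
  ultimately show ?thesis by (auto simp: closed_cofibration_def)
qed

text \<open>A cell attachment without an explicit pushout: since \<open>P\<close> is compact and
  \<open>W\<close> Hausdorff, \<open>F\<close> times the identity of the interval is a closed map,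
  hence a quotient map onto its image. The retraction \<open>R1\<close> descends along it, because
  points over \<open>B\<close> come from \<open>Q\<close>, where \<open>R1\<close> is the identity,
  and all other points have a single preimage.\<close>

lemma closed_cofibration_attach:
  assumes P: "compact_space P" and W: "Hausdorff_space W" and F: "continuous_map P W F"
    and B: "closedin W B" and cover: "topspace W \<subseteq> B \<union> F ` topspace P"
    and QB: "F ` Q \<subseteq> B" and inj: "inj_on F (topspace P - Q)" and off: "F ` (topspace P - Q) \<inter> B = {}"
    and cof: "closed_cofibration P Q"
  shows "closed_cofibration W B"
proof -
  obtain R1 where clQ: "closedin P Q" and R1: "cofibration_retraction P Q R1"
    using cof by (auto simp: closed_cofibration_def)
  let ?IP = "prod_topology unit_interval P" and ?IW = "prod_topology unit_interval W"
  let ?FP = "F ` topspace P"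
  \<comment> \<open>An inverse of \<open>F\<close>, meaningful only outside \<open>B\<close>, where
    the preimage is unique.\<close>
  define g where "g w = (SOME p. p \<in> topspace P \<and> F p = w)" for w
  have g: "g (F p) = p" if "p \<in> topspace P" "F p \<notin> B" for p
  proof -
    have *: "g (F p) \<in> topspace P \<and> F (g (F p)) = F p"
      unfolding g_def by (rule someI[of _ p]) (use that in auto)
    then have "g (F p) \<in> topspace P - Q" "p \<in> topspace P - Q"
      using that QB by (auto simp: image_subset_iff)
    with * inj show ?thesis by (auto dest: inj_onD)
  qed
  define F1 where "F1 z = (fst z, F (snd z))" for z :: "real \<times> 'a"
  define R where "R z = (if z \<in> {0..1} \<times> B then z else F1 (R1 (fst z, g (snd z))))" for z
  have F1: "F1 (t, p) = (t, F p)" "fst (F1 z) = fst z" "snd (F1 z) = F (snd z)" for t p z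
    by (simp_all add: F1_def)
  have contF1: "continuous_map ?IP ?IW F1"
    unfolding F1_def by (intro continuous_map_pairedI continuous_map_fst continuous_map_compose'[OF continuous_map_snd F])
  have R1Q: "R1 (t, p) = (t, p)" if "t \<in> {0..1}" "p \<in> Q" for t p
    using R1 that unfolding cofibration_retraction_def by blast
  have RF1: "R (F1 (t, p)) = F1 (R1 (t, p))" if "t \<in> {0..1}" "p \<in> topspace P" for t p
  proof (cases "F p \<in> B")
    case True
    then have "p \<in> Q" using off that by auto
    then show ?thesis using True R1Q[OF that(1)] that(1) by (simp add: F1 R_def)
  next
    case False
    then show ?thesis using g[OF that(2)] by (simp add: F1 R_def)
  qed
  have clF: "closedin W ?FP"
    using compactin_imp_closedin[OF W image_compactin[OF P[unfolded compact_space_def] F]] .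
  have q: "quotient_map ?IP (subtopology ?IW ({0..1} \<times> ?FP)) F1"
  proof (rule continuous_closed_imp_quotient_map)
    show c: "continuous_map ?IP (subtopology ?IW ({0..1} \<times> ?FP)) F1"
      by (rule continuous_map_into_subtopology[OF contF1]) (auto simp: F1)
    show "closed_map ?IP (subtopology ?IW ({0..1} \<times> ?FP)) F1"
    proof (rule T1_Spaces.continuous_imp_closed_map[OF c])
      show "compact_space ?IP"
        using P compact_space_unit_interval by (simp add: compact_space_prod_topology)
      show "Hausdorff_space (subtopology ?IW ({0..1} \<times> ?FP))"
        using W Hausdorff_space_unit_interval
        by (intro Hausdorff_space_subtopology) (simp add: Hausdorff_space_prod_topology)
    qed
    show "F1 ` topspace ?IP = topspace (subtopology ?IW ({0..1} \<times> ?FP))"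
    proof -
      have "F1 ` ({0..1} \<times> topspace P) = {0..1} \<times> ?FP"
      proof safe
        show "(t, F p) \<in> F1 ` ({0..1} \<times> topspace P)" if "t \<in> {0..1}" "p \<in> topspace P" for t p
          using that by (intro image_eqI[of _ _ "(t, p)"]) (auto simp: F1)
      qed (auto simp: F1_def)
      then show ?thesis using closedin_subset[OF clF] by auto
    qed
  qed
  have contR: "continuous_map ?IW ?IW (\<lambda>z. if z \<in> {0..1} \<times> B then z else R z)"
  proof (rule continuous_map_pasting2[where T = "{0..1} \<times> ?FP"])
    show "closedin ?IW ({0..1} \<times> B)" "closedin ?IW ({0..1} \<times> ?FP)"
      using B clF by (auto simp: closedin_prod_Times_iff)
    show "topspace ?IW \<subseteq> {0..1} \<times> B \<union> {0..1} \<times> ?FP"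
      using cover by auto
    show "continuous_map (subtopology ?IW ({0..1} \<times> B)) ?IW (\<lambda>z. z)"
      by (simp add: continuous_map_from_subtopology)
    have "continuous_map ?IP ?IW (\<lambda>z. F1 (R1 z))"
      using R1 unfolding cofibration_retraction_def by (intro continuous_map_compose'[OF _ contF1]) auto
    then have "continuous_map ?IP ?IW (R \<circ> F1)"
    proof (rule continuous_map_eq)
      fix z assume "z \<in> topspace ?IP"
      then show "F1 (R1 z) = (R \<circ> F1) z" using RF1[of "fst z" "snd z"] by auto
    qed
    then show "continuous_map (subtopology ?IW ({0..1} \<times> ?FP)) ?IW R"
      by (rule continuous_compose_quotient_map[OF q])
  qed (simp add: R_def)
  have "(\<lambda>z. if z \<in> {0..1} \<times> B then z else R z) = R"
    by (simp add: R_def fun_eq_iff)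
  with contR have contR: "continuous_map ?IW ?IW R" by simp
  have RB: "R (t, w) = (t, w)" if "t \<in> {0..1}" "w \<in> B" for t w
    using that by (simp add: R_def)
  have "cofibration_retraction W B R"
    unfolding cofibration_retraction_def
  proof (intro conjI ballI contR)
    fix t :: real and w assume t: "t \<in> {0..1}" and w: "w \<in> topspace W"
    show "fst (R (t, w)) = 0 \<or> snd (R (t, w)) \<in> B"
    proof (cases "w \<in> B")
      case False
      then obtain p where p: "p \<in> topspace P" "w = F p" using cover w by auto
      then have "fst (R1 (t, p)) = 0 \<or> snd (R1 (t, p)) \<in> Q"
        using R1 t unfolding cofibration_retraction_def by blast
      moreover have "R (t, w) = F1 (R1 (t, p))" using RF1[OF t p(1)] p by (simp only: F1)
      ultimately show ?thesis using QB by (auto simp: F1)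
    qed (use RB t in auto)
  next
    fix w assume w: "w \<in> topspace W"
    show "R (0, w) = (0, w)"
    proof (cases "w \<in> B")
      case False
      then obtain p where p: "p \<in> topspace P" "w = F p" using cover w by auto
      then have "R1 (0, p) = (0, p)"
        using R1 unfolding cofibration_retraction_def by blast
      moreover have "R (0, w) = F1 (R1 (0, p))" using RF1[of 0 p] p by (simp add: F1(1))
      ultimately show ?thesis using p by (simp add: F1)
    qed (use RB in auto)
  qed (use RB in simp)
  then show ?thesis using B by (auto simp: closed_cofibration_def)
qed

text \<open>The weak topology survives the product with the interval because the interval is locally
  compact. Around \<open>t0\<close> a compact neighbourhood \<open>J\<close> is chosen; by the tube
  lemma, the set \<open>S\<close> of all points \<open>y\<close> with \<open>F (J x {y})\<close>
  inside \<open>U\<close> is open in every stage \<open>A k\<close>, hence open in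
  \<open>W\<close>.\<close>

lemma continuous_map_weak_prod:
  assumes weak: "\<And>S. S \<subseteq> topspace W \<Longrightarrow> (\<And>n::nat. openin (subtopology W (A n)) (S \<inter> A n)) \<Longrightarrow> openin W S"
    and un: "topspace W \<subseteq> (\<Union>n. A n)" and sub: "\<And>n. A n \<subseteq> topspace W"
    and F: "\<And>n. continuous_map (prod_topology unit_interval (subtopology W (A n))) T F"
  shows "continuous_map (prod_topology unit_interval W) T F"
proof -
  let ?IW = "prod_topology unit_interval W"
  have FT: "F z \<in> topspace T" if "z \<in> topspace ?IW" for z
  proof -
    obtain t w where tw: "z = (t, w)" by (cases z)
    with that have z: "z = (t, w)" "t \<in> {0..1}" "w \<in> topspace W" by simp_all
    then obtain n where "w \<in> A n" using un by blast
    then have "z \<in> topspace (prod_topology unit_interval (subtopology W (A n)))"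
      using z by simp
    then show ?thesis by (rule continuous_map_mem[OF F])
  qed
  moreover have "openin ?IW {z \<in> topspace ?IW. F z \<in> U}" if U: "openin T U" for U
  proof (subst openin_subopen, clarsimp)
    fix t0 y0 assume t0: "0 \<le> t0" "t0 \<le> 1" and y0: "y0 \<in> topspace W" and FU: "F (t0, y0) \<in> U"
    have op: "openin (prod_topology unit_interval (subtopology W (A n)))
        {z \<in> {0..1} \<times> A n. F z \<in> U}" for n
    proof -
      have "{z \<in> topspace (prod_topology unit_interval (subtopology W (A n))). F z \<in> U}
          = {z \<in> {0..1} \<times> A n. F z \<in> U}" using sub[of n] by auto
      then show ?thesis
        using openin_continuous_map_preimage[OF F[of n] U] by simp
    qed
    obtain n where n: "y0 \<in> A n" using y0 un by auto
    have "continuous_map unit_interval (prod_topology unit_interval (subtopology W (A n))) (\<lambda>t. (t, y0))"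
      using n y0 by (intro continuous_map_pairedI) auto
    from openin_continuous_map_preimage[OF this op[of n]]
    have "openin unit_interval {t \<in> topspace unit_interval. (t, y0) \<in> {z \<in> {0..1} \<times> A n. F z \<in> U}}" .
    also have "{t \<in> topspace unit_interval. (t, y0) \<in> {z \<in> {0..1} \<times> A n. F z \<in> U}}
        = {t \<in> {0..1}. F (t, y0) \<in> U}" using n by auto
    finally have "openin unit_interval {t \<in> {0..1}. F (t, y0) \<in> U}" .
    then obtain O' where O': "open O'" "{t \<in> {0..1}. F (t, y0) \<in> U} = {0..1} \<inter> O'"
      unfolding openin_open by blast
    have "t0 \<in> {t \<in> {0..1}. F (t, y0) \<in> U}" using t0 FU by simp
    then have "t0 \<in> O'" unfolding O'(2) by blast
    then obtain e where e: "e > 0" "cball t0 e \<subseteq> O'"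
      using O'(1) open_contains_cball by blast
    define J where "J = {0..1} \<inter> cball t0 e"
    have cJ: "compactin unit_interval J"
      unfolding J_def by (auto simp: compactin_subtopology intro: compact_Int)
    define S where "S = {y \<in> topspace W. \<forall>t\<in>J. F (t, y) \<in> U}"
    have "openin W S"
    proof (rule weak)
      fix k
      show "openin (subtopology W (A k)) (S \<inter> A k)"
      proof (subst openin_subopen, clarify)
        fix y assume y: "y \<in> S" "y \<in> A k"
        have "J \<times> {y} \<subseteq> {z \<in> {0..1} \<times> A k. F z \<in> U}"
          using y by (auto simp: S_def J_def)
        from tube_lemma_left[OF op[of k] cJ _ this] obtain U' V' where UV: "openin (subtopology W (A k)) V'"
            "J \<subseteq> U'" "y \<in> V'" "U' \<times> V' \<subseteq> {z \<in> {0..1} \<times> A k. F z \<in> U}"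
          using y sub[of k] by (auto simp: S_def)
        then show "\<exists>T. openin (subtopology W (A k)) T \<and> y \<in> T \<and> T \<subseteq> S \<inter> A k"
          using openin_subset[OF UV(1)] by (intro exI[of _ V']) (auto simp: S_def)
      qed
    qed (auto simp: S_def)
    moreover have "openin unit_interval ({0..1} \<inter> ball t0 e)"
      by (simp add: openin_open_Int)
    ultimately have "openin ?IW (({0..1} \<inter> ball t0 e) \<times> S)"
      by (simp add: openin_prod_Times_iff)
    moreover have "t0 \<in> {0..1} \<inter> ball t0 e" using t0 e by auto
    moreover have "y0 \<in> S"
    proof -
      have "J \<subseteq> {t \<in> {0..1}. F (t, y0) \<in> U}" unfolding O'(2) J_def using e(2) by blast
      then show ?thesis using y0 by (auto simp: S_def)
    qed
    moreover have "({0..1} \<inter> ball t0 e) \<times> S \<subseteq> {z. z \<in> {0..1} \<times> topspace W \<and> F z \<in> U}"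
    proof (clarify)
      fix t y assume t: "t \<in> {0..1}" "t \<in> ball t0 e" and y: "y \<in> S"
      have "t \<in> J" using t by (simp add: J_def)
      then show "(t, y) \<in> {0..1} \<times> topspace W \<and> F (t, y) \<in> U"
        using y t by (simp add: S_def)
    qed
    ultimately show "\<exists>T. openin ?IW T \<and> (t0, y0) \<in> T \<and>
         T \<subseteq> {z. z \<in> {0..1} \<times> topspace W \<and> F z \<in> U}" by blast
  qed
  ultimately show ?thesis by (auto simp: continuous_map_def)
qed

text \<open>The retractions \<open>C n\<close> of the stages are chosen one after the other, each
  extending the previous one strictly and not just up to homotopy. Their union is thus a function,
  and its continuity can be tested on the stages.\<close>

lemma closed_cofibration_sequence:
  assumes weak: "\<And>S. S \<subseteq> topspace W \<Longrightarrow> (\<And>n::nat. openin (subtopology W (A n)) (S \<inter> A n)) \<Longrightarrow> openin W S"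
    and un: "topspace W \<subseteq> (\<Union>n. A n)" and cl: "\<And>n. closedin W (A n)"
    and mono: "\<And>n. A n \<subseteq> A (Suc n)"
    and cof: "\<And>n. closed_cofibration (subtopology W (A (Suc n))) (A n)"
  shows "closed_cofibration W (A 0)"
proof -
  have sub: "A n \<subseteq> topspace W" for n using cl by (rule closedin_subset)
  have le: "A m \<subseteq> A n" if "m \<le> n" for m n using lift_Suc_mono_le[of A, OF mono that] .
  let ?r = "\<lambda>n. cofibration_retraction (subtopology W (A n)) (A 0)"
  have "\<exists>C. \<forall>n. ?r n (C n) \<and> (\<forall>t\<in>{0..1}. \<forall>w\<in>A n. C (Suc n) (t, w) = C n (t, w))"
  proof (rule dependent_nat_choice)
    have "?r 0 id" unfolding cofibration_retraction_def by auto
    then show "\<exists>C. ?r 0 C" by blast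
  next
    fix C and n assume C: "?r n C"
    have eq: "subtopology (subtopology W (A (Suc n))) (A n) = subtopology W (A n)"
      using mono[of n] by (simp add: subtopology_subtopology Int_absorb1)
    show "\<exists>C'. ?r (Suc n) C' \<and> (\<forall>t\<in>{0..1}. \<forall>w\<in>A n. C' (t, w) = C (t, w))"
    proof -
      obtain C' where "?r (Suc n) C'" "\<And>t b. t \<in> {0..1} \<Longrightarrow> b \<in> A n \<Longrightarrow> C' (t, b) = C (t, b)"
        by (rule cofibration_retraction_extend[OF cof[of n], unfolded eq, OF C]) (use le[of 0 n] in auto)
      then show ?thesis by blast
    qed
  qed
  then obtain C where C: "\<And>n. ?r n (C n)"
    and CS: "\<And>n t w. t \<in> {0..1} \<Longrightarrow> w \<in> A n \<Longrightarrow> C (Suc n) (t, w) = C n (t, w)" by blast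
  have Cle: "C n (t, w) = C m (t, w)" if "m \<le> n" "t \<in> {0..1}" "w \<in> A m" for m n t w
    using that(1)
  proof (induction n rule: dec_induct)
    case (step n)
    then show ?case using CS[of t w n] that le[of m n] by auto
  qed simp
  define R where "R z = C (LEAST n. snd z \<in> A n) z" for z
  have R: "R (t, w) = C n (t, w)" if "t \<in> {0..1}" "w \<in> A n" for n t w
  proof -
    have "w \<in> A (LEAST n. w \<in> A n)" "(LEAST n. w \<in> A n) \<le> n"
      using that by (auto intro: LeastI Least_le)
    then show ?thesis using Cle that by (simp add: R_def)
  qed
  have top: "topspace (subtopology W (A n)) = A n" for n using sub[of n] by auto
  have "continuous_map (prod_topology unit_interval W) (prod_topology unit_interval W) R"
  proof (rule continuous_map_weak_prod[of W A, OF weak un sub])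
    fix n
    have "continuous_map (prod_topology unit_interval (subtopology W (A n)))
             (prod_topology unit_interval W) (C n)"
      by (rule continuous_map_into_prod_fulltopology[OF cofibration_retractionD(1)[OF C]])
    then show "continuous_map (prod_topology unit_interval (subtopology W (A n)))
             (prod_topology unit_interval W) R"
    proof (rule continuous_map_eq)
      fix z assume "z \<in> topspace (prod_topology unit_interval (subtopology W (A n)))"
      then show "C n z = R z" using R[of "fst z" "snd z" n] by (simp add: mem_Times_iff)
    qed
  qed auto
  moreover have "fst (R (t, w)) = 0 \<or> snd (R (t, w)) \<in> A 0" "R (0, w) = (0, w)"
    if t: "t \<in> {0..1}" and w: "w \<in> topspace W" for t w
  proof -
    obtain n where n: "w \<in> A n" using w un by auto
    then have "w \<in> topspace (subtopology W (A n))" using top by simp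
    from cofibration_retractionD(2)[OF C t this] cofibration_retractionD(3)[OF C this]
    show "fst (R (t, w)) = 0 \<or> snd (R (t, w)) \<in> A 0" "R (0, w) = (0, w)"
      using R[OF t n] R[of 0, OF _ n] by simp_all
  qed
  moreover have "R (t, w) = (t, w)" if t: "t \<in> {0..1}" and w: "w \<in> A 0" for t w
    using cofibration_retractionD(4)[OF C t w] R[OF t w] by simp
  moreover have "(0::real) \<in> {0..1}" by simp
  ultimately have "cofibration_retraction W (A 0) R"
    unfolding cofibration_retraction_def by blast
  then show ?thesis using cl by (auto simp: closed_cofibration_def)
qed

section \<open>Discs\<close>

text \<open>Made for expressions containing a unit direction \<open>(y - x) / r\<close>, which has
  no limit where \<open>r\<close> vanishes, multiplied by a coefficient that tends to zero at least
  linearly in \<open>r\<close>.\<close>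

lemma continuous_on_squeeze_zero:
  fixes T r :: "'a::topological_space \<Rightarrow> real"
  assumes r: "continuous_on S r" and bound: "\<And>z. z \<in> S \<Longrightarrow> \<bar>T z\<bar> \<le> C * \<bar>r z\<bar>"
    and T: "continuous_on (S \<inter> {z. r z \<noteq> 0}) T"
  shows "continuous_on S T"
  unfolding continuous_on_def
proof
  fix z assume z: "z \<in> S"
  show "(T \<longlongrightarrow> T z) (at z within S)"
  proof (cases "r z = 0")
    case True
    then have "T z = 0" using bound[OF z] by simp
    moreover have "((\<lambda>w. C * \<bar>r w\<bar>) \<longlongrightarrow> C * \<bar>r z\<bar>) (at z within S)"
      using r z by (auto simp: continuous_on_def intro!: tendsto_intros)
    moreover have "\<forall>\<^sub>F w in at z within S. norm (T w) \<le> C * \<bar>r w\<bar>"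
      unfolding eventually_at_topological using bound by (intro exI[of _ UNIV]) auto
    ultimately show ?thesis
      using True Lim_null_comparison[of T "\<lambda>w. C * \<bar>r w\<bar>"] by simp
  next
    case False
    obtain O' where O': "open O'" "O' \<inter> S = r -` (- {0}) \<inter> S"
      using r unfolding continuous_on_open_invariant by (metis open_Compl closed_singleton)
    have eq: "S \<inter> {z. r z \<noteq> 0} = S \<inter> O'"
      using O'(2) by blast
    have "(T \<longlongrightarrow> T z) (at z within S \<inter> O')"
      using T z False O'(2) unfolding continuous_on_def eq by auto
    moreover have "at z within S \<inter> O' = at z within S"
      using z False O' by (intro at_within_nhd[of z O']) auto
    ultimately show ?thesis by simp
  qed
qed

text \<open>The point set of \<open>disc n\<close>, written with \<open>L2_set\<close> to have the
  norm inequalities at hand, and as a subset of the whole function type to be able to use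
  \<open>continuous_on\<close>.\<close>

definition disc_set :: "nat \<Rightarrow> (nat \<Rightarrow> real) set" where
  "disc_set n = {x. (\<forall>i\<ge>n. x i = 0) \<and> L2_set x {..<n} \<le> 1}"

lemma disc_eq: "disc n = top_of_set (disc_set n)"
proof -
  have "{x. \<forall>i\<ge>n. x i = 0} \<inter> {x. (\<Sum>i<n. (x i)\<^sup>2) \<le> 1} = disc_set n"
    by (auto simp: disc_set_def L2_set_def)
  then show ?thesis
    by (simp add: disc_def Euclidean_space_def subtopology_subtopology euclidean_product_topology)
qed

lemma topspace_disc [simp]: "topspace (disc n) = disc_set n"
  by (simp add: disc_eq)

lemma disc_boundary_eq: "disc_boundary n = {x \<in> disc_set n. L2_set x {..<n} = 1}"
  by (auto simp: disc_boundary_def L2_set_def)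

lemma disc_interior_eq: "disc_interior n = disc_set n - disc_boundary n"
  by (auto simp: disc_interior_def disc_boundary_eq disc_set_def L2_set_def)

lemma continuous_on_coordinate:
  "continuous_on S f \<Longrightarrow> continuous_on S (\<lambda>z. (f z :: 'b \<Rightarrow> 'c::topological_space) i)"
  by (rule continuous_on_product_then_coordinatewise)

lemma continuous_on_L2_set:
  fixes f :: "'a::topological_space \<Rightarrow> nat \<Rightarrow> real"
  assumes "\<And>i. continuous_on S (\<lambda>z. f z i)"
  shows "continuous_on S (\<lambda>z. L2_set (f z) A)"
  unfolding L2_set_def by (intro continuous_intros assms)

lemma closed_L2_set_le: "closed {x :: nat \<Rightarrow> real. L2_set x A \<le> c}"
  by (intro closed_Collect_le continuous_on_L2_set continuous_on_const)
     (auto intro: continuous_on_product_coordinates)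

lemma closed_L2_set_eq: "closed {x :: nat \<Rightarrow> real. L2_set x A = c}"
  by (intro closed_Collect_eq continuous_on_L2_set continuous_on_const)
     (auto intro: continuous_on_product_coordinates)

text \<open>It is closed and lies in a product of intervals, since every coordinate is bounded by
  the norm.\<close>

lemma compact_disc_set: "compact (disc_set n)"
proof -
  have "compactin (product_topology (\<lambda>_. euclideanreal) UNIV) (PiE UNIV (\<lambda>_::nat. {-1..1}))"
    by (simp add: compactin_PiE)
  then have c: "compact (PiE UNIV (\<lambda>_::nat. {-1..1::real}))"
    by (simp add: euclidean_product_topology)
  have "closed (\<Inter>i\<in>{n..}. {x :: nat \<Rightarrow> real. x i = 0})"
    by (intro closed_INT ballI closed_Collect_eq continuous_on_const continuous_on_product_coordinates)
  then have "closed ((\<Inter>i\<in>{n..}. {x :: nat \<Rightarrow> real. x i = 0}) \<inter> {x. L2_set x {..<n} \<le> 1})"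
    by (intro closed_Int closed_L2_set_le)
  also have "(\<Inter>i\<in>{n..}. {x :: nat \<Rightarrow> real. x i = 0}) \<inter> {x. L2_set x {..<n} \<le> 1} = disc_set n"
    by (auto simp: disc_set_def)
  finally have "closed (disc_set n)" .
  moreover have "disc_set n \<subseteq> PiE UNIV (\<lambda>_. {-1..1})"
  proof
    fix x assume x: "x \<in> disc_set n"
    have "\<bar>x i\<bar> \<le> 1" for i
    proof (cases "i < n")
      case True
      then have "\<bar>x i\<bar> \<le> L2_set (\<lambda>i. \<bar>x i\<bar>) {..<n}"
        by (intro member_le_L2_set) auto
      also have "\<dots> = L2_set x {..<n}" by (simp add: L2_set_def)
      finally show ?thesis using x by (simp add: disc_set_def)
    qed (use x in \<open>simp add: disc_set_def\<close>)
    then show "x \<in> PiE UNIV (\<lambda>_. {-1..1})" by (auto simp: abs_le_iff minus_le_iff)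
  qed
  ultimately show ?thesis
    using compact_Int_closed[OF c] by (metis Int_absorb1)
qed

lemma compact_space_disc: "compact_space (disc n)"
  using compact_disc_set[of n] by (simp add: disc_eq compact_space_subtopology)

lemma L2_set_cmult: "L2_set (\<lambda>i. c * x i) A = \<bar>c\<bar> * L2_set x A" for x :: "nat \<Rightarrow> real"
  by (simp add: L2_set_def power_mult_distrib real_sqrt_mult flip: sum_distrib_left)

lemma L2_set_divide: "L2_set (\<lambda>i. x i / c) A = L2_set x A / \<bar>c\<bar>" for x :: "nat \<Rightarrow> real"
  using L2_set_cmult[of "inverse c" x A] by (simp add: divide_inverse mult.commute)

text \<open>Central projection of the cylinder from the point at height \<open>2\<close> above the centre.\<close>

lemma closed_cofibration_disc_boundary: "closed_cofibration (disc n) (disc_boundary n)"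
proof -
  \<comment> \<open>The ray from the centre \<open>(2, 0)\<close> through \<open>(s, x)\<close>
    consists of the points \<open>(2 + (s - 2) / c, x / c)\<close>, with \<open>(s, x)\<close>
    itself at \<open>c = 1\<close>. It meets the wall at \<open>c = |x|\<close> and the bottom at
    \<open>c = (2 - s) / 2\<close>; the first hit belongs to the larger value. The bound
    \<open>\<mu> \<ge> 1/2\<close> follows from \<open>s \<le> 1\<close>.\<close>
  define \<mu> where "\<mu> z = max (L2_set (snd z) {..<n}) ((2 - fst z) / 2)" for z :: "real \<times> (nat \<Rightarrow> real)"
  define R where "R z = (2 + (fst z - 2) / \<mu> z, (\<lambda>i. snd z i / \<mu> z))" for z
  let ?S = "{0..1::real} \<times> disc_set n"
  have \<mu>: "\<mu> z \<ge> 1/2" if "z \<in> ?S" for z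
    using that by (auto simp: \<mu>_def le_max_iff_disj)
  have cont: "continuous_on ?S R"
  proof -
    have c: "continuous_on ?S (\<lambda>z. snd z i)" for i
      by (rule continuous_on_coordinate) (rule continuous_on_snd[OF continuous_on_id])
    have cm: "continuous_on ?S \<mu>"
      unfolding \<mu>_def by (intro continuous_on_max continuous_on_L2_set c continuous_intros) auto
    have nz: "\<forall>z\<in>?S. \<mu> z \<noteq> 0" using \<mu> by fastforce
    have "continuous_on ?S (\<lambda>z. 2 + (fst z - 2) / \<mu> z)"
      by (intro continuous_on_add continuous_on_divide continuous_on_diff continuous_on_const
          continuous_on_fst continuous_on_id cm nz)
    moreover have "continuous_on ?S (\<lambda>z i. snd z i / \<mu> z)"
      by (intro continuous_on_coordinatewise_then_product continuous_on_divide c cm nz)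
    ultimately show ?thesis unfolding R_def by (rule continuous_on_Pair)
  qed
  have R: "fst (R (s, x)) \<in> {0..1} \<and> snd (R (s, x)) \<in> disc_set n \<and>
      (fst (R (s, x)) = 0 \<or> snd (R (s, x)) \<in> disc_boundary n)"
    if "s \<in> {0..1}" "x \<in> disc_set n" for s x
  proof -
    let ?m = "\<mu> (s, x)"
    have m: "?m \<ge> 1/2" "?m \<ge> L2_set x {..<n}" "?m \<ge> (2 - s) / 2" "?m \<le> 1"
      using \<mu>[of "(s, x)"] that by (auto simp: \<mu>_def disc_set_def)
    have m_eq: "?m = L2_set x {..<n} \<or> ?m = (2 - s) / 2"
      by (simp add: \<mu>_def max_def)
    have "(2 - s) * ?m \<le> 2 - s" using m that by (intro mult_left_le) auto
    then have "(2 - s) / ?m \<le> 2" "(2 - s) / ?m \<ge> 2 - s"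
      using m by (simp_all add: field_simps)
    then have h: "fst (R (s, x)) \<in> {0..1}"
      using that by (simp add: R_def minus_divide_left[symmetric] diff_divide_distrib)
    have L: "L2_set (snd (R (s, x))) {..<n} = L2_set x {..<n} / ?m"
      using m by (simp add: R_def L2_set_divide)
    then have d: "snd (R (s, x)) \<in> disc_set n"
      using m that by (auto simp: disc_set_def R_def divide_le_eq)
    from m_eq have "fst (R (s, x)) = 0 \<or> snd (R (s, x)) \<in> disc_boundary n"
    proof
      assume "?m = L2_set x {..<n}"
      then show ?thesis using d L m(1) by (simp add: disc_boundary_eq)
    next
      assume *: "?m = (2 - s) / 2"
      have "2 - s \<noteq> 0" using that by auto
      then have "fst (R (s, x)) = 0" unfolding R_def fst_conv * by (simp add: field_simps)
      then show ?thesis ..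
    qed
    with h d show ?thesis by blast
  qed
  have id: "R (s, x) = (s, x)" if "s \<in> {0..1}" "x \<in> disc_set n" "s = 0 \<or> x \<in> disc_boundary n" for s x
  proof -
    have "\<mu> (s, x) = 1" using that by (auto simp: \<mu>_def disc_boundary_eq disc_set_def)
    then show ?thesis by (simp add: R_def)
  qed
  have "cofibration_retraction (disc n) (disc_boundary n) R"
    unfolding cofibration_retraction_def
  proof (intro conjI ballI)
    have "R \<in> ?S \<rightarrow> ?S"
    proof
      fix z :: "real \<times> (nat \<Rightarrow> real)" assume "z \<in> ?S"
      then show "R z \<in> ?S" using R[of "fst z" "snd z"] by (simp add: mem_Times_iff)
    qed
    with cont have "continuous_map (top_of_set ?S) (top_of_set ?S) R" by simp
    then show "continuous_map (prod_topology unit_interval (disc n)) (prod_topology unit_interval (disc n)) R"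
      by (simp add: disc_eq)
  next
    fix t :: real and w assume "t \<in> {0..1}" "w \<in> topspace (disc n)"
    then show "fst (R (t, w)) = 0 \<or> snd (R (t, w)) \<in> disc_boundary n" using R[of t w] by simp
  next
    fix w assume "w \<in> topspace (disc n)"
    then show "R (0, w) = (0, w)" using id[of 0 w] by simp
  next
    fix t :: real and a assume "t \<in> {0..1}" "a \<in> disc_boundary n"
    then show "R (t, a) = (t, a)" using id[of t a] by (simp add: disc_boundary_eq)
  qed
  moreover have "closedin (disc n) (disc_boundary n)"
  proof -
    have "disc_boundary n = disc_set n \<inter> {x. L2_set x {..<n} = 1}" by (auto simp: disc_boundary_eq)
    then show ?thesis
      unfolding disc_eq by (simp only: closedin_closed_Int closed_L2_set_eq)
  qed
  ultimately show ?thesis by (auto simp: closed_cofibration_def)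
qed

text \<open>Away from the diagonal, the pairs \<open>(x, y)\<close> with a fixed direction \<open>\<delta>\<close> from \<open>x\<close> to \<open>y\<close> form a
  convex set, in which one projects centrally from \<open>(0, \<delta>/2)\<close>. The projected second component is
  truncated to the disc, so that \<open>2\<bar>y\<bar> - 1\<close>, a lower bound for the gauge of the disc around
  \<open>\<delta>/2\<close>, can be used instead of the gauge itself.\<close>

lemma closed_cofibration_disc_square:
  "closed_cofibration (prod_topology (disc n) (disc n))
     {(x, y). x \<in> disc_set n \<and> y \<in> disc_set n \<and> (x \<in> disc_boundary n \<or> y \<in> disc_boundary n \<or> x = y)}"
    (is "closed_cofibration ?D ?A")
proof -
  define N where "N x = L2_set x {..<n}" for x :: "nat \<Rightarrow> real"
  define r where "r z = N (\<lambda>i. fst (snd z) i - snd (snd z) i)" for z :: "real \<times> (nat \<Rightarrow> real) \<times> (nat \<Rightarrow> real)"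
  \<comment> \<open>The four terms stand for the four pieces to be hit: the bottom, \<open>x\<close>
    on the sphere, \<open>y\<close> on the sphere, and the diagonal. Projection from
    \<open>\<delta>/2\<close> takes \<open>y\<close> to
    \<open>y / \<mu> + (1 - 1 / \<mu>) \<delta>/2\<close>, the second summand being
    \<open>T\<close>. The difference of the projected points is then
    \<open>(2 r + \<mu> - 1) / (2 \<mu>)\<close> times \<open>\<delta>\<close>, which vanishes for
    \<open>\<mu> = 1 - 2 r\<close>.\<close>
  define \<mu> where "\<mu> z = max (max ((2 - fst z) / 2) (N (fst (snd z)))) (max (2 * N (snd (snd z)) - 1) (1 - 2 * r z))"
    for z :: "real \<times> (nat \<Rightarrow> real) \<times> (nat \<Rightarrow> real)"
  define T where "T z i = (1 - 1 / \<mu> z) * ((snd (snd z) i - fst (snd z) i) / r z / 2)" for z i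
  define Y where "Y z i = snd (snd z) i / \<mu> z + T z i" for z i
  define R where "R z = (2 + (fst z - 2) / \<mu> z, (\<lambda>i. fst (snd z) i / \<mu> z), (\<lambda>i. Y z i / max 1 (N (Y z))))" for z
  let ?S = "{0..1::real} \<times> disc_set n \<times> disc_set n"
  have Dn: "x \<in> disc_set n \<longleftrightarrow> (\<forall>i\<ge>n. x i = 0) \<and> N x \<le> 1" for x
    by (simp add: disc_set_def N_def)
  have Bn: "x \<in> disc_boundary n \<longleftrightarrow> x \<in> disc_set n \<and> N x = 1" for x
    by (auto simp: disc_boundary_eq N_def)
  have N0: "N x \<ge> 0" for x by (simp add: N_def)
  have Ndiv: "N (\<lambda>i. x i / c) = N x / \<bar>c\<bar>" for x c by (simp add: N_def L2_set_divide)
  have Ncm: "N (\<lambda>i. c * x i) = \<bar>c\<bar> * N x" for x c by (simp add: N_def L2_set_cmult)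
  have Ntri: "N (\<lambda>i. x i + y i) \<le> N x + N y" for x y by (simp add: N_def L2_set_triangle_ineq)
  have r0: "r z \<ge> 0" for z by (simp add: r_def N0)
  have \<mu>: "\<mu> z \<ge> 1/2" "\<mu> z \<le> 1" "1 - \<mu> z \<le> 2 * r z" if "z \<in> ?S" for z
    using that r0[of z] by (auto simp: \<mu>_def Dn le_max_iff_disj)
  have nd: "N (\<lambda>i. y i - x i) = N (\<lambda>i. x i - y i)" for x y
    by (simp add: N_def L2_set_def power2_commute)
  have r_coord: "\<bar>y i - x i\<bar> \<le> r (s, x, y)" if "x \<in> disc_set n" "y \<in> disc_set n" for s x y i
  proof (cases "i < n")
    case True
    have "\<bar>y i - x i\<bar> \<le> L2_set (\<lambda>i. \<bar>y i - x i\<bar>) {..<n}"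
      by (rule member_le_L2_set) (use True in auto)
    also have "\<dots> = N (\<lambda>i. y i - x i)" by (simp add: N_def L2_set_def)
    finally show ?thesis unfolding nd[of y x] by (simp add: r_def)
  qed (use that r0 in \<open>simp add: Dn\<close>)
  have cont: "continuous_on ?S R"
  proof -
    have cx: "continuous_on U (\<lambda>z. fst (snd z) i)" and cy: "continuous_on U (\<lambda>z. snd (snd z) i)"
      for i and U :: "(real \<times> (nat \<Rightarrow> real) \<times> (nat \<Rightarrow> real)) set"
      by (rule continuous_on_coordinate[where f = "\<lambda>z. fst (snd z)"]
            continuous_on_coordinate[where f = "\<lambda>z. snd (snd z)"],
          intro continuous_on_fst continuous_on_snd continuous_on_id)+
    have cr: "continuous_on U r" for U
      unfolding r_def N_def by (intro continuous_on_L2_set continuous_on_diff cx cy)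
    have cm: "continuous_on U \<mu>" for U
      unfolding \<mu>_def N_def
      by (intro continuous_on_max continuous_on_divide continuous_on_diff continuous_on_mult continuous_on_const
          continuous_on_fst continuous_on_id continuous_on_L2_set cx cy cr) auto
    have nz: "\<forall>z\<in>?S. \<mu> z \<noteq> 0" using \<mu>(1) by fastforce
    \<comment> \<open>On the diagonal the direction is a division by zero, with value
      \<open>0\<close>. Nearby its coordinates stay bounded, while
      \<open>1 - \<mu> \<le> 2 r\<close> makes the coefficient \<open>1 - 1 / \<mu>\<close> at most
      \<open>4 r\<close> in absolute value.\<close>
    have cT: "continuous_on ?S (\<lambda>z. T z i)" for i
    proof (rule continuous_on_squeeze_zero[OF cr])
      fix z assume z: "z \<in> ?S"
      then obtain s x y where zz: "z = (s, x, y)" "x \<in> disc_set n" "y \<in> disc_set n" by auto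
      have "\<bar>1 - 1 / \<mu> z\<bar> = (1 - \<mu> z) / \<mu> z" using \<mu>[OF z] by (simp add: field_simps)
      also have "\<dots> \<le> (2 * r z) / (1/2)" using \<mu>[OF z] r0[of z] by (intro frac_le) auto
      finally have 1: "\<bar>1 - 1 / \<mu> z\<bar> \<le> 4 * r z" by simp
      have 2: "\<bar>(snd (snd z) i - fst (snd z) i) / r z / 2\<bar> \<le> 1"
      proof (cases "r z = 0")
        case False
        then show ?thesis using r_coord[OF zz(2,3), of i s] r0[of z] by (simp add: zz(1) divide_le_eq)
      qed simp
      have "\<bar>T z i\<bar> \<le> (4 * r z) * 1"
        unfolding T_def abs_mult using 1 2 r0[of z] by (intro mult_mono) auto
      then show "\<bar>T z i\<bar> \<le> 4 * \<bar>r z\<bar>" using r0[of z] by simp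
    next
      show "continuous_on (?S \<inter> {z. r z \<noteq> 0}) (\<lambda>z. T z i)"
        unfolding T_def
        by (intro continuous_on_mult continuous_on_diff continuous_on_divide continuous_on_const cx cy cr cm)
           (use nz in auto)
    qed
    have cY: "continuous_on ?S (\<lambda>z. Y z i)" for i
      unfolding Y_def by (intro continuous_on_add continuous_on_divide cy cm cT nz)
    have "continuous_on ?S (\<lambda>z. max 1 (N (Y z)))"
      unfolding N_def by (intro continuous_on_max continuous_on_const continuous_on_L2_set cY)
    then have "continuous_on ?S (\<lambda>z i. Y z i / max 1 (N (Y z)))"
      by (intro continuous_on_coordinatewise_then_product continuous_on_divide cY) auto
    moreover have "continuous_on ?S (\<lambda>z i. fst (snd z) i / \<mu> z)"
      by (intro continuous_on_coordinatewise_then_product continuous_on_divide cx cm nz)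
    moreover have "continuous_on ?S (\<lambda>z. 2 + (fst z - 2) / \<mu> z)"
      by (intro continuous_on_add continuous_on_divide continuous_on_diff continuous_on_const
          continuous_on_fst continuous_on_id cm nz)
    ultimately show ?thesis unfolding R_def by (intro continuous_on_Pair)
  qed
  have R: "R (s, x, y) \<in> ?S \<and> (fst (R (s, x, y)) = 0 \<or> snd (R (s, x, y)) \<in> ?A)"
    if s: "s \<in> {0..1}" and x: "x \<in> disc_set n" and y: "y \<in> disc_set n" for s x y
  proof -
    define m where "m = \<mu> (s, x, y)"
    define \<rho> where "\<rho> = r (s, x, y)"
    have m: "m \<ge> 1/2" "m \<le> 1" using \<mu>[of "(s, x, y)"] s x y by (auto simp: m_def)
    have m_ge: "m \<ge> (2 - s) / 2" "m \<ge> N x" by (simp_all add: m_def \<mu>_def le_max_iff_disj)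
    have m_eq: "m = (2 - s) / 2 \<or> m = N x \<or> m = 2 * N y - 1 \<or> m = 1 - 2 * \<rho>"
      unfolding m_def \<mu>_def \<rho>_def fst_conv snd_conv by linarith
    define x' where "x' = (\<lambda>i. x i / m)"
    define t where "t = (\<lambda>i. (1 - 1 / m) * ((y i - x i) / \<rho> / 2))"
    define y1 where "y1 = (\<lambda>i. y i / m + t i)"
    define y' where "y' = (\<lambda>i. y1 i / max 1 (N y1))"
    have "Y (s, x, y) = y1" by (simp add: fun_eq_iff Y_def T_def y1_def t_def m_def \<rho>_def)
    then have Req: "R (s, x, y) = (2 + (s - 2) / m, x', y')"
      by (simp add: R_def x'_def y'_def m_def)
    have "(2 - s) * m \<le> 2 - s" using m s by (intro mult_left_le) auto
    then have "(2 - s) / m \<le> 2" "(2 - s) / m \<ge> 2 - s"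
      using m m_ge(1) by (simp_all add: field_simps)
    then have h: "2 + (s - 2) / m \<in> {0..1}"
      using s by (simp add: diff_divide_distrib)
    have Nx': "N x' = N x / m" using m by (simp add: x'_def Ndiv)
    then have x': "x' \<in> disc_set n" using m m_ge(2) x by (simp add: Dn x'_def divide_le_eq)
    have Ny': "N y' = N y1 / max 1 (N y1)" by (simp add: y'_def Ndiv)
    then have y': "y' \<in> disc_set n"
      using x y N0[of y1] by (auto simp: Dn y'_def y1_def t_def divide_le_eq)
    have "2 + (s - 2) / m = 0 \<or> (x', y') \<in> ?A"
      using m_eq
    proof (elim disjE)
      assume *: "m = (2 - s) / 2"
      have "2 - s \<noteq> 0" using s by auto
      then have "2 + (s - 2) / m = 0" unfolding * by (simp add: field_simps)
      then show ?thesis ..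
    next
      assume "m = N x"
      then show ?thesis using x' y' Nx' m(1) by (simp add: Bn)
    next
      \<comment> \<open>Now \<open>|y| = (1 + m) / 2\<close> and
        \<open>|t| \<le> (1 / m - 1) / 2\<close>, so that
        \<open>|y1| \<ge> |y| / m - |t| \<ge> 1\<close>, and the truncation moves \<open>y1\<close>
        exactly onto the sphere.\<close>
      assume *: "m = 2 * N y - 1"
      have "N t \<le> (1 / m - 1) / 2"
      proof -
        have "N t = \<bar>1 - 1 / m\<bar> * (N (\<lambda>i. y i - x i) / \<bar>\<rho>\<bar> / 2)"
          unfolding t_def Ncm Ndiv by simp
        also have "N (\<lambda>i. y i - x i) = \<rho>" unfolding nd[of y x] by (simp add: \<rho>_def r_def)
        also have "\<bar>1 - 1 / m\<bar> = 1 / m - 1" using m by (simp add: field_simps)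
        also have "(1 / m - 1) * (\<rho> / \<bar>\<rho>\<bar> / 2) \<le> (1 / m - 1) * (1 / 2)"
        proof (rule mult_left_mono)
          show "\<rho> / \<bar>\<rho>\<bar> / 2 \<le> 1 / 2" using r0[of "(s, x, y)"] by (simp add: \<rho>_def)
          show "0 \<le> 1 / m - 1" using m by (simp add: field_simps)
        qed
        finally show ?thesis by simp
      qed
      moreover have "N y / m \<le> N y1 + N t"
      proof -
        have "N (\<lambda>i. y1 i + (-1) * t i) \<le> N y1 + N (\<lambda>i. (-1) * t i)" by (rule Ntri)
        moreover have "N (\<lambda>i. y1 i + (-1) * t i) = N y / m"
          using m by (simp add: y1_def Ndiv)
        ultimately show ?thesis unfolding Ncm by simp
      qed
      moreover have "N y / m - (1 / m - 1) / 2 = 1"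
      proof -
        have "N y = (1 + m) / 2" using * by simp
        then show ?thesis using m(1) by (simp add: field_simps)
      qed
      ultimately have "N y1 \<ge> 1" by linarith
      then have "N y' = 1" by (simp add: Ny')
      then show ?thesis using x' y' by (simp add: Bn)
    next
      \<comment> \<open>The projected points coincide before truncation, and truncation does not
        move them because \<open>x'\<close> is already in the disc.\<close>
      assume *: "m = 1 - 2 * \<rho>"
      have "y1 = x'"
      proof
        fix i
        show "y1 i = x' i"
        proof (cases "\<rho> = 0")
          case True
          then have "\<bar>y i - x i\<bar> \<le> 0" using r_coord[OF x y, of i s] by (simp add: \<rho>_def)
          then show ?thesis using True * by (simp add: y1_def x'_def t_def)
        next
          case False
          have e: "2 * \<rho> = 1 - m" using * by simp
          have "(1 - 1 / m) = - (2 * \<rho>) / m" unfolding e using m(1) by (simp add: field_simps)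
          then have "t i = - ((y i - x i) / m)" using False by (simp add: t_def)
          then show ?thesis by (simp add: y1_def x'_def diff_divide_distrib)
        qed
      qed
      moreover have "N x' \<le> 1" using x' by (simp add: Dn)
      ultimately have "y' = x'" by (simp add: y'_def max_def)
      then show ?thesis using x' by simp
    qed
    then show ?thesis using h x' y' by (auto simp: Req)
  qed
  have id: "R (s, x, y) = (s, x, y)"
    if "s \<in> {0..1}" "x \<in> disc_set n" "y \<in> disc_set n" "s = 0 \<or> (x, y) \<in> ?A" for s x y
  proof -
    have "\<mu> (s, x, y) = 1"
    proof (rule antisym)
      show "\<mu> (s, x, y) \<le> 1" using \<mu>[of "(s, x, y)"] that by auto
      have "r (s, x, x) = 0" by (simp add: r_def N_def L2_set_def)
      then show "1 \<le> \<mu> (s, x, y)"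
        using that(4) by (auto simp: \<mu>_def Bn le_max_iff_disj)
    qed
    then have "Y (s, x, y) = y" by (simp add: fun_eq_iff Y_def T_def)
    moreover have "max 1 (N y) = 1" using that(3) by (simp add: Dn)
    ultimately show ?thesis using \<open>\<mu> (s, x, y) = 1\<close> by (simp add: R_def)
  qed
  have "cofibration_retraction ?D ?A R"
    unfolding cofibration_retraction_def
  proof (intro conjI ballI)
    have "R \<in> ?S \<rightarrow> ?S" 
    proof
      fix z :: "real \<times> (nat \<Rightarrow> real) \<times> (nat \<Rightarrow> real)" assume "z \<in> ?S"
      then show "R z \<in> ?S" using R[of "fst z" "fst (snd z)" "snd (snd z)"] by (simp add: mem_Times_iff)
    qed
    with cont have "continuous_map (top_of_set ?S) (top_of_set ?S) R" by simp
    then show "continuous_map (prod_topology unit_interval ?D) (prod_topology unit_interval ?D) R"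
      by (simp add: disc_eq)
  next
    fix t :: real and w assume "t \<in> {0..1}" "w \<in> topspace ?D"
    then show "fst (R (t, w)) = 0 \<or> snd (R (t, w)) \<in> ?A" using R[of t "fst w" "snd w"] by (simp add: mem_Times_iff)
  next
    fix w assume "w \<in> topspace ?D"
    then show "R (0, w) = (0, w)" using id[of 0 "fst w" "snd w"] by (simp add: mem_Times_iff)
  next
    fix t :: real and a assume "t \<in> {0..1}" "a \<in> ?A"
    then show "R (t, a) = (t, a)" using id[of t "fst a" "snd a"] by (cases a) simp
  qed
  moreover have "closedin ?D ?A"
  proof -
    have cx: "continuous_on UNIV (\<lambda>z :: (nat \<Rightarrow> real) \<times> (nat \<Rightarrow> real). fst z i)"
      and cy: "continuous_on UNIV (\<lambda>z :: (nat \<Rightarrow> real) \<times> (nat \<Rightarrow> real). snd z i)"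
      for i :: nat
      by (rule continuous_on_coordinate[where f = "\<lambda>z. fst z"]
            continuous_on_coordinate[where f = "\<lambda>z. snd z"],
          intro continuous_on_fst continuous_on_snd continuous_on_id)+
    have "closed {z :: (nat \<Rightarrow> real) \<times> (nat \<Rightarrow> real). N (fst z) = 1}"
      and "closed {z :: (nat \<Rightarrow> real) \<times> (nat \<Rightarrow> real). N (snd z) = 1}"
      unfolding N_def
      by (intro closed_Collect_eq continuous_on_L2_set continuous_on_const cx cy)+
    moreover have "closed {z :: (nat \<Rightarrow> real) \<times> (nat \<Rightarrow> real). fst z = snd z}"
      by (intro closed_Collect_eq continuous_on_fst continuous_on_snd continuous_on_id)
    ultimately have cl: "closed ({z. N (fst z) = 1} \<union> {z. N (snd z) = 1} \<union> {z. fst z = snd z})"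
      by (intro closed_Un)
    have A: "?A = (disc_set n \<times> disc_set n) \<inter> ({z. N (fst z) = 1} \<union> {z. N (snd z) = 1} \<union> {z. fst z = snd z})"
      by (auto simp: Bn)
    have D: "?D = top_of_set (disc_set n \<times> disc_set n)" by (simp add: disc_eq)
    show ?thesis unfolding A D by (rule closedin_closed_Int[OF cl])
  qed
  ultimately show ?thesis by (auto simp: closed_cofibration_def)
qed

section \<open>Finite subcomplexes\<close>

locale cw_complex =
  fixes Y :: "'b topology" and E :: "'b set set" and d :: "'b set \<Rightarrow> nat"
    and \<Phi> :: "'b set \<Rightarrow> (nat \<Rightarrow> real) \<Rightarrow> 'b"
  assumes CW: "CW_complex Y E d \<Phi>"
begin

lemma Hausdorff: "Hausdorff_space Y"
  using CW by (simp add: CW_complex_def)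

lemma Union_cells: "\<Union>E = topspace Y"
  using CW by (simp add: CW_complex_def)

lemma cells_eq: "c \<in> E \<Longrightarrow> c' \<in> E \<Longrightarrow> y \<in> c \<Longrightarrow> y \<in> c' \<Longrightarrow> c = c'"
  using CW by (auto simp: CW_complex_def pairwise_def disjnt_iff)

lemma continuous_char: "c \<in> E \<Longrightarrow> continuous_map (disc (d c)) Y (\<Phi> c)"
  using CW by (simp add: CW_complex_def)

lemma char_interior:
  assumes "c \<in> E"
  shows "inj_on (\<Phi> c) (disc_interior (d c))" "\<Phi> c ` disc_interior (d c) = c"
proof -
  have "homeomorphic_map (subtopology (disc (d c)) (disc_interior (d c))) (subtopology Y c) (\<Phi> c)"
    using CW assms by (simp add: CW_complex_def)
  moreover have "topspace (subtopology (disc (d c)) (disc_interior (d c))) = disc_interior (d c)"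
    by (auto simp: disc_interior_eq)
  moreover have "topspace (subtopology Y c) = c"
    using Union_cells assms by auto
  ultimately show "inj_on (\<Phi> c) (disc_interior (d c))" "\<Phi> c ` disc_interior (d c) = c"
    using homeomorphic_imp_injective_map homeomorphic_imp_surjective_map by metis+
qed

lemma char_boundary:
  assumes "c \<in> E"
  obtains F where "finite F" "F \<subseteq> E" "\<And>c'. c' \<in> F \<Longrightarrow> d c' < d c" "\<Phi> c ` disc_boundary (d c) \<subseteq> \<Union>F"
proof -
  have "\<exists>F. finite F \<and> F \<subseteq> E \<and> (\<forall>c'\<in>F. d c' < d c) \<and> \<Phi> c ` disc_boundary (d c) \<subseteq> \<Union>F"
    using CW assms by (simp add: CW_complex_def)
  then show ?thesis using that by blast
qed

lemma closedin_weak: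
  assumes "S \<subseteq> topspace Y" "\<And>c. c \<in> E \<Longrightarrow> closedin (disc (d c)) {x \<in> disc_set (d c). \<Phi> c x \<in> S}"
  shows "closedin Y S"
  using CW assms by (simp add: CW_complex_def)

text \<open>A set of cells rather than a subspace, since the inductions below add and remove single
  cells.\<close>

definition finite_subcomplex :: "'b set set \<Rightarrow> bool" where
  "finite_subcomplex S \<longleftrightarrow> finite S \<and> S \<subseteq> E \<and> (\<forall>c\<in>S. \<Phi> c ` disc_boundary (d c) \<subseteq> \<Union>S)"

lemma finite_subcomplex_empty: "finite_subcomplex {}"
  by (simp add: finite_subcomplex_def)

lemma finite_subcomplex_Union:
  assumes "finite \<S>" "\<And>S. S \<in> \<S> \<Longrightarrow> finite_subcomplex S"
  shows "finite_subcomplex (\<Union>\<S>)"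
  unfolding finite_subcomplex_def
proof (intro conjI ballI)
  show "finite (\<Union>\<S>)" "\<Union>\<S> \<subseteq> E" using assms by (auto simp: finite_subcomplex_def)
  fix c assume "c \<in> \<Union>\<S>"
  then obtain S where S: "S \<in> \<S>" "c \<in> S" by auto
  then have "\<Phi> c ` disc_boundary (d c) \<subseteq> \<Union>S"
    using assms(2) by (auto simp: finite_subcomplex_def)
  then show "\<Phi> c ` disc_boundary (d c) \<subseteq> \<Union>(\<Union>\<S>)" using S by blast
qed

lemma finite_subcomplex_Un:
  "finite_subcomplex S \<Longrightarrow> finite_subcomplex T \<Longrightarrow> finite_subcomplex (S \<union> T)"
  using finite_subcomplex_Union[of "{S, T}"] by auto

text \<open>By induction on the dimension: closure-finiteness covers the boundary of
  \<open>c\<close> by finitely many cells of smaller dimension, and the finite subcomplexes around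
  these are united.\<close>

lemma cell_in_finite_subcomplex:
  assumes "c \<in> E"
  shows "\<exists>S. finite_subcomplex S \<and> c \<in> S"
  using assms
proof (induction "d c" arbitrary: c rule: less_induct)
  case less
  obtain F where F: "finite F" "F \<subseteq> E" "\<And>c'. c' \<in> F \<Longrightarrow> d c' < d c" "\<Phi> c ` disc_boundary (d c) \<subseteq> \<Union>F"
    using char_boundary[OF less.prems] by metis
  then have "\<forall>c'\<in>F. \<exists>S. finite_subcomplex S \<and> c' \<in> S" using less.hyps by blast
  then obtain S where S: "\<And>c'. c' \<in> F \<Longrightarrow> finite_subcomplex (S c') \<and> c' \<in> S c'" by metis
  let ?T = "\<Union>(S ` F)"
  have T: "finite_subcomplex ?T"
    using F(1) S by (intro finite_subcomplex_Union) auto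
  have "\<Phi> c ` disc_boundary (d c) \<subseteq> \<Union>?T" using F(4) S by blast
  moreover have "\<Phi> b ` disc_boundary (d b) \<subseteq> \<Union>?T" if "b \<in> ?T" for b
    using T that unfolding finite_subcomplex_def by blast
  ultimately have "\<Phi> b ` disc_boundary (d b) \<subseteq> \<Union>(insert c ?T)" if "b \<in> insert c ?T" for b
    using that by (metis Union_insert insert_iff le_supI2)
  with T less.prems have "finite_subcomplex (insert c ?T)"
    unfolding finite_subcomplex_def by simp
  then show ?case by blast
qed

lemma char_image_subset:
  assumes "finite_subcomplex S" "c \<in> S"
  shows "\<Phi> c ` disc_set (d c) \<subseteq> \<Union>S"
proof -
  have "\<Phi> c ` disc_interior (d c) = c" "\<Phi> c ` disc_boundary (d c) \<subseteq> \<Union>S"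
    using assms char_interior by (auto simp: finite_subcomplex_def)
  moreover have "disc_set (d c) \<subseteq> disc_interior (d c) \<union> disc_boundary (d c)"
    by (auto simp: disc_interior_eq)
  ultimately show ?thesis using assms(2) by blast
qed

lemma compactin_finite_subcomplex:
  assumes "finite_subcomplex S"
  shows "compactin Y (\<Union>S)"
proof -
  have S: "finite S" "S \<subseteq> E" using assms by (auto simp: finite_subcomplex_def)
  have eq: "\<Union>S = (\<Union>c\<in>S. \<Phi> c ` disc_set (d c))"
  proof
    show "\<Union>S \<subseteq> (\<Union>c\<in>S. \<Phi> c ` disc_set (d c))"
    proof
      fix y assume "y \<in> \<Union>S"
      then obtain c where c: "c \<in> S" "y \<in> c" by auto
      then have "y \<in> \<Phi> c ` disc_interior (d c)" using char_interior(2)[of c] S by auto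
      then show "y \<in> (\<Union>c\<in>S. \<Phi> c ` disc_set (d c))" using c by (auto simp: disc_interior_eq)
    qed
  qed (use char_image_subset[OF assms] in blast)
  have "compactin Y (\<Phi> c ` disc_set (d c))" if "c \<in> S" for c
    using image_compactin[OF _ continuous_char[of c]] compact_space_disc[of "d c"] that S
    by (auto simp: compact_space_def)
  then show ?thesis
    unfolding eq by (intro compactin_Union) (use S in auto)
qed

lemma closedin_finite_subcomplex: "finite_subcomplex S \<Longrightarrow> closedin Y (\<Union>S)"
  by (rule compactin_imp_closedin[OF Hausdorff compactin_finite_subcomplex])

text \<open>A cell \<open>c\<close> of largest dimension in \<open>T - S0\<close> can be removed.
  Cells of \<open>S0\<close> have their boundary inside \<open>S0\<close>; the boundary of any other
  remaining cell is covered by cells of dimension less than that of \<open>c\<close>, and as each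
  point lies in only one cell, it misses \<open>c\<close>.\<close>

lemma finite_subcomplex_induct [consumes 3, case_names base step]:
  assumes T: "finite_subcomplex T" and S0: "finite_subcomplex S0" "S0 \<subseteq> T"
    and base: "P S0"
    and step: "\<And>c S. finite_subcomplex S \<Longrightarrow> finite_subcomplex (insert c S) \<Longrightarrow> S0 \<subseteq> S \<Longrightarrow> c \<notin> S \<Longrightarrow> P S
               \<Longrightarrow> P (insert c S)"
  shows "P T"
  using T S0(2)
proof (induction "card (T - S0)" arbitrary: T)
  case 0
  then have "T = S0" by (auto simp: finite_subcomplex_def)
  then show ?case using base by simp
next
  case (Suc k)
  have fin: "finite T" and TE: "T \<subseteq> E" using Suc.prems by (auto simp: finite_subcomplex_def)
  then have "finite (T - S0)" "T - S0 \<noteq> {}" using Suc.hyps(2) by (blast, metis card.empty nat.distinct(1))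
  then have fin': "finite (d ` (T - S0))" and "d ` (T - S0) \<noteq> {}" by simp_all
  then have "Max (d ` (T - S0)) \<in> d ` (T - S0)" by (rule Max_in)
  then obtain c where c: "c \<in> T - S0" and "Max (d ` (T - S0)) = d c" by (rule imageE) simp
  then have cmax: "d c' \<le> d c" if "c' \<in> T - S0" for c'
    using Max_ge[OF fin', of "d c'"] that by simp
  let ?T = "T - {c}"
  have "finite_subcomplex ?T"
    unfolding finite_subcomplex_def
  proof (intro conjI ballI subsetI)
    fix c' y assume c': "c' \<in> ?T" and y: "y \<in> \<Phi> c' ` disc_boundary (d c')"
    show "y \<in> \<Union>?T"
    proof (cases "c' \<in> S0")
      case True
      then have "y \<in> \<Union>S0" using S0(1) y unfolding finite_subcomplex_def by blast
      moreover have "S0 \<subseteq> ?T" using Suc.prems(2) c by blast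
      ultimately show ?thesis by (rule rev_subsetD[OF _ Union_mono])
    next
      case False
      have c'E: "c' \<in> E" using c' TE by auto
      obtain F where F: "finite F" "F \<subseteq> E" "\<And>c'a. c'a \<in> F \<Longrightarrow> d c'a < d c'" "\<Phi> c' ` disc_boundary (d c') \<subseteq> \<Union>F"
        using char_boundary[OF c'E] by metis
      obtain f where f: "f \<in> F" "y \<in> f" using F(4) y by blast
      obtain g where g: "g \<in> T" "y \<in> g" using Suc.prems(1) c' y unfolding finite_subcomplex_def by blast
      have "f = g" using cells_eq[of f g y] f g F(2) TE by blast
      moreover have "d f < d c" using F(3)[OF f(1)] cmax[of c'] c' False by fastforce
      ultimately show ?thesis using g by blast
    qed
  qed (use fin TE in auto)
  moreover have "S0 \<subseteq> ?T" using c Suc.prems by auto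
  moreover have "card (?T - S0) = k"
  proof -
    have "?T - S0 = (T - S0) - {c}" by auto
    then show ?thesis using Suc.hyps(2) c fin by simp
  qed
  ultimately have "P (insert c ?T)"
    using Suc.hyps(1)[of ?T] step[of ?T c] Suc.prems(1) c by (simp add: insert_absorb)
  then show ?case using c by (simp add: insert_absorb)
qed

section \<open>Attaching one cell to a finite subcomplex\<close>

context
  fixes c :: "'b set" and S :: "'b set set"
  assumes S: "finite_subcomplex S" and insert_subcomplex: "finite_subcomplex (insert c S)" and c: "c \<notin> S"
begin

abbreviation (input) "Z \<equiv> subtopology Y (\<Union>(insert c S))"

lemma new_cell_mem: "c \<in> E" and old_cells_subset: "S \<subseteq> E"
  using insert_subcomplex by (auto simp: finite_subcomplex_def)

lemma topspace_Z: "topspace Z = \<Union>(insert c S)"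
  using closedin_subset[OF closedin_finite_subcomplex[OF insert_subcomplex]] by auto

lemma Hausdorff_Z: "Hausdorff_space Z"
  by (rule Hausdorff_space_subtopology[OF Hausdorff])

lemma continuous_Z: "continuous_map (disc (d c)) Z (\<Phi> c)"
  using continuous_map_into_subtopology[OF continuous_char[OF new_cell_mem]] char_image_subset[OF insert_subcomplex, of c]
  by (auto simp: Pi_iff)

lemma closedin_Z: "closedin Z (\<Union>S)"
  by (rule closedin_subset_topspace[OF closedin_finite_subcomplex[OF S]]) auto

text \<open>The hypothesis places the boundary only in \<open>insert c S\<close>, but the cell
  containing a boundary point has smaller dimension than \<open>c\<close> and so is not
  \<open>c\<close> itself.\<close>

lemma boundary_S: "x \<in> disc_boundary (d c) \<Longrightarrow> \<Phi> c x \<in> \<Union>S"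
proof -
  assume x: "x \<in> disc_boundary (d c)"
  obtain F where F: "finite F" "F \<subseteq> E" "\<And>c'. c' \<in> F \<Longrightarrow> d c' < d c" "\<Phi> c ` disc_boundary (d c) \<subseteq> \<Union>F"
    using char_boundary[OF new_cell_mem] by metis
  obtain f where f: "f \<in> F" "\<Phi> c x \<in> f" using F(4) x by blast
  obtain g where g: "g \<in> insert c S" "\<Phi> c x \<in> g" using insert_subcomplex x unfolding finite_subcomplex_def by blast
  have "f = g" using cells_eq[of f g] f g F(2) new_cell_mem old_cells_subset by blast
  then show ?thesis using F(3)[OF f(1)] g by auto
qed

lemma char_interior_mem: "x \<in> disc_set (d c) - disc_boundary (d c) \<Longrightarrow> \<Phi> c x \<in> c"
  using char_interior(2)[OF new_cell_mem] by (auto simp: disc_interior_eq)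

lemma new_cell_disjoint: "y \<in> c \<Longrightarrow> y \<notin> \<Union>S"
  using cells_eq[OF new_cell_mem] old_cells_subset c by blast

lemma new_cellE:
  assumes "y \<in> c" obtains x where "x \<in> disc_set (d c) - disc_boundary (d c)" "y = \<Phi> c x"
  using assms char_interior(2)[OF new_cell_mem] by (auto simp: disc_interior_eq)

lemma inj_on_new_cell: "inj_on (\<Phi> c) (disc_set (d c) - disc_boundary (d c))"
  using char_interior(1)[OF new_cell_mem] by (simp add: disc_interior_eq)

lemma closed_cofibration_attach_cell: "closed_cofibration Z (\<Union>S)"
proof (rule closed_cofibration_attach[OF compact_space_disc Hausdorff_Z continuous_Z closedin_Z])
  show "topspace Z \<subseteq> \<Union>S \<union> \<Phi> c ` topspace (disc (d c))"
    unfolding topspace_Z by (auto elim: new_cellE)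
  show "\<Phi> c ` disc_boundary (d c) \<subseteq> \<Union>S"
    using boundary_S by blast
  show "inj_on (\<Phi> c) (topspace (disc (d c)) - disc_boundary (d c))"
    using inj_on_new_cell by simp
  show "\<Phi> c ` (topspace (disc (d c)) - disc_boundary (d c)) \<inter> \<Union>S = {}"
    using char_interior_mem new_cell_disjoint by auto
qed (rule closed_cofibration_disc_boundary)

text \<open>With \<open>A\<close> for the old part, the inclusion of the diagonal is factored. From
  \<open>Z x Z\<close> down to \<open>?T = (A x Z) \<union> (Z x A) \<union> \<Delta>\<close> the
  product of two discs is attached along \<open>?Q\<close>, the case of
  \<open>closed_cofibration_disc_square\<close>. From \<open>?T\<close> to \<open>\<Delta>\<close>
  excision leaves the inclusion of the diagonal of \<open>A\<close> into
  \<open>?W1 = (A x Z) \<union> (Z x A)\<close>, which factors through \<open>Z x A\<close> and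
  \<open>A x A\<close>.\<close>

lemma closed_cofibration_attach_cell_diagonal:
  assumes IH: "closed_cofibration (prod_topology (subtopology Y (\<Union>S)) (subtopology Y (\<Union>S)))
                 ((\<lambda>z. (z, z)) ` \<Union>S)"
  shows "closed_cofibration (prod_topology Z Z) ((\<lambda>z. (z, z)) ` \<Union>(insert c S))"
proof -
  let ?A = "\<Union>S" and ?Z = "\<Union>(insert c S)" and ?D = "disc (d c)" and ?W = "prod_topology Z Z"
  let ?\<Delta> = "(\<lambda>z. (z, z)) ` ?Z"
  let ?Q = "{(x, y). x \<in> disc_set (d c) \<and> y \<in> disc_set (d c) \<and>
              (x \<in> disc_boundary (d c) \<or> y \<in> disc_boundary (d c) \<or> x = y)}"
  let ?W1 = "?A \<times> ?Z \<union> ?Z \<times> ?A"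
  let ?T = "?W1 \<union> ?\<Delta>"
  let ?F = "\<lambda>p. (\<Phi> c (fst p), \<Phi> c (snd p))"
  have AZ: "?A \<subseteq> ?Z" by auto
  have clAZ: "closedin ?W (?A \<times> ?Z)" "closedin ?W (?Z \<times> ?A)"
    using closedin_Z closedin_topspace[of Z] unfolding closedin_prod_Times_iff topspace_Z by auto
  then have cl1: "closedin ?W ?W1" by (rule closedin_Un)
  have cl\<Delta>: "closedin ?W ?\<Delta>"
    using Hausdorff_Z unfolding Hausdorff_space_closedin_diagonal topspace_Z .
  have clT: "closedin ?W ?T" using cl1 cl\<Delta> by (rule closedin_Un)
  have 1: "closed_cofibration ?W ?T"
  proof (rule closed_cofibration_attach[where P = "prod_topology ?D ?D" and F = ?F and Q = ?Q])
    show "compact_space (prod_topology ?D ?D)"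
      using compact_space_disc by (simp add: compact_space_prod_topology)
    show "Hausdorff_space ?W"
      using Hausdorff_Z by (simp add: Hausdorff_space_prod_topology)
    show "continuous_map (prod_topology ?D ?D) ?W ?F"
      by (intro continuous_map_pairedI continuous_map_compose'[OF _ continuous_Z] continuous_map_fst continuous_map_snd)
    show "topspace ?W \<subseteq> ?T \<union> ?F ` topspace (prod_topology ?D ?D)"
    proof
      fix w assume w: "w \<in> topspace ?W"
      then obtain a b where ab: "w = (a, b)" "a \<in> ?Z" "b \<in> ?Z" by (auto simp: topspace_Z)
      show "w \<in> ?T \<union> ?F ` topspace (prod_topology ?D ?D)"
      proof (cases "a \<in> ?A \<or> b \<in> ?A")
        case False
        then have "a \<in> c" "b \<in> c" using ab by auto
        then obtain x y where "x \<in> disc_set (d c)" "a = \<Phi> c x" "y \<in> disc_set (d c)" "b = \<Phi> c y"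
          by (auto elim!: new_cellE)
        then have "w \<in> ?F ` topspace (prod_topology ?D ?D)"
          by (intro image_eqI[of _ _ "(x, y)"]) (simp_all add: ab)
        then show ?thesis by (rule UnI2)
      next
        case True
        then have "w \<in> ?T" using ab by blast
        then show ?thesis by (rule UnI1)
      qed
    qed
    show "?F ` ?Q \<subseteq> ?T"
    proof (rule image_subsetI)
      fix p assume p: "p \<in> ?Q"
      then obtain x y where xy: "p = (x, y)" "x \<in> disc_set (d c)" "y \<in> disc_set (d c)"
        and "x \<in> disc_boundary (d c) \<or> y \<in> disc_boundary (d c) \<or> x = y" by blast
      moreover have "\<Phi> c x \<in> ?Z" "\<Phi> c y \<in> ?Z"
        using xy char_image_subset[OF insert_subcomplex, of c] by auto
      ultimately have "(\<Phi> c x, \<Phi> c y) \<in> ?T"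
        using boundary_S by blast
      then show "?F p \<in> ?T" by (simp add: xy(1))
    qed
    have off: "x \<in> disc_set (d c) - disc_boundary (d c) \<and> y \<in> disc_set (d c) - disc_boundary (d c) \<and> x \<noteq> y"
      if "(x, y) \<in> topspace (prod_topology ?D ?D) - ?Q" for x y
      using that by auto
    show "inj_on ?F (topspace (prod_topology ?D ?D) - ?Q)"
    proof (rule inj_onI)
      fix p q assume p: "p \<in> topspace (prod_topology ?D ?D) - ?Q" and q: "q \<in> topspace (prod_topology ?D ?D) - ?Q"
        and eq: "?F p = ?F q"
      then show "p = q"
        using off[of "fst p" "snd p"] off[of "fst q" "snd q"] inj_onD[OF inj_on_new_cell]
        by (simp add: prod_eq_iff)
    qed
    show "?F ` (topspace (prod_topology ?D ?D) - ?Q) \<inter> ?T = {}"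
    proof -
      have *: "?F p \<notin> ?T" if p: "p \<in> topspace (prod_topology ?D ?D) - ?Q" for p
      proof -
        have "\<Phi> c (fst p) \<in> c" "\<Phi> c (snd p) \<in> c" "\<Phi> c (fst p) \<noteq> \<Phi> c (snd p)"
          using off[of "fst p" "snd p"] p char_interior_mem inj_onD[OF inj_on_new_cell, of "fst p" "snd p"] by auto
        then show ?thesis using new_cell_disjoint by auto
      qed
      show ?thesis
      proof (rule equals0I, elim IntE imageE)
        fix w p assume w: "w \<in> ?T" "w = ?F p" and p: "p \<in> topspace (prod_topology ?D ?D) - ?Q"
        show False using *[OF p] w(1) unfolding w(2) by (rule notE)
      qed
    qed
  qed (rule clT closed_cofibration_disc_square)+
  have sub: "subtopology (prod_topology Z Z) (B \<times> C) = prod_topology (subtopology Y B) (subtopology Y C)"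
    if "B \<subseteq> ?Z" "C \<subseteq> ?Z" for B C
    using that by (simp add: subtopology_Times subtopology_subtopology Int_absorb1)
  have topA: "topspace (subtopology Y ?A) = ?A"
    using closedin_subset[OF closedin_finite_subcomplex[OF S]] by auto
  have 2: "closed_cofibration (subtopology ?W ?W1) (?Z \<times> ?A)"
  proof (rule closed_cofibration_excision[where ?W1.0 = "?A \<times> ?Z"])
    show "closedin (subtopology ?W ?W1) (?A \<times> ?Z)" "closedin (subtopology ?W ?W1) (?Z \<times> ?A)"
      by (rule closedin_subset_topspace[OF clAZ(1)], blast) (rule closedin_subset_topspace[OF clAZ(2)], blast)
    show "?A \<times> ?Z \<union> ?Z \<times> ?A = topspace (subtopology ?W ?W1)"
      by (rule topspace_subtopology_subset[OF closedin_subset[OF cl1], symmetric])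
    have eq: "subtopology (subtopology ?W ?W1) (?A \<times> ?Z) = prod_topology (subtopology Y ?A) Z"
    proof -
      have "subtopology (subtopology ?W ?W1) (?A \<times> ?Z) = subtopology ?W (?A \<times> ?Z)"
        by (simp add: subtopology_subtopology Int_absorb1)
      then show ?thesis using sub[OF AZ subset_refl] by simp
    qed
    have eq': "?A \<times> ?Z \<inter> ?Z \<times> ?A = topspace (subtopology Y ?A) \<times> ?A"
      unfolding topA by auto
    show "closed_cofibration (subtopology (subtopology ?W ?W1) (?A \<times> ?Z)) (?A \<times> ?Z \<inter> ?Z \<times> ?A)"
      unfolding eq eq' by (rule closed_cofibration_times_left[OF closed_cofibration_attach_cell])
  qed
  have 3: "closed_cofibration (subtopology (subtopology ?W ?W1) (?Z \<times> ?A)) (?A \<times> ?A)"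
  proof -
    have "subtopology (subtopology ?W ?W1) (?Z \<times> ?A) = subtopology ?W (?Z \<times> ?A)"
      by (simp add: subtopology_subtopology Int_absorb1)
    also have "\<dots> = prod_topology Z (subtopology Y ?A)"
      by (rule sub[OF subset_refl AZ])
    finally show ?thesis
      using closed_cofibration_times_right[OF closed_cofibration_attach_cell, of "subtopology Y ?A"]
      by (simp only: topA)
  qed
  have 4: "closed_cofibration (subtopology (subtopology ?W ?W1) (?A \<times> ?A)) ((\<lambda>z. (z, z)) ` ?A)"
  proof -
    have "subtopology (subtopology ?W ?W1) (?A \<times> ?A) = subtopology ?W (?A \<times> ?A)"
    proof -
      have "?W1 \<inter> ?A \<times> ?A = ?A \<times> ?A" using AZ by blast
      then show ?thesis by (simp only: subtopology_subtopology)
    qed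
    also have "\<dots> = prod_topology (subtopology Y ?A) (subtopology Y ?A)"
      by (rule sub[OF AZ AZ])
    finally show ?thesis using IH by simp
  qed
  have 5: "closed_cofibration (subtopology ?W ?W1) ((\<lambda>z. (z, z)) ` ?A)"
    using closed_cofibration_trans[OF closed_cofibration_trans[OF 2 3] 4] .
  have 6: "closed_cofibration (subtopology ?W ?T) ?\<Delta>"
  proof (rule closed_cofibration_excision[where ?W1.0 = ?W1])
    show "closedin (subtopology ?W ?T) ?W1" "closedin (subtopology ?W ?T) ?\<Delta>"
      by (rule closedin_subset_topspace[OF cl1], blast) (rule closedin_subset_topspace[OF cl\<Delta>], blast)
    show "?W1 \<union> ?\<Delta> = topspace (subtopology ?W ?T)"
      by (rule topspace_subtopology_subset[OF closedin_subset[OF clT], symmetric])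
    have eq: "?W1 \<inter> ?\<Delta> = (\<lambda>z. (z, z)) ` ?A" by blast
    have "?T \<inter> ?W1 = ?W1" by blast
    then have eq': "subtopology (subtopology ?W ?T) ?W1 = subtopology ?W ?W1"
      by (simp only: subtopology_subtopology)
    show "closed_cofibration (subtopology (subtopology ?W ?T) ?W1) (?W1 \<inter> ?\<Delta>)"
      unfolding eq eq' by (rule 5)
  qed
  show ?thesis by (rule closed_cofibration_trans[OF 1 6])
qed

end

lemma closed_cofibration_finite_subcomplexes:
  assumes "finite_subcomplex T" "finite_subcomplex S" "S \<subseteq> T"
  shows "closed_cofibration (subtopology Y (\<Union>T)) (\<Union>S)"
  using assms
proof (induction rule: finite_subcomplex_induct)
  case base
  have "topspace (subtopology Y (\<Union>S)) = \<Union>S"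
    using closedin_subset[OF closedin_finite_subcomplex[OF assms(2)]] by auto
  then show ?case using closed_cofibration_refl[of "subtopology Y (\<Union>S)"] by simp
next
  case (step c T)
  have "\<Union>(insert c T) \<inter> \<Union>T = \<Union>T" by blast
  then have eq: "subtopology (subtopology Y (\<Union>(insert c T))) (\<Union>T) = subtopology Y (\<Union>T)"
    by (simp only: subtopology_subtopology)
  show ?case
    by (rule closed_cofibration_trans[OF closed_cofibration_attach_cell[OF step(1,2,4)]])
       (unfold eq, rule step(5))
qed

lemma closed_cofibration_diagonal_finite_subcomplex:
  assumes "finite_subcomplex S"
  shows "closed_cofibration (prod_topology (subtopology Y (\<Union>S)) (subtopology Y (\<Union>S))) ((\<lambda>z. (z, z)) ` \<Union>S)"
  using assms finite_subcomplex_empty empty_subsetI[of S]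
proof (induction rule: finite_subcomplex_induct)
  case base
  then show ?case
    using closed_cofibration_refl[of "prod_topology (subtopology Y {}) (subtopology Y {})"]
    by (simp only: topspace_prod_topology topspace_subtopology Union_empty image_empty Int_empty_right Sigma_empty1)
next
  case (step c T)
  show ?case by (rule closed_cofibration_attach_cell_diagonal[OF step(1,2,4,5)])
qed

text \<open>Along an enumeration of the cells, each stage is enlarged by a finite subcomplex around
  the next cell. The enumeration \<open>from_nat_into\<close> is meaningful only for nonempty
  \<open>E\<close>.\<close>

lemma finite_subcomplex_exhaustion:
  assumes "countable E" "finite_subcomplex S"
  obtains T :: "nat \<Rightarrow> 'b set set" where "T 0 = S" "\<And>n. finite_subcomplex (T n)"
    "\<And>n. T n \<subseteq> T (Suc n)" "E \<subseteq> (\<Union>n. T n)"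
proof (cases "E = {}")
  case True
  then show ?thesis using assms(2) by (intro that[of "\<lambda>_. S"]) auto
next
  case False
  let ?e = "from_nat_into E"
  have e: "?e n \<in> E" for n using from_nat_into[OF False] .
  have "\<exists>T. \<forall>n. (finite_subcomplex (T n) \<and> (n = 0 \<longrightarrow> T n = S)) \<and> (T n \<subseteq> T (Suc n) \<and> ?e n \<in> T (Suc n))"
  proof (rule dependent_nat_choice)
    fix T and n :: nat assume T: "finite_subcomplex T \<and> (n = 0 \<longrightarrow> T = S)"
    obtain T' where "finite_subcomplex T'" "?e n \<in> T'" using cell_in_finite_subcomplex[OF e] by blast
    then show "\<exists>T'. (finite_subcomplex T' \<and> (Suc n = 0 \<longrightarrow> T' = S)) \<and> T \<subseteq> T' \<and> ?e n \<in> T'"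
      using T finite_subcomplex_Un by (intro exI[of _ "T \<union> T'"]) auto
  qed (use assms in auto)
  then obtain T where T: "\<And>n. finite_subcomplex (T n)" "T 0 = S" "\<And>n. T n \<subseteq> T (Suc n)" "\<And>n. ?e n \<in> T (Suc n)"
    by blast
  have "E \<subseteq> (\<Union>n. T n)"
  proof
    fix c assume "c \<in> E"
    then obtain n where "c = ?e n" using from_nat_into_surj[OF assms(1)] by metis
    then show "c \<in> (\<Union>n. T n)" using T(4)[of n] by auto
  qed
  with T show ?thesis by (intro that[of T])
qed

text \<open>The stages of an exhaustion determine the topology of \<open>Y\<close>: every
  characteristic map has its image in one of them, so a set that is closed on each stage has closed
  preimages in all discs.\<close>

lemma closed_cofibration_finite_subcomplex:
  assumes "countable E" "finite_subcomplex S"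
  shows "closed_cofibration Y (\<Union>S)"
proof -
  obtain T where T: "T 0 = S" "\<And>n. finite_subcomplex (T n)" "\<And>n. T n \<subseteq> T (Suc n)" "E \<subseteq> (\<Union>n. T n)"
    using finite_subcomplex_exhaustion[OF assms] by metis
  let ?A = "\<lambda>n. \<Union>(T n)"
  have cl: "closedin Y (?A n)" for n by (rule closedin_finite_subcomplex[OF T(2)])
  have "closed_cofibration Y (?A 0)"
  proof (rule closed_cofibration_sequence[where A = ?A])
    fix U assume U: "U \<subseteq> topspace Y" "\<And>n. openin (subtopology Y (?A n)) (U \<inter> ?A n)"
    have C: "closedin Y ((topspace Y - U) \<inter> ?A n)" for n
    proof -
      have "closedin (subtopology Y (?A n)) (topspace (subtopology Y (?A n)) - (U \<inter> ?A n))"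
        by (rule closedin_diff[OF closedin_topspace U(2)])
      also have "topspace (subtopology Y (?A n)) - (U \<inter> ?A n) = (topspace Y - U) \<inter> ?A n" by auto
      finally show ?thesis using closedin_trans_full cl by blast
    qed
    have "closedin Y (topspace Y - U)"
    proof (rule closedin_weak)
      fix c assume "c \<in> E"
      then obtain n where n: "c \<in> T n" using T(4) by auto
      have "closedin (disc (d c)) {x \<in> topspace (disc (d c)). \<Phi> c x \<in> (topspace Y - U) \<inter> ?A n}"
        by (rule closedin_continuous_map_preimage[OF continuous_char[OF \<open>c \<in> E\<close>] C])
      also have "{x \<in> topspace (disc (d c)). \<Phi> c x \<in> (topspace Y - U) \<inter> ?A n} =
           {x \<in> disc_set (d c). \<Phi> c x \<in> topspace Y - U}"
        using char_image_subset[OF T(2) n] by auto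
      finally show "closedin (disc (d c)) {x \<in> disc_set (d c). \<Phi> c x \<in> topspace Y - U}" .
    qed auto
    then show "openin Y U" by (simp only: openin_closedin[OF U(1)])
  next
    show "topspace Y \<subseteq> (\<Union>n. ?A n)" unfolding Union_cells[symmetric] using T(4) by blast
    show "closedin Y (?A n)" for n by (rule cl)
    show "?A n \<subseteq> ?A (Suc n)" for n by (rule Union_mono[OF T(3)])
    show "closed_cofibration (subtopology Y (?A (Suc n))) (?A n)" for n
      by (rule closed_cofibration_finite_subcomplexes[OF T(2) T(2) T(3)])
  qed
  then show ?thesis by (simp add: T(1))
qed

text \<open>Otherwise there are points \<open>p n\<close> of \<open>K\<close> outside the stages
  \<open>T n\<close> of an exhaustion. A stage contains only finitely many of them, so every tail of
  the sequence is closed. The complements \<open>U n\<close> of the tails cover \<open>K\<close>,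
  but finitely many of them always miss a later point.\<close>

lemma compactin_in_finite_subcomplex:
  assumes "countable E" "compactin Y K"
  obtains S where "finite_subcomplex S" "K \<subseteq> \<Union>S"
proof -
  obtain T where T: "T 0 = {}" "\<And>n. finite_subcomplex (T n)" "\<And>n. T n \<subseteq> T (Suc n)" "E \<subseteq> (\<Union>n. T n)"
    using finite_subcomplex_exhaustion[OF assms(1) finite_subcomplex_empty] by metis
  have mono: "T m \<subseteq> T n" if "m \<le> n" for m n using lift_Suc_mono_le[of T, OF T(3) that] .
  have "\<exists>n. K \<subseteq> \<Union>(T n)"
  proof (rule ccontr)
    assume "\<not> ?thesis"
    then have "\<forall>n. \<exists>p. p \<in> K \<and> p \<notin> \<Union>(T n)" by blast
    then obtain p where p: "\<And>n. p n \<in> K" "\<And>n. p n \<notin> \<Union>(T n)" by metis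
    have pY: "p n \<in> topspace Y" for n using p(1) compactin_subset_topspace[OF assms(2)] by blast
    define U where "U n = topspace Y - p ` {n..}" for n
    have op: "openin Y (U n)" for n
    proof -
      have "closedin Y (p ` {n..})"
      proof (rule closedin_weak)
        fix c assume c: "c \<in> E"
        then obtain k where k: "c \<in> T k" using T(4) by auto
        have "closedin Y (p ` {n..<k})"
          using Hausdorff pY by (intro closedin_Hausdorff_finite) auto
        then have "closedin (disc (d c)) {x \<in> topspace (disc (d c)). \<Phi> c x \<in> p ` {n..<k}}"
          by (rule closedin_continuous_map_preimage[OF continuous_char[OF c]])
        moreover have "\<Phi> c x \<in> p ` {n..<k} \<longleftrightarrow> \<Phi> c x \<in> p ` {n..}" if x: "x \<in> disc_set (d c)" for x
        proof
          assume "\<Phi> c x \<in> p ` {n..}"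
          then obtain j where j: "\<Phi> c x = p j" "n \<le> j" by auto
          have "j < k"
          proof (rule ccontr)
            assume "\<not> j < k"
            then have "\<Union>(T k) \<subseteq> \<Union>(T j)" by (intro Union_mono mono) simp
            moreover have "\<Phi> c x \<in> \<Union>(T k)" using char_image_subset[OF T(2) k] x by blast
            ultimately show False using p(2)[of j] j(1) by (metis subsetD)
          qed
          with j show "\<Phi> c x \<in> p ` {n..<k}" by auto
        qed auto
        ultimately show "closedin (disc (d c)) {x \<in> disc_set (d c). \<Phi> c x \<in> p ` {n..}}"
          by (simp cong: conj_cong)
      qed (use pY in auto)
      then show ?thesis by (simp add: U_def openin_diff)
    qed
    have "K \<subseteq> \<Union>(range U)"
    proof
      fix y assume "y \<in> K"
      then have "y \<in> topspace Y" using compactin_subset_topspace[OF assms(2)] by blast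
      then obtain k where "y \<in> \<Union>(T k)" using T(4) Union_cells by blast
      then have "y \<in> U k" using \<open>y \<in> topspace Y\<close> p(2) mono unfolding U_def by blast
      then show "y \<in> \<Union>(range U)" by blast
    qed
    then obtain \<F> where \<F>: "finite \<F>" "\<F> \<subseteq> range U" "K \<subseteq> \<Union>\<F>"
      using compactinD[OF assms(2), of "range U"] op by auto
    then obtain N where N: "finite N" "\<F> = U ` N" by (meson finite_subset_image)
    let ?m = "Max (insert 0 N)"
    have "p ?m \<in> \<Union>\<F>" using \<F>(3) p(1) by blast
    then obtain n where "n \<in> N" "p ?m \<in> U n" using N by blast
    moreover have "n \<le> ?m" using N(1) \<open>n \<in> N\<close> by simp
    ultimately show False by (auto simp: U_def)
  qed
  then show ?thesis using that T(2) by blast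
qed

text \<open>The factorisation runs over \<open>Z x Z\<close>, for \<open>Z\<close> the space of
  \<open>S\<close>. The infinite part of \<open>Y\<close> is dealt with by the cofibration
  \<open>Z\<close> in \<open>Y\<close>, multiplied by the identity of \<open>Z\<close>.\<close>

lemma closed_cofibration_diagonal:
  assumes "countable E" "finite_subcomplex S"
  shows "closed_cofibration (prod_topology Y (subtopology Y (\<Union>S))) ((\<lambda>z. (z, z)) ` \<Union>S)"
proof -
  have top: "topspace (subtopology Y (\<Union>S)) = \<Union>S"
    using closedin_subset[OF closedin_finite_subcomplex[OF assms(2)]] by auto
  have "closed_cofibration (prod_topology Y (subtopology Y (\<Union>S))) (\<Union>S \<times> \<Union>S)"
    using closed_cofibration_times_right[OF closed_cofibration_finite_subcomplex[OF assms], of "subtopology Y (\<Union>S)"]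
    by (simp only: top)
  moreover have "subtopology (prod_topology Y (subtopology Y (\<Union>S))) (\<Union>S \<times> \<Union>S)
      = prod_topology (subtopology Y (\<Union>S)) (subtopology Y (\<Union>S))"
    by (simp add: subtopology_Times subtopology_subtopology)
  ultimately show ?thesis
    using closed_cofibration_trans closed_cofibration_diagonal_finite_subcomplex[OF assms(2)] by metis
qed

lemma compact_space_finite:
  assumes "finite E"
  shows "compact_space Y"
proof -
  have "\<Phi> c ` disc_boundary (d c) \<subseteq> \<Union>E" if "c \<in> E" for c
    using char_boundary[OF that] by (metis Sup_subset_mono subset_trans)
  then have "finite_subcomplex E" using assms by (auto simp: finite_subcomplex_def)
  then show ?thesis
    using compactin_finite_subcomplex[of E] Union_cells by (simp add: compact_space_def)
qed

end

section \<open>Relative lifting and Dold's theorem\<close>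

lemma continuous_map_from_unit:
  "continuous_map Z unit_interval f \<Longrightarrow> continuous_map Z euclideanreal f"
  by (rule continuous_map_into_fulltopology)

lemma continuous_map_into_unit:
  assumes "continuous_map Z euclideanreal f" "\<And>z. z \<in> topspace Z \<Longrightarrow> 0 \<le> f z" "\<And>z. z \<in> topspace Z \<Longrightarrow> f z \<le> 1"
  shows "continuous_map Z unit_interval f"
  using assms by (intro continuous_map_into_subtopology) auto

lemmas continuous_map_real_intros =
  continuous_map_add continuous_map_diff continuous_map_real_mult continuous_map_real_min
  continuous_map_real_max continuous_map_canonical_const continuous_map_real_abs

lemma continuous_map_scale:
  assumes "s \<in> {0..1}"
  shows "continuous_map unit_interval unit_interval (\<lambda>t. t * s)"
proof (rule continuous_map_into_unit)
  show "continuous_map unit_interval euclideanreal (\<lambda>t. t * s)"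
    by (intro continuous_map_real_mult continuous_map_canonical_const continuous_map_from_subtopology) simp
qed (use assms in \<open>auto intro: mult_le_one\<close>)

text \<open>The pair \<open>(M, {f})\<close> as an NDR pair, with \<open>u h\<close> bounding the
  time at which the contraction \<open>\<psi>\<close> has brought \<open>h\<close> to
  \<open>f\<close>. Points with \<open>u h > 1\<close> need not arrive. The last clause at
  \<open>t = 0\<close> forces \<open>u\<close> to vanish at \<open>f\<close> only.\<close>

definition well_pointed :: "'m topology \<Rightarrow> 'm \<Rightarrow> bool" where
  "well_pointed M f \<longleftrightarrow> f \<in> topspace M \<and>
     (\<exists>u \<psi>. continuous_map M euclideanreal u \<and> (\<forall>h\<in>topspace M. 0 \<le> u h) \<and> u f = 0 \<and>
        continuous_map (prod_topology unit_interval M) M \<psi> \<and>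
        (\<forall>h\<in>topspace M. \<psi> (0, h) = h) \<and> (\<forall>t\<in>{0..1}. \<psi> (t, f) = f) \<and>
        (\<forall>t\<in>{0..1}. \<forall>h\<in>topspace M. u h \<le> t \<longrightarrow> \<psi> (t, h) = f))"

text \<open>Path lifting for Moore paths: the length \<open>w x\<close> of the path to be lifted depends on the
  parameter, and paths of length \<open>0\<close> are lifted to constant paths.\<close>

definition regular_lifting :: "'p topology \<Rightarrow> 'n topology \<Rightarrow> ('n \<Rightarrow> 'b) \<Rightarrow> 'b topology \<Rightarrow> bool" where
  "regular_lifting P N p B \<longleftrightarrow>
     (\<forall>b w \<beta>. continuous_map P N b \<and> continuous_map P unit_interval w \<and>
        continuous_map (prod_topology P unit_interval) B \<beta> \<and> (\<forall>x\<in>topspace P. \<beta> (x, 0) = p (b x)) \<longrightarrow>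
        (\<exists>L. continuous_map P N L \<and>
           (\<forall>x\<in>topspace P. p (L x) = \<beta> (x, w x) \<and> (w x = 0 \<longrightarrow> L x = b x))))"

text \<open>Homotopy lifting for \<open>[0,1] x M\<close> in the direction \<open>s\<close>, with
  the start \<open>K\<close> and the values \<open>n\<close> over the point \<open>f\<close>
  prescribed. The coordinate \<open>q\<close> allows a homotopy of maps on \<open>M\<close> to be
  deformed in its turn; for lifting a single homotopy it is frozen.\<close>

definition relative_lifting ::
  "'m topology \<Rightarrow> 'm \<Rightarrow> 'n topology \<Rightarrow> ('n \<Rightarrow> 'b) \<Rightarrow> 'b topology \<Rightarrow> bool" where
  "relative_lifting M f N p B \<longleftrightarrow>
     (\<forall>K \<beta> n. continuous_map (prod_topology unit_interval M) N K \<and>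
        continuous_map (prod_topology (prod_topology unit_interval unit_interval) M) B \<beta> \<and>
        continuous_map (prod_topology unit_interval unit_interval) N n \<and>
        (\<forall>q\<in>{0..1}. \<forall>h\<in>topspace M. \<beta> ((q, 0), h) = p (K (q, h))) \<and>
        (\<forall>q\<in>{0..1}. n (q, 0) = K (q, f)) \<and>
        (\<forall>q\<in>{0..1}. \<forall>s\<in>{0..1}. \<beta> ((q, s), f) = p (n (q, s))) \<longrightarrow>
        (\<exists>L. continuous_map (prod_topology (prod_topology unit_interval unit_interval) M) N L \<and>
           (\<forall>q\<in>{0..1}. \<forall>h\<in>topspace M. L ((q, 0), h) = K (q, h)) \<and>
           (\<forall>q\<in>{0..1}. \<forall>s\<in>{0..1}. L ((q, s), f) = n (q, s)) \<and>
           (\<forall>q\<in>{0..1}. \<forall>s\<in>{0..1}. \<forall>h\<in>topspace M. p (L ((q, s), h)) = \<beta> ((q, s), h))))"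

lemma relative_liftingE:
  assumes "relative_lifting M f N p B"
    and "continuous_map (prod_topology unit_interval M) N K"
    and "continuous_map (prod_topology (prod_topology unit_interval unit_interval) M) B \<beta>"
    and "continuous_map (prod_topology unit_interval unit_interval) N n"
    and "\<And>q h. q \<in> {0..1} \<Longrightarrow> h \<in> topspace M \<Longrightarrow> \<beta> ((q, 0), h) = p (K (q, h))"
    and "\<And>q. q \<in> {0..1} \<Longrightarrow> n (q, 0) = K (q, f)"
    and "\<And>q s. q \<in> {0..1} \<Longrightarrow> s \<in> {0..1} \<Longrightarrow> \<beta> ((q, s), f) = p (n (q, s))"
  obtains L where "continuous_map (prod_topology (prod_topology unit_interval unit_interval) M) N L"
    and "\<forall>q\<in>{0..1}. \<forall>h\<in>topspace M. L ((q, 0), h) = K (q, h)"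
    and "\<forall>q\<in>{0..1}. \<forall>s\<in>{0..1}. L ((q, s), f) = n (q, s)"
    and "\<forall>q\<in>{0..1}. \<forall>s\<in>{0..1}. \<forall>h\<in>topspace M. p (L ((q, s), h)) = \<beta> ((q, s), h)"
proof -
  have "\<exists>L. continuous_map (prod_topology (prod_topology unit_interval unit_interval) M) N L \<and>
           (\<forall>q\<in>{0..1}. \<forall>h\<in>topspace M. L ((q, 0), h) = K (q, h)) \<and>
           (\<forall>q\<in>{0..1}. \<forall>s\<in>{0..1}. L ((q, s), f) = n (q, s)) \<and>
           (\<forall>q\<in>{0..1}. \<forall>s\<in>{0..1}. \<forall>h\<in>topspace M. p (L ((q, s), h)) = \<beta> ((q, s), h))"
    by (rule assms(1)[unfolded relative_lifting_def, THEN spec, THEN spec, THEN spec, THEN mp, of K \<beta> n])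
       (intro conjI ballI assms(2-7); assumption)
  then show ?thesis by (elim exE conjE) (rule that)
qed

text \<open>With \<open>w = min s (u h)\<close>, the point \<open>(h, s)\<close> of \<open>M \<times> [0,1]\<close> is moved to
  \<open>(\<psi> w h, s - w)\<close> in \<open>(M \<times> {0}) \<union> ({f} \<times> [0,1])\<close>, where the lift is prescribed; it is transported
  back along the same path, of length \<open>w\<close>.\<close>

lemma relative_lifting_well_pointed:
  fixes M :: "'m topology"
  assumes M: "well_pointed M f"
    and N: "regular_lifting (prod_topology (prod_topology unit_interval unit_interval) M) N p B"
  shows "relative_lifting M f N p B"
  unfolding relative_lifting_def
proof (intro allI impI, elim conjE)
  fix K \<beta> n
  let ?II = "prod_topology unit_interval unit_interval"
  let ?P = "prod_topology ?II M"
  assume K: "continuous_map (prod_topology unit_interval M) N K"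
    and \<beta>: "continuous_map ?P B \<beta>" and n: "continuous_map ?II N n"
    and \<beta>K: "\<forall>q\<in>{0..1}. \<forall>h\<in>topspace M. \<beta> ((q, 0), h) = p (K (q, h))"
    and nK: "\<forall>q\<in>{0..1}. n (q, 0) = K (q, f)"
    and \<beta>n: "\<forall>q\<in>{0..1}. \<forall>s\<in>{0..1}. \<beta> ((q, s), f) = p (n (q, s))"
  obtain u \<psi> where u: "continuous_map M euclideanreal u" "\<And>h. h \<in> topspace M \<Longrightarrow> 0 \<le> u h" "u f = 0"
    and \<psi>: "continuous_map (prod_topology unit_interval M) M \<psi>" "\<And>h. h \<in> topspace M \<Longrightarrow> \<psi> (0, h) = h"
      "\<And>t. t \<in> {0..1} \<Longrightarrow> \<psi> (t, f) = f"
      "\<And>t h. t \<in> {0..1} \<Longrightarrow> h \<in> topspace M \<Longrightarrow> u h \<le> t \<Longrightarrow> \<psi> (t, h) = f"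
    and f: "f \<in> topspace M"
    using M unfolding well_pointed_def by metis
  define q :: "(real \<times> real) \<times> 'm \<Rightarrow> real" where "q z = fst (fst z)" for z
  define s :: "(real \<times> real) \<times> 'm \<Rightarrow> real" where "s z = snd (fst z)" for z
  define h :: "(real \<times> real) \<times> 'm \<Rightarrow> 'm" where "h z = snd z" for z
  note defs = q_def s_def h_def
  define w where "w z = min (s z) (u (h z))" for z
  have mem: "q z \<in> {0..1}" "s z \<in> {0..1}" "h z \<in> topspace M" if "z \<in> topspace ?P" for z
    using that by (auto simp: defs)
  have cq: "continuous_map ?P unit_interval q" and cs: "continuous_map ?P unit_interval s"
    and ch: "continuous_map ?P M h"
    unfolding defs by (intro continuous_map_snd continuous_map_fst'[OF continuous_map_fst] continuous_map_snd'[OF continuous_map_fst])+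
  have cuh: "continuous_map ?P euclideanreal (\<lambda>z. u (h z))"
    by (rule continuous_map_compose'[OF ch u(1)])
  have w01: "0 \<le> w z" "w z \<le> s z" "w z \<le> 1" if "z \<in> topspace ?P" for z
    using mem[OF that] u(2) by (auto simp: w_def min_le_iff_disj)
  have cw: "continuous_map ?P unit_interval w"
    unfolding w_def
    by (intro continuous_map_into_unit continuous_map_real_min continuous_map_from_unit[OF cs] cuh)
       (use w01 in \<open>auto simp: w_def\<close>)
  define b where "b z = (if s z \<le> u (h z) then K (q z, \<psi> (s z, h z)) else n (q z, s z - u (h z)))" for z
  have cb: "continuous_map ?P N b"
    unfolding b_def
  proof (rule continuous_map_cases_le[OF continuous_map_from_unit[OF cs] cuh])
    have "continuous_map ?P N (\<lambda>z. K (q z, \<psi> (s z, h z)))"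
      by (intro continuous_map_compose'[OF _ K] continuous_map_pairedI cq continuous_map_compose'[OF _ \<psi>(1)] cs ch)
    then show "continuous_map (subtopology ?P {z \<in> topspace ?P. s z \<le> u (h z)}) N (\<lambda>z. K (q z, \<psi> (s z, h z)))"
      by (rule continuous_map_from_subtopology)
  next
    let ?Q = "subtopology ?P {z \<in> topspace ?P. u (h z) \<le> s z}"
    have "continuous_map ?Q unit_interval (\<lambda>z. s z - u (h z))"
    proof (rule continuous_map_into_unit)
      show "continuous_map ?Q euclideanreal (\<lambda>z. s z - u (h z))"
        by (intro continuous_map_from_subtopology continuous_map_diff continuous_map_from_unit[OF cs] cuh)
    next
      fix z assume "z \<in> topspace ?Q"
      then have z: "z \<in> topspace ?P" "u (h z) \<le> s z" by simp_all
      show "0 \<le> s z - u (h z)" "s z - u (h z) \<le> 1" using z mem[OF z(1)] u(2) by force+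
    qed
    then show "continuous_map ?Q N (\<lambda>z. n (q z, s z - u (h z)))"
      by (intro continuous_map_compose'[OF _ n] continuous_map_pairedI continuous_map_from_subtopology[OF cq])
  next
    fix z assume z: "z \<in> topspace ?P" "s z = u (h z)"
    then have "\<psi> (s z, h z) = f" using \<psi>(4) mem[OF z(1)] by simp
    then show "K (q z, \<psi> (s z, h z)) = n (q z, s z - u (h z))"
      using nK mem[OF z(1)] z(2) by simp
  qed
  \<comment> \<open>The contraction time still left after running for time \<open>snd y\<close>, cut
    off at \<open>0\<close> because the path must be defined on the whole interval. Thus
    \<open>\<gamma>\<close> starts below \<open>b z\<close> and from time \<open>w z\<close> on
    rests at \<open>\<beta> z\<close>.\<close>
  define w' where "w' y = max 0 (w (fst y) - snd y)" for y :: "((real \<times> real) \<times> 'm) \<times> real"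
  define \<gamma> where "\<gamma> y = \<beta> ((q (fst y), s (fst y) - w' y), \<psi> (w' y, h (fst y)))" for y
  have c\<gamma>: "continuous_map (prod_topology ?P unit_interval) B \<gamma>"
  proof -
    let ?R = "prod_topology ?P unit_interval"
    have cw': "continuous_map ?R euclideanreal w'"
      unfolding w'_def
      by (intro continuous_map_real_max continuous_map_diff continuous_map_canonical_const
          continuous_map_from_unit continuous_map_snd continuous_map_compose'[OF continuous_map_fst cw])
    have w': "0 \<le> w' y" "w' y \<le> s (fst y)" "w' y \<le> 1" if "y \<in> topspace ?R" for y
      using that w01[of "fst y"] mem[of "fst y"] by (auto simp: w'_def mem_Times_iff)
    have "continuous_map ?R unit_interval w'"
      using w' by (intro continuous_map_into_unit cw') auto
    moreover have "continuous_map ?R unit_interval (\<lambda>y. s (fst y) - w' y)"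
    proof (rule continuous_map_into_unit)
      show "continuous_map ?R euclideanreal (\<lambda>y. s (fst y) - w' y)"
        by (intro continuous_map_diff cw' continuous_map_from_unit continuous_map_compose'[OF continuous_map_fst cs])
      fix y assume y: "y \<in> topspace ?R"
      then have "s (fst y) \<le> 1" using mem(2)[of "fst y"] by (simp add: mem_Times_iff)
      then show "0 \<le> s (fst y) - w' y" "s (fst y) - w' y \<le> 1" using w'[OF y] by simp_all
    qed
    ultimately show ?thesis
      unfolding \<gamma>_def
      by (intro continuous_map_compose'[OF _ \<beta>] continuous_map_pairedI continuous_map_compose'[OF _ \<psi>(1)]
          continuous_map_compose'[OF continuous_map_fst cq] continuous_map_compose'[OF continuous_map_fst ch])
  qed
  have \<gamma>b: "\<gamma> (z, 0) = p (b z)" if z: "z \<in> topspace ?P" for z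
  proof (cases "s z \<le> u (h z)")
    case True
    then have "w' (z, 0) = s z" using w01[OF z] mem[OF z] by (simp add: w'_def w_def)
    moreover have "\<psi> (s z, h z) \<in> topspace M"
      using mem[OF z] by (intro continuous_map_mem[OF \<psi>(1)]) simp
    ultimately show ?thesis using \<beta>K mem[OF z] True by (simp add: \<gamma>_def b_def)
  next
    case False
    then have "w' (z, 0) = u (h z)" using w01[OF z] u(2) mem[OF z] by (simp add: w'_def w_def)
    moreover have "\<psi> (u (h z), h z) = f" using \<psi>(4) mem[OF z] u(2) False by simp
    moreover have "s z - u (h z) \<in> {0..1}" using False mem[OF z] u(2)[of "h z"] by simp
    ultimately show ?thesis using \<beta>n mem[OF z] False by (simp add: \<gamma>_def b_def)
  qed
  obtain L where L: "continuous_map ?P N L" "\<And>z. z \<in> topspace ?P \<Longrightarrow> p (L z) = \<gamma> (z, w z)"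
    "\<And>z. z \<in> topspace ?P \<Longrightarrow> w z = 0 \<Longrightarrow> L z = b z"
    using N[unfolded regular_lifting_def, rule_format, of b w \<gamma>] cb cw c\<gamma> \<gamma>b by blast
  show "\<exists>L. continuous_map ?P N L \<and>
           (\<forall>q\<in>{0..1}. \<forall>h\<in>topspace M. L ((q, 0), h) = K (q, h)) \<and>
           (\<forall>q\<in>{0..1}. \<forall>s\<in>{0..1}. L ((q, s), f) = n (q, s)) \<and>
           (\<forall>q\<in>{0..1}. \<forall>s\<in>{0..1}. \<forall>h\<in>topspace M. p (L ((q, s), h)) = \<beta> ((q, s), h))"
  proof (intro exI[of _ L] conjI ballI L(1))
    fix q0 :: real and h0 assume q0: "q0 \<in> {0..1}" and h0: "h0 \<in> topspace M"
    have z: "((q0, 0), h0) \<in> topspace ?P" using q0 h0 by simp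
    have "w ((q0, 0), h0) = 0" using u(2)[OF h0] by (simp add: w_def defs)
    moreover have "b ((q0, 0), h0) = K (q0, h0)"
      using u(2)[OF h0] \<psi>(2)[OF h0] by (simp add: b_def defs)
    ultimately show "L ((q0, 0), h0) = K (q0, h0)" using L(3)[OF z] by simp
  next
    fix q0 s0 :: real assume qs: "q0 \<in> {0..1}" "s0 \<in> {0..1}"
    have z: "((q0, s0), f) \<in> topspace ?P" using qs f by simp
    have "w ((q0, s0), f) = 0" using u(3) qs by (simp add: w_def defs)
    moreover have "b ((q0, s0), f) = n (q0, s0)"
    proof (cases "s0 = 0")
      case True
      then show ?thesis using u(3) \<psi>(2)[OF f] nK qs by (simp add: b_def defs)
    next
      case False
      then have "\<not> s0 \<le> 0" using qs by simp
      then show ?thesis using u(3) by (simp add: b_def defs)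
    qed
    ultimately show "L ((q0, s0), f) = n (q0, s0)" using L(3)[OF z] by simp
  next
    fix q0 s0 :: real and h0 assume qs: "q0 \<in> {0..1}" "s0 \<in> {0..1}" and h0: "h0 \<in> topspace M"
    have z: "((q0, s0), h0) \<in> topspace ?P" using qs h0 by simp
    have "w' (((q0, s0), h0), w ((q0, s0), h0)) = 0" by (simp add: w'_def)
    then have "\<gamma> (((q0, s0), h0), w ((q0, s0), h0)) = \<beta> ((q0, s0), h0)"
      using \<psi>(2)[OF h0] by (simp add: \<gamma>_def defs)
    then show "p (L ((q0, s0), h0)) = \<beta> ((q0, s0), h0)" using L(2)[OF z] by simp
  qed
qed

text \<open>A lift starts inside the component, and moving \<open>s\<close> from \<open>0\<close>
  joins each of its values to the start, so it never leaves.\<close>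

lemma relative_lifting_path_component:
  assumes "relative_lifting M f S p B"
  shows "relative_lifting M f (subtopology S (path_component_of_set S c)) p B"
  unfolding relative_lifting_def
proof (intro allI impI, elim conjE)
  let ?C = "path_component_of_set S c"
  fix K \<beta> n
  let ?II = "prod_topology unit_interval unit_interval"
  let ?P = "prod_topology ?II M"
  assume K: "continuous_map (prod_topology unit_interval M) (subtopology S ?C) K"
    and \<beta>: "continuous_map ?P B \<beta>" and n: "continuous_map ?II (subtopology S ?C) n"
    and rest: "\<forall>q\<in>{0..1}. \<forall>h\<in>topspace M. \<beta> ((q, 0), h) = p (K (q, h))"
      "\<forall>q\<in>{0..1}. n (q, 0) = K (q, f)"
      "\<forall>q\<in>{0..1}. \<forall>s\<in>{0..1}. \<beta> ((q, s), f) = p (n (q, s))"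
  obtain L where L: "continuous_map ?P S L"
    and L': "\<forall>q\<in>{0..1}. \<forall>h\<in>topspace M. L ((q, 0), h) = K (q, h)"
      "\<forall>q\<in>{0..1}. \<forall>s\<in>{0..1}. L ((q, s), f) = n (q, s)"
      "\<forall>q\<in>{0..1}. \<forall>s\<in>{0..1}. \<forall>h\<in>topspace M. p (L ((q, s), h)) = \<beta> ((q, s), h)"
  proof (rule relative_liftingE[OF assms continuous_map_into_fulltopology[OF K] \<beta> continuous_map_into_fulltopology[OF n]])
  qed (rule rest[rule_format]; assumption)+
  have "L ((q, s), h) \<in> ?C" if q: "q \<in> {0..1}" and s: "s \<in> {0..1}" and h: "h \<in> topspace M" for q s h
  proof -
    have "continuous_map unit_interval S (\<lambda>t. L ((q, t * s), h))"
      by (intro continuous_map_compose'[OF _ L] continuous_map_pairedI continuous_map_scale[OF s]) (use q h in auto)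
    then have "path_component_of S (L ((q, 0), h)) (L ((q, s), h))"
      unfolding path_component_of_def pathin_def by (intro exI[of _ "\<lambda>t. L ((q, t * s), h)"]) simp
    moreover have "path_component_of S c (L ((q, 0), h))"
      using continuous_map_mem[OF K, of "(q, h)"] q h L'(1) by simp
    ultimately show ?thesis using path_component_of_trans by fastforce
  qed
  then have "continuous_map ?P (subtopology S ?C) L"
    by (intro continuous_map_into_subtopology[OF L]) (auto simp: Pi_iff)
  then show "\<exists>L. continuous_map ?P (subtopology S ?C) L \<and>
           (\<forall>q\<in>{0..1}. \<forall>h\<in>topspace M. L ((q, 0), h) = K (q, h)) \<and>
           (\<forall>q\<in>{0..1}. \<forall>s\<in>{0..1}. L ((q, s), f) = n (q, s)) \<and>
           (\<forall>q\<in>{0..1}. \<forall>s\<in>{0..1}. \<forall>h\<in>topspace M. p (L ((q, s), h)) = \<beta> ((q, s), h))"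
    using L' by blast
qed

text \<open>The contraction moves every point along a path that begins at that point, so it
  preserves the component.\<close>

lemma well_pointed_path_component:
  assumes "well_pointed S f" "f \<in> path_component_of_set S c"
  shows "well_pointed (subtopology S (path_component_of_set S c)) f"
proof -
  let ?C = "path_component_of_set S c"
  let ?M = "subtopology S ?C"
  obtain u \<psi> where u: "continuous_map S euclideanreal u" "\<And>h. h \<in> topspace S \<Longrightarrow> 0 \<le> u h" "u f = 0"
    and \<psi>: "continuous_map (prod_topology unit_interval S) S \<psi>" "\<And>h. h \<in> topspace S \<Longrightarrow> \<psi> (0, h) = h"
      "\<And>t. t \<in> {0..1} \<Longrightarrow> \<psi> (t, f) = f"
      "\<And>t h. t \<in> {0..1} \<Longrightarrow> h \<in> topspace S \<Longrightarrow> u h \<le> t \<Longrightarrow> \<psi> (t, h) = f"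
    and f: "f \<in> topspace S"
    using assms(1) unfolding well_pointed_def by metis
  have mem: "\<psi> (t, h) \<in> ?C" if t: "t \<in> {0..1}" and h: "h \<in> topspace S" "h \<in> ?C" for t h
  proof -
    have "continuous_map unit_interval S (\<lambda>r. \<psi> (r * t, h))"
      by (intro continuous_map_compose'[OF _ \<psi>(1)] continuous_map_pairedI continuous_map_scale[OF t]) (use h in auto)
    then have "path_component_of S (\<psi> (0, h)) (\<psi> (t, h))"
      unfolding path_component_of_def pathin_def by (intro exI[of _ "\<lambda>r. \<psi> (r * t, h)"]) simp
    then show ?thesis using path_component_of_trans[of S c h] \<psi>(2)[OF h(1)] h(2) by simp
  qed
  have "continuous_map (prod_topology unit_interval ?M) S \<psi>"
  proof -
    have "continuous_map (prod_topology unit_interval ?M) (prod_topology unit_interval S) (\<lambda>z. z)"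
      by (rule continuous_map_into_prod_fulltopology[where S = ?C]) simp
    then show ?thesis by (rule continuous_map_compose'[OF _ \<psi>(1)])
  qed
  then have "continuous_map (prod_topology unit_interval ?M) ?M \<psi>"
    by (rule continuous_map_into_subtopology) (use mem in auto)
  then show ?thesis
    unfolding well_pointed_def
    using u \<psi> f assms(2) continuous_map_from_subtopology[OF u(1)]
    by (intro conjI exI[of _ u] exI[of _ \<psi>]) auto
qed

section \<open>Correcting homotopy inverses over a base\<close>

abbreviation vertical_based :: "'m topology \<Rightarrow> 'm \<Rightarrow> ('m \<Rightarrow> 'b) \<Rightarrow> ('m \<Rightarrow> 'm) \<Rightarrow> bool" where
  "vertical_based M f p \<equiv> (\<lambda>F. F f = f \<and> (\<forall>x\<in>topspace M. p (F x) = p x))"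

text \<open>\<open>F\<close> is run backwards and then \<open>G\<close> forwards, which is why the
  gluing condition concerns the two starting values.\<close>

lemma continuous_map_concat:
  assumes F: "continuous_map (prod_topology unit_interval X) Z F"
    and G: "continuous_map (prod_topology unit_interval X) Z G"
    and eq: "\<And>x. x \<in> topspace X \<Longrightarrow> F (0, x) = G (0, x)"
  shows "continuous_map (prod_topology unit_interval X) Z
           (\<lambda>z. if fst z \<le> 1/2 then F (1 - 2 * fst z, snd z) else G (2 * fst z - 1, snd z))"
proof (rule continuous_map_cases_le)
  let ?P = "prod_topology unit_interval X"
  have c: "continuous_map (subtopology ?P S) euclideanreal fst" for S
    by (intro continuous_map_from_subtopology continuous_map_from_unit continuous_map_fst)
  show "continuous_map ?P euclideanreal fst"
    by (intro continuous_map_from_unit continuous_map_fst)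
  show "continuous_map (subtopology ?P {x \<in> topspace ?P. fst x \<le> 1/2}) Z (\<lambda>z. F (1 - 2 * fst z, snd z))"
    by (intro continuous_map_compose'[OF _ F] continuous_map_pairedI continuous_map_into_unit continuous_map_real_intros c
        continuous_map_from_subtopology[OF continuous_map_snd]) auto
  show "continuous_map (subtopology ?P {x \<in> topspace ?P. 1/2 \<le> fst x}) Z (\<lambda>z. G (2 * fst z - 1, snd z))"
    by (intro continuous_map_compose'[OF _ G] continuous_map_pairedI continuous_map_into_unit continuous_map_real_intros c
        continuous_map_from_subtopology[OF continuous_map_snd]) auto
next
  fix z assume z: "z \<in> topspace (prod_topology unit_interval X)" "fst z = 1/2"
  have "1 - 2 * fst z = 0" "2 * fst z - 1 = 0" using z(2) by simp_all
  then show "F (1 - 2 * fst z, snd z) = G (2 * fst z - 1, snd z)"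
    using eq[of "snd z"] z(1) by (simp add: mem_Times_iff)
qed (rule continuous_map_canonical_const)

text \<open>The projection of \<open>\<Theta>\<close> to the base is a homotopy \<open>\<alpha>\<close> from the identity to itself, possibly
  an essential one. Lifting \<open>\<alpha>\<close> to a homotopy starting at \<open>\<Gamma>\<close> corrects \<open>\<Gamma>\<close>: the combined homotopy
  then covers \<open>\<alpha>\<close> run backwards and forwards, which is contracted in a second lifting step.\<close>

lemma vertical_based_left_inverse:
  assumes f: "f \<in> topspace M" and \<Phi>: "continuous_map M N \<Phi>" and \<Gamma>: "continuous_map N M \<Gamma>"
    and p: "continuous_map M B p" and p': "continuous_map N B p'"
    and \<Phi>p: "\<And>x. x \<in> topspace M \<Longrightarrow> p' (\<Phi> x) = p x" and \<Gamma>p: "\<And>y. y \<in> topspace N \<Longrightarrow> p (\<Gamma> y) = p' y"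
    and \<Phi>f: "\<Phi> f = g"
    and \<Theta>: "continuous_map (prod_topology unit_interval M) M \<Theta>"
      "\<And>x. x \<in> topspace M \<Longrightarrow> \<Theta> (0, x) = \<Gamma> (\<Phi> x)" "\<And>x. x \<in> topspace M \<Longrightarrow> \<Theta> (1, x) = x"
    and \<alpha>: "continuous_map (prod_topology unit_interval B) B \<alpha>"
      "\<And>b. b \<in> topspace B \<Longrightarrow> \<alpha> (0, b) = b" "\<And>b. b \<in> topspace B \<Longrightarrow> \<alpha> (1, b) = b"
    and \<Theta>\<alpha>: "\<And>s x. s \<in> {0..1} \<Longrightarrow> x \<in> topspace M \<Longrightarrow> p (\<Theta> (s, x)) = \<alpha> (s, p x)"
    and NM: "relative_lifting N g M p B" and MM: "relative_lifting M f M p B"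
  obtains \<Lambda> where "continuous_map (prod_topology unit_interval N) M \<Lambda>"
    "\<forall>y\<in>topspace N. \<Lambda> (0, y) = \<Gamma> y"
    "\<forall>s\<in>{0..1}. \<forall>y\<in>topspace N. p (\<Lambda> (s, y)) = \<alpha> (s, p' y)"
    "\<Lambda> (1, g) = f"
    "homotopic_with (vertical_based M f p) M M (\<lambda>x. \<Lambda> (1, \<Phi> x)) id"
proof -
  let ?II = "prod_topology unit_interval unit_interval"
  let ?IM = "prod_topology unit_interval M"
  have g: "g \<in> topspace N" using continuous_map_mem[OF \<Phi> f] \<Phi>f by simp
  have pB: "p x \<in> topspace B" if "x \<in> topspace M" for x using continuous_map_mem[OF p that] .
  have p'B: "p' y \<in> topspace B" if "y \<in> topspace N" for y using continuous_map_mem[OF p' that] .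
  obtain L where L: "continuous_map (prod_topology ?II N) M L"
    and LK: "\<forall>q\<in>{0..1}. \<forall>y\<in>topspace N. L ((q, 0), y) = \<Gamma> (snd (q, y))"
    and Ln: "\<forall>q\<in>{0..1}. \<forall>s\<in>{0..1}. L ((q, s), g) = \<Theta> (snd (q, s), f)"
    and Lp: "\<forall>q\<in>{0..1}. \<forall>s\<in>{0..1}. \<forall>y\<in>topspace N. p (L ((q, s), y)) = \<alpha> (snd (fst ((q, s), y)), p' (snd ((q, s), y)))"
  proof (rule relative_liftingE[OF NM, where K = "\<lambda>z. \<Gamma> (snd z)" and \<beta> = "\<lambda>z. \<alpha> (snd (fst z), p' (snd z))"
        and n = "\<lambda>z. \<Theta> (snd z, f)"])
    show "continuous_map (prod_topology unit_interval N) M (\<lambda>z. \<Gamma> (snd z))"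
      by (rule continuous_map_compose'[OF continuous_map_snd \<Gamma>])
    show "continuous_map (prod_topology ?II N) B (\<lambda>z. \<alpha> (snd (fst z), p' (snd z)))"
      by (intro continuous_map_compose'[OF _ \<alpha>(1)] continuous_map_pairedI continuous_map_snd'[OF continuous_map_fst] continuous_map_compose'[OF continuous_map_snd p'])
    show "continuous_map ?II M (\<lambda>z. \<Theta> (snd z, f))"
      by (intro continuous_map_compose'[OF _ \<Theta>(1)] continuous_map_pairedI continuous_map_snd) (simp add: f)
    show "\<alpha> (snd (fst ((q, 0), h)), p' (snd ((q, 0), h))) = p (\<Gamma> (snd (q, h)))" if "h \<in> topspace N" for q h
      using that \<Gamma>p \<alpha>(2) p'B by simp
    show "\<Theta> (snd (q, 0), f) = \<Gamma> (snd (q, g))" for q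
      using \<Theta>(2)[OF f] \<Phi>f by simp
    show "\<alpha> (snd (fst ((q, s), g)), p' (snd ((q, s), g))) = p (\<Theta> (snd (q, s), f))" if "s \<in> {0..1}" for q s
      using \<Theta>\<alpha>[OF that f] \<Phi>p[OF f] \<Phi>f by simp
  qed
  \<comment> \<open>Only one homotopy was to be lifted, so all slices had the same data and the one
    at \<open>q = 0\<close> is taken.\<close>
  define \<Lambda> where "\<Lambda> z = L ((0, fst z), snd z)" for z
  have c\<Lambda>: "continuous_map (prod_topology unit_interval N) M \<Lambda>"
    unfolding \<Lambda>_def by (intro continuous_map_compose'[OF _ L] continuous_map_pairedI continuous_map_fst continuous_map_snd) simp
  have \<Lambda>0: "\<Lambda> (0, y) = \<Gamma> y" if "y \<in> topspace N" for y using LK that by (simp add: \<Lambda>_def)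
  have \<Lambda>p: "p (\<Lambda> (s, y)) = \<alpha> (s, p' y)" if "s \<in> {0..1}" "y \<in> topspace N" for s y
    using Lp that by (simp add: \<Lambda>_def)
  have \<Lambda>g: "\<Lambda> (s, g) = \<Theta> (s, f)" if "s \<in> {0..1}" for s using Ln that by (simp add: \<Lambda>_def)
  \<comment> \<open>From the identity back along \<open>\<Theta>\<close> to
    \<open>\<Gamma> \<circ> \<Phi>\<close>, then along \<open>\<Lambda>\<close> to the corrected
    composite. Over the base this is \<open>\<alpha>\<close> at time
    \<open>|2 t - 1|\<close>.\<close>
  define T where "T z = (if fst z \<le> 1/2 then \<Theta> (1 - 2 * fst z, snd z) else \<Lambda> (2 * fst z - 1, \<Phi> (snd z)))" for z
  have cT: "continuous_map ?IM M T"
  proof -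
    have "continuous_map ?IM M (\<lambda>z. \<Lambda> (fst z, \<Phi> (snd z)))"
      by (intro continuous_map_compose'[OF _ c\<Lambda>] continuous_map_pairedI continuous_map_fst continuous_map_compose'[OF continuous_map_snd \<Phi>])
    note c = continuous_map_concat[OF \<Theta>(1) this, unfolded fst_conv snd_conv]
    show ?thesis
      unfolding T_def[abs_def] by (rule c) (simp add: \<Theta>(2) \<Lambda>0 continuous_map_mem[OF \<Phi>])
  qed
  \<comment> \<open>Linear interpolation in \<open>s\<close> from \<open>|2 t - 1|\<close> to
    \<open>1\<close>. It equals \<open>1\<close> for \<open>s = 1\<close> as well as for
    \<open>t = 0\<close> and \<open>t = 1\<close>, so it contracts the track of \<open>T\<close> and
    is constant on the three other sides of the square.\<close>
  define a where "a t s = \<bar>2 * t - 1\<bar> + (1 - \<bar>2 * t - 1\<bar>) * s" for t s :: real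
  have a01: "a t s \<in> {0..1}" if "t \<in> {0..1}" "s \<in> {0..1}" for t s
  proof -
    have "\<bar>2 * t - 1\<bar> \<le> 1" using that by auto
    moreover from this have "(1 - \<bar>2 * t - 1\<bar>) * s \<le> (1 - \<bar>2 * t - 1\<bar>) * 1" using that by (intro mult_left_mono) auto
    ultimately show ?thesis using that by (simp add: a_def)
  qed
  have ca: "continuous_map ?II unit_interval (\<lambda>z. a (fst z) (snd z))"
  proof (rule continuous_map_into_unit)
    show "continuous_map ?II euclideanreal (\<lambda>z. a (fst z) (snd z))"
      unfolding a_def
      by (intro continuous_map_real_intros continuous_map_from_unit continuous_map_fst continuous_map_snd)
  qed (use a01 in \<open>auto simp: mem_Times_iff\<close>)
  have Tp: "p (T (t, x)) = \<alpha> (\<bar>2 * t - 1\<bar>, p x)" if "t \<in> {0..1}" "x \<in> topspace M" for t x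
  proof (cases "t \<le> 1/2")
    case True
    then have "\<bar>2 * t - 1\<bar> = 1 - 2 * t" by simp
    then show ?thesis using \<Theta>\<alpha>[of "1 - 2 * t" x] that True by (simp add: T_def)
  next
    case False
    then have "\<bar>2 * t - 1\<bar> = 2 * t - 1" by simp
    then show ?thesis
      using \<Lambda>p[of "2 * t - 1" "\<Phi> x"] that False continuous_map_mem[OF \<Phi> that(2)] \<Phi>p[OF that(2)] by (simp add: T_def)
  qed
  have Tf: "T (t, f) = \<Theta> (\<bar>2 * t - 1\<bar>, f)" if "t \<in> {0..1}" for t
  proof (cases "t \<le> 1/2")
    case True
    then have "\<bar>2 * t - 1\<bar> = 1 - 2 * t" by simp
    then show ?thesis using True by (simp add: T_def)
  next
    case False
    then have "\<bar>2 * t - 1\<bar> = 2 * t - 1" by simp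
    then show ?thesis using \<Lambda>g[of "2 * t - 1"] that False \<Phi>f by (simp add: T_def)
  qed
  obtain L' where L': "continuous_map (prod_topology ?II M) M L'"
    and L'K: "\<forall>q\<in>{0..1}. \<forall>x\<in>topspace M. L' ((q, 0), x) = T (q, x)"
    and L'n: "\<forall>q\<in>{0..1}. \<forall>s\<in>{0..1}. L' ((q, s), f) = \<Theta> (a (fst (q, s)) (snd (q, s)), f)"
    and L'p: "\<forall>q\<in>{0..1}. \<forall>s\<in>{0..1}. \<forall>x\<in>topspace M. p (L' ((q, s), x)) =
      \<alpha> (a (fst (fst ((q, s), x))) (snd (fst ((q, s), x))), p (snd ((q, s), x)))"
  proof (rule relative_liftingE[OF MM cT, where \<beta> = "\<lambda>z. \<alpha> (a (fst (fst z)) (snd (fst z)), p (snd z))"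
        and n = "\<lambda>z. \<Theta> (a (fst z) (snd z), f)"])
    show "continuous_map (prod_topology ?II M) B (\<lambda>z. \<alpha> (a (fst (fst z)) (snd (fst z)), p (snd z)))"
      by (intro continuous_map_compose'[OF _ \<alpha>(1)] continuous_map_pairedI continuous_map_compose'[OF continuous_map_fst ca]
          continuous_map_compose'[OF continuous_map_snd p])
    show "continuous_map ?II M (\<lambda>z. \<Theta> (a (fst z) (snd z), f))"
      by (intro continuous_map_compose'[OF _ \<Theta>(1)] continuous_map_pairedI ca) (simp add: f)
    show "\<alpha> (a (fst (fst ((q, 0), h))) (snd (fst ((q, 0), h))), p (snd ((q, 0), h))) = p (T (q, h))"
      if "q \<in> {0..1}" "h \<in> topspace M" for q h
      using Tp[OF that] by (simp add: a_def)
    show "\<Theta> (a (fst (q, 0)) (snd (q, 0)), f) = T (q, f)" if "q \<in> {0..1}" for q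
      using Tf[OF that] by (simp add: a_def)
    show "\<alpha> (a (fst (fst ((q, s), f))) (snd (fst ((q, s), f))), p (snd ((q, s), f))) = p (\<Theta> (a (fst (q, s)) (snd (q, s)), f))"
      if "q \<in> {0..1}" "s \<in> {0..1}" for q s
      using \<Theta>\<alpha>[OF a01[OF that] f] by simp
  qed
  have edge: "homotopic_with (vertical_based M f p) M M (\<lambda>x. L' ((i, j), x)) (\<lambda>x. L' ((k, l), x))"
    if ij: "i \<in> {0..1}" "j \<in> {0..1}" "k \<in> {0..1}" "l \<in> {0..1}"
      and a1: "\<And>t. t \<in> {0..1} \<Longrightarrow> a ((1 - t) * i + t * k) ((1 - t) * j + t * l) = 1" for i j k l
    unfolding homotopic_with_def
  proof (intro exI[of _ "\<lambda>z. L' (((1 - fst z) * i + fst z * k, (1 - fst z) * j + fst z * l), snd z)"] conjI allI ballI)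
    have conv: "(1 - t) * x + t * y \<in> {0..1}" if "t \<in> {0..1}" "x \<in> {0..1}" "y \<in> {0..1}" for t x y :: real
      using convexD_alt[of "{0..1::real}" x y t] that by simp
    have c: "continuous_map ?IM unit_interval (\<lambda>z. (1 - fst z) * x + fst z * y)" if "x \<in> {0..1}" "y \<in> {0..1}" for x y
    proof (rule continuous_map_into_unit)
      show "continuous_map ?IM euclideanreal (\<lambda>z. (1 - fst z) * x + fst z * y)"
        by (intro continuous_map_real_intros continuous_map_from_unit continuous_map_fst)
    next
      fix z assume "z \<in> topspace ?IM"
      then have "fst z \<in> {0..1}" by (simp add: mem_Times_iff)
      from conv[OF this that] show "0 \<le> (1 - fst z) * x + fst z * y" "(1 - fst z) * x + fst z * y \<le> 1" by simp_all
    qed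
    show "continuous_map ?IM M (\<lambda>z. L' (((1 - fst z) * i + fst z * k, (1 - fst z) * j + fst z * l), snd z))"
      by (intro continuous_map_compose'[OF _ L'] continuous_map_pairedI c continuous_map_snd ij)
    fix t :: real assume t: "t \<in> {0..1}"
    note c01 = conv[OF t ij(1,3)] conv[OF t ij(2,4)]
    show "L' (((1 - fst (t, f)) * i + fst (t, f) * k, (1 - fst (t, f)) * j + fst (t, f) * l), snd (t, f)) = f"
      using L'n[rule_format, OF c01] a1[OF t] \<Theta>(3)[OF f] by simp
    show "p (L' (((1 - fst (t, x)) * i + fst (t, x) * k, (1 - fst (t, x)) * j + fst (t, x) * l), snd (t, x))) = p x"
      if "x \<in> topspace M" for x
      using L'p[rule_format, OF c01 that] a1[OF t] \<alpha>(3)[OF pB[OF that]] by simp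
  qed simp_all
  \<comment> \<open>The side \<open>s = 0\<close> carries \<open>T\<close>, which is neither
    vertical nor based. Its end points are joined along the other three sides, where
    \<open>a = 1\<close> and hence the lift covers the identity and fixes \<open>f\<close>.\<close>
  have e1: "homotopic_with (vertical_based M f p) M M (\<lambda>x. L' ((1, 0), x)) (\<lambda>x. L' ((1, 1), x))"
    by (rule edge) (auto simp: a_def)
  have e2: "homotopic_with (vertical_based M f p) M M (\<lambda>x. L' ((1, 1), x)) (\<lambda>x. L' ((0, 1), x))"
    by (rule edge) (auto simp: a_def)
  have e3: "homotopic_with (vertical_based M f p) M M (\<lambda>x. L' ((0, 1), x)) (\<lambda>x. L' ((0, 0), x))"
    by (rule edge) (auto simp: a_def)
  have "homotopic_with (vertical_based M f p) M M (\<lambda>x. L' ((1, 0), x)) (\<lambda>x. L' ((0, 0), x))"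
    by (rule homotopic_with_trans[OF homotopic_with_trans[OF e1 e2] e3])
  then have "homotopic_with (vertical_based M f p) M M (\<lambda>x. \<Lambda> (1, \<Phi> x)) id"
  proof (rule homotopic_with_eq)
    show "\<Lambda> (1, \<Phi> x) = L' ((1, 0), x)" "id x = L' ((0, 0), x)" if "x \<in> topspace M" for x
      using L'K[rule_format, of 1 x] L'K[rule_format, of 0 x] that \<Theta>(3) by (simp_all add: T_def)
    show "vertical_based M f p h \<longleftrightarrow> vertical_based M f p k" if "\<And>x. x \<in> topspace M \<Longrightarrow> h x = k x" for h k
      using that f by auto
  qed
  then show ?thesis
    using that[of \<Lambda>] c\<Lambda> \<Lambda>0 \<Lambda>p \<Lambda>g[of 1] \<Theta>(3)[OF f] by simp
qed

text \<open>\<open>\<Phi>\<close> remains as it is and only its inverse is changed, by two uses of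
  \<open>vertical_based_left_inverse\<close>: for \<open>\<Phi>\<close>, and then for the corrected
  inverse \<open>\<Gamma>1\<close>. The maps \<open>\<alpha>\<close> and \<open>\<alpha>'\<close>
  express that the given homotopies, although not vertical, move all points of a fibre in the same
  way over the base.\<close>

theorem fibre_homotopy_equivalence_Dold:
  assumes f: "f \<in> topspace M" and \<Phi>: "continuous_map M N \<Phi>" and \<Gamma>: "continuous_map N M \<Gamma>"
    and p: "continuous_map M B p" and p': "continuous_map N B p'"
    and \<Phi>p: "\<And>x. x \<in> topspace M \<Longrightarrow> p' (\<Phi> x) = p x" and \<Gamma>p: "\<And>y. y \<in> topspace N \<Longrightarrow> p (\<Gamma> y) = p' y"
    and \<Phi>f: "\<Phi> f = g"
    and \<Theta>: "continuous_map (prod_topology unit_interval M) M \<Theta>"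
      "\<And>x. x \<in> topspace M \<Longrightarrow> \<Theta> (0, x) = \<Gamma> (\<Phi> x)" "\<And>x. x \<in> topspace M \<Longrightarrow> \<Theta> (1, x) = x"
    and \<alpha>: "continuous_map (prod_topology unit_interval B) B \<alpha>"
      "\<And>b. b \<in> topspace B \<Longrightarrow> \<alpha> (0, b) = b" "\<And>b. b \<in> topspace B \<Longrightarrow> \<alpha> (1, b) = b"
    and \<Theta>\<alpha>: "\<And>s x. s \<in> {0..1} \<Longrightarrow> x \<in> topspace M \<Longrightarrow> p (\<Theta> (s, x)) = \<alpha> (s, p x)"
    and \<Xi>: "continuous_map (prod_topology unit_interval N) N \<Xi>"
      "\<And>y. y \<in> topspace N \<Longrightarrow> \<Xi> (0, y) = \<Phi> (\<Gamma> y)" "\<And>y. y \<in> topspace N \<Longrightarrow> \<Xi> (1, y) = y"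
    and \<alpha>': "continuous_map (prod_topology unit_interval B) B \<alpha>'"
      "\<And>b. b \<in> topspace B \<Longrightarrow> \<alpha>' (0, b) = b" "\<And>b. b \<in> topspace B \<Longrightarrow> \<alpha>' (1, b) = b"
    and \<Xi>\<alpha>': "\<And>s y. s \<in> {0..1} \<Longrightarrow> y \<in> topspace N \<Longrightarrow> p' (\<Xi> (s, y)) = \<alpha>' (s, p' y)"
    and NM: "relative_lifting N g M p B" and MM: "relative_lifting M f M p B"
    and MN: "relative_lifting M f N p' B" and NN: "relative_lifting N g N p' B"
  shows "fibre_homotopy_equivalence M f p N g p' \<Phi>"
proof -
  have g: "g \<in> topspace N" using continuous_map_mem[OF \<Phi> f] \<Phi>f by simp
  have pB: "p x \<in> topspace B" if "x \<in> topspace M" for x using continuous_map_mem[OF p that] .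
  have p'B: "p' y \<in> topspace B" if "y \<in> topspace N" for y using continuous_map_mem[OF p' that] .
  obtain \<Lambda> where \<Lambda>: "continuous_map (prod_topology unit_interval N) M \<Lambda>"
    "\<forall>y\<in>topspace N. \<Lambda> (0, y) = \<Gamma> y"
    "\<forall>s\<in>{0..1}. \<forall>y\<in>topspace N. p (\<Lambda> (s, y)) = \<alpha> (s, p' y)"
    "\<Lambda> (1, g) = f"
    and left: "homotopic_with (vertical_based M f p) M M (\<lambda>x. \<Lambda> (1, \<Phi> x)) id"
    by (rule vertical_based_left_inverse[OF f \<Phi> \<Gamma> p p' \<Phi>p \<Gamma>p \<Phi>f \<Theta> \<alpha> \<Theta>\<alpha> NM MM])
  define \<Gamma>1 where "\<Gamma>1 y = \<Lambda> (1, y)" for y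
  have c\<Gamma>1: "continuous_map N M \<Gamma>1"
    unfolding \<Gamma>1_def by (intro continuous_map_compose'[OF _ \<Lambda>(1)] continuous_map_pairedI) auto
  have \<Gamma>1p: "p (\<Gamma>1 y) = p' y" if "y \<in> topspace N" for y
    using \<Lambda>(3)[rule_format, of 1 y] that \<alpha>(3) p'B by (simp add: \<Gamma>1_def)
  \<comment> \<open>The second use needs a homotopy from \<open>\<Phi> \<circ> \<Gamma>1\<close> to
    the identity: back along \<open>\<Phi> \<circ> \<Lambda>\<close> to
    \<open>\<Phi> \<circ> \<Gamma>\<close>, then along \<open>\<Xi>\<close>. Over the base it
    follows \<open>\<alpha>\<close> backwards and \<open>\<alpha>'\<close> forwards, again a loop at
    the identity.\<close>
  define \<Theta>' where "\<Theta>' z = (if fst z \<le> 1/2 then \<Phi> (\<Lambda> (1 - 2 * fst z, snd z)) else \<Xi> (2 * fst z - 1, snd z))" for z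
  define \<alpha>'' where "\<alpha>'' z = (if fst z \<le> 1/2 then \<alpha> (1 - 2 * fst z, snd z) else \<alpha>' (2 * fst z - 1, snd z))" for z
  have c\<Theta>': "continuous_map (prod_topology unit_interval N) N \<Theta>'"
    unfolding \<Theta>'_def[abs_def]
    by (rule continuous_map_concat[OF continuous_map_compose'[OF \<Lambda>(1) \<Phi>] \<Xi>(1)]) (simp add: \<Lambda>(2) \<Xi>(2))
  have c\<alpha>'': "continuous_map (prod_topology unit_interval B) B \<alpha>''"
    unfolding \<alpha>''_def[abs_def] by (rule continuous_map_concat[OF \<alpha>(1) \<alpha>'(1)]) (simp add: \<alpha>(2) \<alpha>'(2))
  have \<Theta>'\<alpha>'': "p' (\<Theta>' (s, y)) = \<alpha>'' (s, p' y)" if "s \<in> {0..1}" "y \<in> topspace N" for s y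
  proof (cases "s \<le> 1/2")
    case True
    then have s: "1 - 2 * s \<in> {0..1}" using that by auto
    have "\<Lambda> (1 - 2 * s, y) \<in> topspace M" using s that by (intro continuous_map_mem[OF \<Lambda>(1)]) simp
    then show ?thesis using True \<Phi>p \<Lambda>(3)[rule_format, OF s that(2)] by (simp add: \<Theta>'_def \<alpha>''_def)
  next
    case False
    then have "2 * s - 1 \<in> {0..1}" using that by auto
    then show ?thesis using False \<Xi>\<alpha>' that(2) by (simp add: \<Theta>'_def \<alpha>''_def)
  qed
  obtain \<Lambda>' where \<Lambda>': "continuous_map (prod_topology unit_interval M) N \<Lambda>'"
    "\<forall>x\<in>topspace M. \<Lambda>' (0, x) = \<Phi> x"
    "\<forall>s\<in>{0..1}. \<forall>x\<in>topspace M. p' (\<Lambda>' (s, x)) = \<alpha>'' (s, p x)"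
    "\<Lambda>' (1, f) = g"
    and right: "homotopic_with (vertical_based N g p') N N (\<lambda>y. \<Lambda>' (1, \<Gamma>1 y)) id"
  proof (rule vertical_based_left_inverse[OF g c\<Gamma>1 \<Phi> p' p \<Gamma>1p \<Phi>p, where \<Theta> = \<Theta>' and \<alpha> = \<alpha>'' and g = f])
    show "\<Gamma>1 g = f" by (simp add: \<Gamma>1_def \<Lambda>(4))
    show "\<Theta>' (0, y) = \<Phi> (\<Gamma>1 y)" "\<Theta>' (1, y) = y" if "y \<in> topspace N" for y
      using \<Xi>(3) that by (simp_all add: \<Theta>'_def \<Gamma>1_def)
    show "\<alpha>'' (0, b) = b" "\<alpha>'' (1, b) = b" if "b \<in> topspace B" for b
      using \<alpha>(3) \<alpha>'(3) that by (simp_all add: \<alpha>''_def)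
    show "p' (\<Theta>' (s, y)) = \<alpha>'' (s, p' y)" if "s \<in> {0..1}" "y \<in> topspace N" for s y
      by (rule \<Theta>'\<alpha>''[OF that])
    show "continuous_map (prod_topology unit_interval N) N \<Theta>'" "continuous_map (prod_topology unit_interval B) B \<alpha>''"
      by (rule c\<Theta>' c\<alpha>'')+
    show "relative_lifting M f N p' B" "relative_lifting N g N p' B"
      by (rule MN NN)+
  qed
  define \<Phi>1 where "\<Phi>1 x = \<Lambda>' (1, x)" for x
  have c\<Phi>1: "continuous_map M N \<Phi>1"
    unfolding \<Phi>1_def by (intro continuous_map_compose'[OF _ \<Lambda>'(1)] continuous_map_pairedI) auto
  have \<Phi>1p: "p' (\<Phi>1 x) = p x" if "x \<in> topspace M" for x
    using \<Lambda>'(3)[rule_format, of 1 x] that \<alpha>'(3)[OF pB] by (simp add: \<Phi>1_def \<alpha>''_def)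
  have left': "homotopic_with (vertical_based M f p) M M (\<Gamma>1 \<circ> \<Phi>) id"
    using left by (simp add: \<Gamma>1_def o_def)
  have right': "homotopic_with (vertical_based N g p') N N (\<Phi>1 \<circ> \<Gamma>1) id"
    using right by (simp add: \<Gamma>1_def \<Phi>1_def o_def)
  text \<open>A left inverse \<open>\<Gamma>1\<close> with a left inverse \<open>\<Phi>1\<close> of its own is a two-sided inverse:
    \<open>\<Phi> \<circ> \<Gamma>1 \<simeq> \<Phi>1 \<circ> \<Gamma>1 \<circ> \<Phi> \<circ> \<Gamma>1 \<simeq> \<Phi>1 \<circ> \<Gamma>1\<close>.\<close>
  have 1: "homotopic_with (vertical_based N g p') N N ((\<Phi>1 \<circ> \<Gamma>1) \<circ> (\<Phi> \<circ> \<Gamma>1)) (id \<circ> (\<Phi> \<circ> \<Gamma>1))"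
  proof (rule homotopic_with_compose_continuous_map_right[OF right' continuous_map_compose[OF c\<Gamma>1 \<Phi>]])
    show "vertical_based N g p' (j \<circ> (\<Phi> \<circ> \<Gamma>1))" if "vertical_based N g p' j" for j
      using that \<Gamma>1p \<Phi>p continuous_map_mem[OF c\<Gamma>1] continuous_map_mem[OF \<Phi>] \<Phi>f \<Lambda>(4) by (simp add: \<Gamma>1_def)
  qed
  have 2: "homotopic_with (\<lambda>F. F f = g \<and> (\<forall>x\<in>topspace M. p' (F x) = p x)) M N (\<Phi>1 \<circ> (\<Gamma>1 \<circ> \<Phi>)) (\<Phi>1 \<circ> id)"
  proof (rule homotopic_with_compose_continuous_map_left)
    \<comment> \<open>The property also records that the maps stay in \<open>topspace M\<close>, for
      \<open>\<Phi>1\<close> respects the projections only there.\<close>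
    show "homotopic_with (\<lambda>j. vertical_based M f p j \<and> (\<forall>x\<in>topspace M. j x \<in> topspace M)) M M (\<Gamma>1 \<circ> \<Phi>) id"
      by (rule homotopic_with_mono[OF left']) (auto dest: continuous_map_mem)
  qed (use c\<Phi>1 \<Phi>1p \<Lambda>'(4) in \<open>auto simp: \<Phi>1_def\<close>)
  have 3: "homotopic_with (vertical_based N g p') N N ((\<Phi>1 \<circ> (\<Gamma>1 \<circ> \<Phi>)) \<circ> \<Gamma>1) ((\<Phi>1 \<circ> id) \<circ> \<Gamma>1)"
    by (rule homotopic_with_compose_continuous_map_right[OF 2 c\<Gamma>1])
       (use continuous_map_mem[OF c\<Gamma>1] \<Gamma>1p \<Lambda>(4) in \<open>auto simp: \<Gamma>1_def\<close>)
  note h1 = homotopic_with_symD[OF 1, unfolded comp_assoc id_comp] and h3 = 3[unfolded comp_assoc id_comp]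
  have "homotopic_with (vertical_based N g p') N N (\<Phi> \<circ> \<Gamma>1) id"
    by (rule homotopic_with_trans[OF homotopic_with_trans[OF h1 h3] right'])
  then show ?thesis
    unfolding fibre_homotopy_equivalence_def using \<Phi> \<Phi>f \<Phi>p c\<Gamma>1 left' by blast
qed

section \<open>Mapping spaces\<close>

lemma topspace_mapping_space [simp]: "topspace (mapping_space X Y) = maps X Y"
proof -
  have "maps X Y \<in> {{f \<in> maps X Y. f ` K \<subseteq> U} | K U. compactin X K \<and> openin Y U}"
    by (auto intro!: exI[of _ "{}"])
  then show ?thesis
    unfolding mapping_space_def topology_generated_by_topspace by auto
qed

section \<open>Continuity in the compact-open topology\<close>

lemma openin_mapping_space:
  assumes "compactin X K" "openin Y U"
  shows "openin (mapping_space X Y) {f \<in> maps X Y. f ` K \<subseteq> U}"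
  unfolding mapping_space_def using assms by (intro topology_generated_by_Basis) blast

lemma continuous_map_into_mapping_space:
  assumes "\<And>x. x \<in> topspace P \<Longrightarrow> F x \<in> maps X Y"
    and "\<And>K U. compactin X K \<Longrightarrow> openin Y U \<Longrightarrow> openin P {x \<in> topspace P. F x ` K \<subseteq> U}"
  shows "continuous_map P (mapping_space X Y) F"
  unfolding mapping_space_def continuous_on_generated_topo_iff
proof (intro conjI allI impI)
  fix V assume "V \<in> {{f \<in> maps X Y. f ` K \<subseteq> U} | K U. compactin X K \<and> openin Y U}"
  then obtain K U where V: "V = {f \<in> maps X Y. f ` K \<subseteq> U}" and KU: "compactin X K" "openin Y U" by blast
  have "F -` V \<inter> topspace P = {x \<in> topspace P. F x ` K \<subseteq> U}"
    using assms(1) by (auto simp: V)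
  then show "openin P (F -` V \<inter> topspace P)" using assms(2)[OF KU] by simp
next
  have "\<Union>{{f \<in> maps X Y. f ` K \<subseteq> U} | K U. compactin X K \<and> openin Y U} = maps X Y"
    using topspace_mapping_space[of X Y] unfolding mapping_space_def topology_generated_by_topspace .
  then show "F ` topspace P \<subseteq> \<Union>{{f \<in> maps X Y. f ` K \<subseteq> U} | K U. compactin X K \<and> openin Y U}"
    using assms(1) by auto
qed

lemma maps_continuous: "f \<in> maps X Y \<Longrightarrow> continuous_map X Y f"
  by (simp add: maps_def)

lemma maps_restrict: "continuous_map X Y f \<Longrightarrow> (\<lambda>x\<in>topspace X. f x) \<in> maps X Y"
  by (simp add: maps_def)

lemma maps_extensional: "f \<in> maps X Y \<Longrightarrow> (\<lambda>x\<in>topspace X. f x) = f"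
  by (simp add: maps_def extensional_restrict)

lemma maps_mem: "f \<in> maps X Y \<Longrightarrow> x \<in> topspace X \<Longrightarrow> f x \<in> topspace Y"
  by (rule continuous_map_mem[OF maps_continuous])

lemma openin_tube:
  assumes F: "continuous_map (prod_topology P K) Y F" and K: "compact_space K" and U: "openin Y U"
  shows "openin P {p \<in> topspace P. \<forall>x\<in>topspace K. F (p, x) \<in> U}"
proof (subst openin_subopen, clarify)
  fix p assume p: "p \<in> topspace P" "\<forall>x\<in>topspace K. F (p, x) \<in> U"
  let ?W = "{z \<in> topspace (prod_topology P K). F z \<in> U}"
  have "openin (prod_topology P K) ?W" by (rule openin_continuous_map_preimage[OF F U])
  moreover have "{p} \<times> topspace K \<subseteq> ?W" using p by auto
  ultimately obtain V V' where V: "openin P V" "p \<in> V" "topspace K \<subseteq> V'" "V \<times> V' \<subseteq> ?W"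
    using tube_lemma_right[of P K ?W "topspace K" p] K p(1) unfolding compact_space_def by blast
  show "\<exists>T. openin P T \<and> p \<in> T \<and> T \<subseteq> {p \<in> topspace P. \<forall>x\<in>topspace K. F (p, x) \<in> U}"
  proof (intro exI[of _ V] conjI V subsetI CollectI ballI)
    fix q assume q: "q \<in> V"
    show "q \<in> topspace P" using q openin_subset[OF V(1)] by blast
    fix x assume "x \<in> topspace K"
    then have "(q, x) \<in> ?W" using V q by blast
    then show "F (q, x) \<in> U" by simp
  qed
qed

lemma image_subset_restrict:
  assumes "K \<subseteq> A"
  shows "(\<lambda>x\<in>A. F x) ` K \<subseteq> U \<longleftrightarrow> (\<forall>x\<in>K. F x \<in> U)"
  using assms by auto

lemma continuous_map_curry:
  assumes F: "continuous_map (prod_topology P X) Y F"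
  shows "continuous_map P (mapping_space X Y) (\<lambda>p. \<lambda>x\<in>topspace X. F (p, x))"
proof (rule continuous_map_into_mapping_space)
  fix p assume "p \<in> topspace P"
  then have "continuous_map X Y (\<lambda>x. F (p, x))"
    by (intro continuous_map_compose'[OF _ F] continuous_map_pairedI) auto
  then show "(\<lambda>x\<in>topspace X. F (p, x)) \<in> maps X Y" by (rule maps_restrict)
next
  fix K U assume K: "compactin X K" and U: "openin Y U"
  have KX: "K \<subseteq> topspace X" by (rule compactin_subset_topspace[OF K])
  have c: "continuous_map (prod_topology P (subtopology X K)) Y F"
  proof -
    have "continuous_map (prod_topology P (subtopology X K)) (prod_topology P X) (\<lambda>z. z)"
      by (rule continuous_map_into_prod_fulltopology[where S = K]) simp
    then show ?thesis by (rule continuous_map_compose'[OF _ F])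
  qed
  have K': "compact_space (subtopology X K)" using K by (simp add: compactin_subspace)
  have top: "topspace (subtopology X K) = K" using KX by auto
  have "{p \<in> topspace P. (\<lambda>x\<in>topspace X. F (p, x)) ` K \<subseteq> U} = {p \<in> topspace P. \<forall>x\<in>K. F (p, x) \<in> U}"
    by (simp only: image_subset_restrict[OF KX])
  then show "openin P {p \<in> topspace P. (\<lambda>x\<in>topspace X. F (p, x)) ` K \<subseteq> U}"
    using openin_tube[OF c K' U] by (simp only: top fst_conv snd_conv)
qed

text \<open>Restricting the argument to a compact \<open>K\<close> replaces local compactness of
  \<open>X\<close>: \<open>K\<close> is compact Hausdorff, hence regular, so a point of
  \<open>K\<close> has a closed, and therefore compact, neighbourhood in \<open>K\<close> that
  \<open>h\<close> still maps into \<open>U\<close>.\<close>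

lemma continuous_map_evaluation:
  assumes X: "Hausdorff_space X" and K: "compactin X K"
  shows "continuous_map (prod_topology (mapping_space X Y) (subtopology X K)) Y (\<lambda>z. fst z (snd z))"
  unfolding continuous_map_def
proof (intro conjI allI impI)
  let ?XK = "subtopology X K"
  let ?P = "prod_topology (mapping_space X Y) ?XK"
  have KX: "K \<subseteq> topspace X" by (rule compactin_subset_topspace[OF K])
  show "(\<lambda>z. fst z (snd z)) \<in> topspace ?P \<rightarrow> topspace Y"
    using maps_mem by fastforce
  fix U assume U: "openin Y U"
  have reg: "neighbourhood_base_of (closedin ?XK) ?XK"
    unfolding neighbourhood_base_of_closedin
    using K X by (intro compact_Hausdorff_imp_regular_space) (simp_all add: compactin_subspace Hausdorff_space_subtopology)
  show "openin ?P {z \<in> topspace ?P. fst z (snd z) \<in> U}"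
  proof (subst openin_subopen, clarify)
    fix h x assume z: "(h, x) \<in> topspace ?P" and hx: "fst (h, x) (snd (h, x)) \<in> U"
    have h: "h \<in> maps X Y" and x: "x \<in> topspace ?XK" using z by simp_all
    let ?O = "{y \<in> topspace ?XK. h y \<in> U}"
    have "openin ?XK ?O"
      by (rule openin_continuous_map_preimage[OF continuous_map_from_subtopology[OF maps_continuous[OF h]] U])
    moreover have "x \<in> ?O" using x hx by simp
    ultimately have "\<exists>V C. openin ?XK V \<and> closedin ?XK C \<and> x \<in> V \<and> V \<subseteq> C \<and> C \<subseteq> ?O"
      using reg unfolding neighbourhood_base_of by blast
    then obtain V C where V: "openin ?XK V" "x \<in> V" and C: "closedin ?XK C" "V \<subseteq> C" "C \<subseteq> ?O" by blast
    have "compactin ?XK C"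
      using closedin_compact_space[OF _ C(1)] K by (simp add: compactin_subspace)
    then have CX: "compactin X C" by (simp add: compactin_subtopology)
    let ?T = "{g \<in> maps X Y. g ` C \<subseteq> U} \<times> V"
    have "openin ?P ?T"
      using openin_mapping_space[OF CX U] V(1) by (simp add: openin_prod_Times_iff)
    moreover have "(h, x) \<in> ?T" using h V C(3) by auto
    moreover have "?T \<subseteq> {z \<in> topspace ?P. fst z (snd z) \<in> U}"
    proof clarify
      fix g y assume g: "g \<in> maps X Y" "g ` C \<subseteq> U" and y: "y \<in> V"
      then have "g y \<in> U" using C(2) by blast
      then show "(g, y) \<in> topspace ?P \<and> fst (g, y) (snd (g, y)) \<in> U"
        using g y openin_subset[OF V(1)] by auto
    qed
    ultimately show "\<exists>T. openin ?P T \<and> (h, x) \<in> T \<and> T \<subseteq> {z \<in> topspace ?P. fst z (snd z) \<in> U}" by blast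
  qed
qed

lemma continuous_map_evaluation_compact:
  assumes "Hausdorff_space X" "compact_space X"
  shows "continuous_map (prod_topology (mapping_space X Y) X) Y (\<lambda>z. fst z (snd z))"
  using continuous_map_evaluation[OF assms(1), of "topspace X"] assms(2) by (simp add: compact_space_def)

lemma continuous_map_evaluation_at:
  assumes "x0 \<in> topspace X"
  shows "continuous_map (mapping_space X Y) Y (\<lambda>h. h x0)"
  unfolding continuous_map_def
proof (intro conjI allI impI)
  show "(\<lambda>h. h x0) \<in> topspace (mapping_space X Y) \<rightarrow> topspace Y"
    using maps_mem assms by fastforce
  fix U assume "openin Y U"
  then have "openin (mapping_space X Y) {f \<in> maps X Y. f ` {x0} \<subseteq> U}"
    using assms by (intro openin_mapping_space) simp_all
  then show "openin (mapping_space X Y) {h \<in> topspace (mapping_space X Y). h x0 \<in> U}" by simp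
qed

text \<open>A subbasic open set sees a map only on a compact \<open>K\<close>, and there evaluation
  is continuous. This covers non-compact \<open>X\<close>, as required for (A).\<close>

lemma continuous_map_postcompose:
  assumes X: "Hausdorff_space X" and F: "continuous_map (prod_topology P (prod_topology X Y)) Z F"
  shows "continuous_map (prod_topology P (mapping_space X Y)) (mapping_space X Z)
           (\<lambda>z. \<lambda>x\<in>topspace X. F (fst z, x, snd z x))"
proof (rule continuous_map_into_mapping_space)
  let ?Q = "prod_topology P (mapping_space X Y)"
  fix z assume "z \<in> topspace ?Q"
  then have z: "fst z \<in> topspace P" "snd z \<in> maps X Y" by (simp_all add: mem_Times_iff)
  have "continuous_map X Z (\<lambda>x. F (fst z, x, snd z x))"
    by (intro continuous_map_compose'[OF _ F] continuous_map_pairedI maps_continuous[OF z(2)]) (use z in simp_all)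
  then show "(\<lambda>x\<in>topspace X. F (fst z, x, snd z x)) \<in> maps X Z" by (rule maps_restrict)
next
  let ?Q = "prod_topology P (mapping_space X Y)"
  fix K U assume K: "compactin X K" and U: "openin Z U"
  have KX: "K \<subseteq> topspace X" by (rule compactin_subset_topspace[OF K])
  let ?R = "prod_topology ?Q (subtopology X K)"
  have "continuous_map ?R (prod_topology (mapping_space X Y) (subtopology X K)) (\<lambda>y. (snd (fst y), snd y))"
    by (intro continuous_map_pairedI continuous_map_snd'[OF continuous_map_fst] continuous_map_snd)
  from continuous_map_compose'[OF this continuous_map_evaluation[OF X K]]
  have ev: "continuous_map ?R Y (\<lambda>y. snd (fst y) (snd y))" by simp
  have c: "continuous_map ?R Z (\<lambda>y. F (fst (fst y), snd y, snd (fst y) (snd y)))"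
    by (intro continuous_map_compose'[OF _ F] continuous_map_pairedI ev continuous_map_fst'[OF continuous_map_fst]
        continuous_map_into_fulltopology[OF continuous_map_snd])
  have K': "compact_space (subtopology X K)" using K by (simp add: compactin_subspace)
  have top: "topspace (subtopology X K) = K" using KX by auto
  have "{z \<in> topspace ?Q. (\<lambda>x\<in>topspace X. F (fst z, x, snd z x)) ` K \<subseteq> U}
     = {z \<in> topspace ?Q. \<forall>x\<in>K. F (fst z, x, snd z x) \<in> U}"
    by (simp only: image_subset_restrict[OF KX])
  then show "openin ?Q {z \<in> topspace ?Q. (\<lambda>x\<in>topspace X. F (fst z, x, snd z x)) ` K \<subseteq> U}"
    using openin_tube[OF c K' U] by (simp only: top fst_conv snd_conv)
qed

text \<open>The supremum is attained. Being below \<open>a\<close> is an open condition by the tube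
  lemma; being above \<open>a\<close> is witnessed at one point \<open>k\<close> and persists
  nearby.\<close>

lemma continuous_map_Sup_compact:
  fixes g :: "'m \<times> 'k \<Rightarrow> real"
  assumes K: "compact_space K" "topspace K \<noteq> {}" and g: "continuous_map (prod_topology M K) euclideanreal g"
  shows "continuous_map M euclideanreal (\<lambda>x. SUP k\<in>topspace K. g (x, k))"
    and "x \<in> topspace M \<Longrightarrow> k \<in> topspace K \<Longrightarrow> g (x, k) \<le> (SUP k\<in>topspace K. g (x, k))"
    and "x \<in> topspace M \<Longrightarrow> \<exists>k\<in>topspace K. (SUP k\<in>topspace K. g (x, k)) = g (x, k)"
proof -
  have max: "\<exists>k\<in>topspace K. \<forall>k'\<in>topspace K. g (x, k') \<le> g (x, k)" if x: "x \<in> topspace M" for x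
  proof -
    have "continuous_map K euclideanreal (\<lambda>k. g (x, k))"
      by (intro continuous_map_compose'[OF _ g] continuous_map_pairedI) (use x in simp_all)
    from image_compactin[OF _ this, of "topspace K"] have "compact ((\<lambda>k. g (x, k)) ` topspace K)"
      using K(1) by (simp add: compact_space_def)
    then show ?thesis using compact_attains_sup[of "(\<lambda>k. g (x, k)) ` topspace K"] K(2) by auto
  qed
  have eq: "(SUP k\<in>topspace K. g (x, k)) = g (x, k)" if "k \<in> topspace K" "\<forall>k'\<in>topspace K. g (x, k') \<le> g (x, k)" for x k
    using that by (intro cSup_eq_maximum) auto
  show le: "g (x, k) \<le> (SUP k\<in>topspace K. g (x, k))" if x: "x \<in> topspace M" and k: "k \<in> topspace K" for x k
  proof -
    obtain k' where k': "k' \<in> topspace K" "\<forall>k\<in>topspace K. g (x, k) \<le> g (x, k')" using max[OF x] by blast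
    then show ?thesis using eq[OF k'] k by simp
  qed
  show att: "\<exists>k\<in>topspace K. (SUP k\<in>topspace K. g (x, k)) = g (x, k)" if x: "x \<in> topspace M" for x
    using max[OF x] eq by blast
  show "continuous_map M euclideanreal (\<lambda>x. SUP k\<in>topspace K. g (x, k))"
    unfolding continuous_map_upper_lower_semicontinuous_lt
  proof (intro conjI allI)
    fix a
    have "{x \<in> topspace M. (SUP k\<in>topspace K. g (x, k)) < a} = {x \<in> topspace M. \<forall>k\<in>topspace K. g (x, k) \<in> {..<a}}"
    proof (intro Collect_cong conj_cong refl)
      fix x assume x: "x \<in> topspace M"
      show "(SUP k\<in>topspace K. g (x, k)) < a \<longleftrightarrow> (\<forall>k\<in>topspace K. g (x, k) \<in> {..<a})"
        using le[OF x] att[OF x] by fastforce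
    qed
    then show "openin M {x \<in> topspace M. (SUP k\<in>topspace K. g (x, k)) < a}"
      using openin_tube[OF g K(1), of "{..<a}"] by simp
    show "openin M {x \<in> topspace M. a < (SUP k\<in>topspace K. g (x, k))}"
    proof (subst openin_subopen, clarify)
      fix x assume x: "x \<in> topspace M" and a: "a < (SUP k\<in>topspace K. g (x, k))"
      obtain k where k: "k \<in> topspace K" "(SUP k\<in>topspace K. g (x, k)) = g (x, k)" using att[OF x] by blast
      have "continuous_map M euclideanreal (\<lambda>y. g (y, k))"
        by (intro continuous_map_compose'[OF _ g] continuous_map_pairedI) (use k in simp_all)
      from openin_continuous_map_preimage[OF this, of "{a<..}"]
      have "openin M {y \<in> topspace M. g (y, k) \<in> {a<..}}" by simp
      moreover have "x \<in> {y \<in> topspace M. g (y, k) \<in> {a<..}}" using x a k(2) by simp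
      moreover have "{y \<in> topspace M. g (y, k) \<in> {a<..}} \<subseteq> {y \<in> topspace M. a < (SUP k\<in>topspace K. g (y, k))}"
        using le[OF _ k(1)] by fastforce
      ultimately show "\<exists>T. openin M T \<and> x \<in> T \<and> T \<subseteq> {x \<in> topspace M. a < (SUP k\<in>topspace K. g (x, k))}" by blast
    qed
  qed
qed

text \<open>The cofibration property of the diagonal yields, for pairs \<open>(a, b)\<close> near the diagonal, a path
  from \<open>a\<close> to \<open>b\<close> depending continuously on \<open>(a, b)\<close> and constant for \<open>a = b\<close>. Applied pointwise to
  \<open>h x\<close> and \<open>f x\<close>, it contracts a neighbourhood of \<open>f\<close> to \<open>f\<close>.\<close>

lemma well_pointed_mapping_space:
  fixes X :: "'a topology" and Y :: "'b topology"
  assumes X: "Hausdorff_space X" "compact_space X" "topspace X \<noteq> {}"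
    and Y: "cw_complex Y E d \<Phi>" "countable E" and f: "f \<in> maps X Y"
  shows "well_pointed (mapping_space X Y) f"
proof -
  interpret cw_complex Y E d \<Phi> by (rule Y(1))
  let ?S = "mapping_space X Y"
  have "compactin Y (f ` topspace X)"
    using X(2) maps_continuous[OF f] unfolding compact_space_def by (rule image_compactin)
  then obtain T where T: "finite_subcomplex T" "f ` topspace X \<subseteq> \<Union>T"
    by (rule compactin_in_finite_subcomplex[OF Y(2)])
  define Z where "Z = \<Union>T"
  let ?W = "prod_topology Y (subtopology Y Z)"
  let ?\<Delta> = "(\<lambda>z. (z, z)) ` Z"
  have ZY: "Z \<subseteq> topspace Y" using closedin_subset[OF closedin_finite_subcomplex[OF T(1)]] by (simp add: Z_def)
  obtain R where cl: "closedin ?W ?\<Delta>" and R: "cofibration_retraction ?W ?\<Delta> R"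
    using closed_cofibration_diagonal[OF Y(2) T(1)] unfolding closed_cofibration_def Z_def by blast
  note RD = cofibration_retractionD[OF R]
  have cf: "continuous_map X (subtopology Y Z) f"
    by (rule continuous_map_into_subtopology[OF maps_continuous[OF f]]) (use T(2) in \<open>auto simp: Z_def\<close>)
  have pair: "(h x, f x) \<in> topspace ?W" if "h \<in> maps X Y" "x \<in> topspace X" for h x
    using maps_mem[OF that] continuous_map_mem[OF cf that(2)] by simp
  have f\<Delta>: "(f x, f x) \<in> ?\<Delta>" if "x \<in> topspace X" for x
    using continuous_map_mem[OF cf that] by auto
  note ev = continuous_map_evaluation_compact[OF X(1,2), of Y]
  \<comment> \<open>The amount by which the retraction lowers the time coordinate at
    \<open>(t, h x, f x)\<close>. Its supremum \<open>v h\<close> over all \<open>t\<close> and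
    \<open>x\<close> bounds this amount: for \<open>t > v h\<close> the time stays positive, so
    \<open>R\<close> must have moved \<open>(h x, f x)\<close> onto the diagonal, for all
    \<open>x\<close> at once.\<close>
  define g where "g y = fst (snd y) - fst (R (fst (snd y), fst y (snd (snd y)), f (snd (snd y))))"
    for y :: "('a \<Rightarrow> 'b) \<times> real \<times> 'a"
  let ?K = "prod_topology unit_interval X"
  have cg: "continuous_map (prod_topology ?S ?K) euclideanreal g"
  proof -
    let ?P = "prod_topology ?S ?K"
    have t: "continuous_map ?P unit_interval (\<lambda>y. fst (snd y))" by (rule continuous_map_fst'[OF continuous_map_snd])
    have x: "continuous_map ?P X (\<lambda>y. snd (snd y))" by (rule continuous_map_snd'[OF continuous_map_snd])
    have hx: "continuous_map ?P Y (\<lambda>y. fst y (snd (snd y)))"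
      using continuous_map_compose'[OF continuous_map_pairedI[OF continuous_map_fst x] ev] by simp
    have "continuous_map ?P unit_interval (\<lambda>y. fst (R (fst (snd y), fst y (snd (snd y)), f (snd (snd y)))))"
      by (intro continuous_map_fst'[OF continuous_map_compose'[OF _ RD(1)]] continuous_map_pairedI t hx continuous_map_compose'[OF x cf])
    then show ?thesis
      unfolding g_def by (intro continuous_map_diff continuous_map_from_unit t)
  qed
  have K: "compact_space ?K" "topspace ?K \<noteq> {}"
    using X(2,3) compact_space_unit_interval by (auto simp: compact_space_prod_topology)
  define v where "v h = (SUP k\<in>topspace ?K. g (h, k))" for h
  note sup = continuous_map_Sup_compact[OF K cg, folded v_def]
  have Rmem: "R (t, h x, f x) \<in> {0..1} \<times> topspace ?W" if "t \<in> {0..1}" "h \<in> maps X Y" "x \<in> topspace X" for t h x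
    using continuous_map_mem[OF RD(1), of "(t, h x, f x)"] that pair by simp
  have v_ge: "t - fst (R (t, h x, f x)) \<le> v h" if "t \<in> {0..1}" "h \<in> maps X Y" "x \<in> topspace X" for t h x
    using sup(2)[of h "(t, x)"] that by (simp add: g_def)
  have v0: "0 \<le> v h" if h: "h \<in> maps X Y" for h
  proof -
    obtain x where x: "x \<in> topspace X" using X(3) by blast
    show ?thesis using v_ge[of 0 h x] h x RD(3)[OF pair[OF h x]] by simp
  qed
  have vf: "v f = 0"
  proof -
    obtain k where k: "k \<in> topspace ?K" "v f = g (f, k)" using sup(3)[of f] f by auto
    then have "fst k \<in> {0..1}" "snd k \<in> topspace X" by (simp_all add: mem_Times_iff)
    then show ?thesis using k(2) RD(4)[OF _ f\<Delta>, of "fst k" "snd k"] by (simp add: g_def)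
  qed
  define D where "D y = snd (R y)" for y
  have D0: "D (0, h x, f x) = (h x, f x)" if "h \<in> maps X Y" "x \<in> topspace X" for h x
    using RD(3)[OF pair[OF that]] by (simp add: D_def)
  have Df: "D (t, f x, f x) = (f x, f x)" if "t \<in> {0..1}" "x \<in> topspace X" for t x
    using RD(4)[OF that(1) f\<Delta>[OF that(2)]] by (simp add: D_def)
  have D\<Delta>: "D (t, h x, f x) \<in> ?\<Delta>"
    if h: "h \<in> maps X Y" and x: "x \<in> topspace X" and t: "v h \<le> t" "t < 1" for t h x
  proof -
    have gt: "D (s, h x, f x) \<in> ?\<Delta>" if "t < s" "s \<le> 1" for s
    proof -
      have s: "s \<in> {0..1}" using that t v0[OF h] by simp
      then have "fst (R (s, h x, f x)) \<noteq> 0" using v_ge[OF s h x] that t by auto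
      then show ?thesis using RD(2)[OF s pair[OF h x]] by (simp add: D_def)
    qed
    \<comment> \<open>Only \<open>s > t\<close> has been settled so far; since the diagonal is
      closed, \<open>s = t\<close> follows by a limit from the right, for which \<open>t < 1\<close>
      leaves room.\<close>
    have "continuous_map unit_interval ?W (\<lambda>s. D (s, h x, f x))"
      unfolding D_def
      by (intro continuous_map_snd'[OF continuous_map_compose'[OF _ RD(1)]] continuous_map_pairedI)
         (use pair[OF h x] in simp_all)
    from closedin_continuous_map_preimage[OF this cl]
    have "closedin unit_interval {s \<in> {0..1}. D (s, h x, f x) \<in> ?\<Delta>}" by simp
    then have clo: "closed {s \<in> {0..1}. D (s, h x, f x) \<in> ?\<Delta>}" by (rule closedin_closed_trans) simp
    have "{t<..<1} \<subseteq> {s \<in> {0..1}. D (s, h x, f x) \<in> ?\<Delta>}"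
      using gt t v0[OF h] by auto
    then have "closure {t<..<1} \<subseteq> {s \<in> {0..1}. D (s, h x, f x) \<in> ?\<Delta>}"
      by (rule closure_minimal[OF _ clo])
    moreover have "t \<in> closure {t<..<1}" using t(2) by simp
    ultimately show ?thesis by blast
  qed
  \<comment> \<open>The first component of \<open>D\<close> leads from \<open>h x\<close> to its
    value at time \<open>v h\<close>, where both components agree; the second component run
    backwards leads from there to \<open>f x\<close>. Halving the time keeps the turning point below
    \<open>1\<close>, as needed for \<open>D\<Delta>\<close>. The way back ends when
    \<open>t / 2 = 2 v h\<close>, whence the factor \<open>4\<close> in the choice of
    \<open>u\<close>.\<close>
  define \<psi> where "\<psi> y = (\<lambda>x\<in>topspace X. if fst y / 2 \<le> v (snd y) then fst (D (fst y / 2, snd y x, f x))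
      else snd (D (max 0 (2 * v (snd y) - fst y / 2), snd y x, f x)))" for y :: "real \<times> ('a \<Rightarrow> 'b)"
  have c\<psi>: "continuous_map (prod_topology unit_interval ?S) ?S \<psi>"
  proof -
    let ?P = "prod_topology (prod_topology unit_interval ?S) X"
    let ?t = "\<lambda>y. fst (fst y) / 2" and ?v = "\<lambda>y. v (snd (fst y))"
    have ct: "continuous_map ?P euclideanreal ?t"
    proof -
      have "continuous_map ?P euclideanreal (\<lambda>y. fst (fst y) * (1/2))"
        by (intro continuous_map_real_mult continuous_map_canonical_const continuous_map_from_unit continuous_map_fst'[OF continuous_map_fst])
      then show ?thesis by simp
    qed
    have ch: "continuous_map ?P ?S (\<lambda>y. snd (fst y))" by (rule continuous_map_snd'[OF continuous_map_fst])
    have cv: "continuous_map ?P euclideanreal ?v" by (rule continuous_map_compose'[OF ch sup(1)])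
    have hx: "continuous_map ?P Y (\<lambda>y. snd (fst y) (snd y))"
      using continuous_map_compose'[OF continuous_map_pairedI[OF ch continuous_map_snd] ev] by simp
    have fx: "continuous_map ?P (subtopology Y Z) (\<lambda>y. f (snd y))"
      by (rule continuous_map_compose'[OF continuous_map_snd cf])
    have cD: "continuous_map (subtopology ?P A) ?W (\<lambda>y. D (s y, snd (fst y) (snd y), f (snd y)))"
      if "continuous_map (subtopology ?P A) unit_interval s" for A s
      unfolding D_def
      by (intro continuous_map_snd'[OF continuous_map_compose'[OF _ RD(1)]] continuous_map_pairedI that
          continuous_map_from_subtopology hx fx)
    have "continuous_map ?P Y (\<lambda>y. if ?t y \<le> ?v y then fst (D (?t y, snd (fst y) (snd y), f (snd y)))
      else snd (D (max 0 (2 * ?v y - ?t y), snd (fst y) (snd y), f (snd y))))"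
    proof (rule continuous_map_cases_le[OF ct cv])
      have "continuous_map (subtopology ?P {x \<in> topspace ?P. ?t x \<le> ?v x}) unit_interval ?t"
        by (rule continuous_map_into_unit[OF continuous_map_from_subtopology[OF ct]]) auto
      from continuous_map_fst'[OF cD[OF this]]
      show "continuous_map (subtopology ?P {x \<in> topspace ?P. ?t x \<le> ?v x}) Y
         (\<lambda>y. fst (D (?t y, snd (fst y) (snd y), f (snd y))))" .
    next
      let ?A = "{x \<in> topspace ?P. ?v x \<le> ?t x}"
      have "continuous_map (subtopology ?P ?A) unit_interval (\<lambda>y. max 0 (2 * ?v y - ?t y))"
      proof (rule continuous_map_into_unit)
        show "continuous_map (subtopology ?P ?A) euclideanreal (\<lambda>y. max 0 (2 * ?v y - ?t y))"
          by (intro continuous_map_from_subtopology continuous_map_real_intros ct cv)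
        fix y assume "y \<in> topspace (subtopology ?P ?A)"
        then have "?v y \<le> ?t y" "?t y \<le> 1 / 2" by auto
        then show "0 \<le> max 0 (2 * ?v y - ?t y)" "max 0 (2 * ?v y - ?t y) \<le> 1" by auto
      qed
      from continuous_map_into_fulltopology[OF continuous_map_snd'[OF cD[OF this]]]
      show "continuous_map (subtopology ?P ?A) Y (\<lambda>y. snd (D (max 0 (2 * ?v y - ?t y), snd (fst y) (snd y), f (snd y))))" .
    next
      fix y assume y: "y \<in> topspace ?P" "?t y = ?v y"
      then have y': "fst (fst y) \<in> {0..1}" "snd (fst y) \<in> maps X Y" "snd y \<in> topspace X"
        by (simp_all add: mem_Times_iff)
      then have lt: "?v y < 1" using y(2) by simp
      have "max 0 (2 * ?v y - ?t y) = ?v y" using y(2) v0[OF y'(2)] by simp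
      moreover have "D (?v y, snd (fst y) (snd y), f (snd y)) \<in> ?\<Delta>"
        by (rule D\<Delta>[OF y'(2,3) order_refl lt])
      ultimately show "fst (D (?t y, snd (fst y) (snd y), f (snd y)))
          = snd (D (max 0 (2 * ?v y - ?t y), snd (fst y) (snd y), f (snd y)))"
        unfolding y(2) by auto
    qed
    from continuous_map_curry[OF this] show ?thesis unfolding \<psi>_def[abs_def] fst_conv snd_conv .
  qed
  show ?thesis
    unfolding well_pointed_def
  proof (intro conjI exI[of _ "\<lambda>h. 4 * v h"] exI[of _ \<psi>] ballI impI c\<psi>)
    show "f \<in> topspace ?S" using f by simp
    show "continuous_map ?S euclideanreal (\<lambda>h. 4 * v h)"
      by (intro continuous_map_real_mult continuous_map_canonical_const sup(1))
    show "4 * v f = 0" by (simp add: vf)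
  next
    fix h assume "h \<in> topspace ?S"
    then have h: "h \<in> maps X Y" by simp
    show "0 \<le> 4 * v h" using v0[OF h] by simp
    have "\<psi> (0, h) = (\<lambda>x\<in>topspace X. h x)"
      unfolding \<psi>_def by (rule restrict_ext) (simp add: v0[OF h] D0[OF h])
    then show "\<psi> (0, h) = h" by (simp add: maps_extensional[OF h])
  next
    fix t :: real assume t: "t \<in> {0..1}"
    have "\<psi> (t, f) = (\<lambda>x\<in>topspace X. f x)"
      unfolding \<psi>_def
    proof (rule restrict_ext)
      fix x assume x: "x \<in> topspace X"
      have "D (t / 2, f x, f x) = (f x, f x)" "D (max 0 (2 * v f - t / 2), f x, f x) = (f x, f x)"
        using t x vf by (auto intro!: Df)
      then show "(if fst (t, f) / 2 \<le> v (snd (t, f)) then fst (D (fst (t, f) / 2, snd (t, f) x, f x))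
          else snd (D (max 0 (2 * v (snd (t, f)) - fst (t, f) / 2), snd (t, f) x, f x))) = f x" by simp
    qed
    then show "\<psi> (t, f) = f" by (simp add: maps_extensional[OF f])
  next
    fix t :: real and h assume t: "t \<in> {0..1}" and h': "h \<in> topspace ?S" and le: "4 * v h \<le> t"
    then have h: "h \<in> maps X Y" by simp
    have "\<psi> (t, h) = (\<lambda>x\<in>topspace X. f x)"
      unfolding \<psi>_def
    proof (rule restrict_ext)
      fix x assume x: "x \<in> topspace X"
      show "(if fst (t, h) / 2 \<le> v (snd (t, h)) then fst (D (fst (t, h) / 2, snd (t, h) x, f x))
          else snd (D (max 0 (2 * v (snd (t, h)) - fst (t, h) / 2), snd (t, h) x, f x))) = f x"
      proof (cases "t / 2 \<le> v h")
        case True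
        then have 0: "v h = 0" "t = 0" using le v0[OF h] t by auto
        then have "D (0, h x, f x) \<in> ?\<Delta>" by (intro D\<Delta>[OF h x]) auto
        then have "h x = f x" unfolding D0[OF h x] by auto
        then show ?thesis using 0 D0[OF h x] by simp
      next
        case False
        have "max 0 (2 * v h - t / 2) = 0" using le by simp
        then show ?thesis using False D0[OF h x] by simp
      qed
    qed
    then show "\<psi> (t, h) = f" by (simp add: maps_extensional[OF f])
  qed
qed

text \<open>The instance for (B): over a single point, \<open>b\<close> itself is a lift.\<close>

lemma regular_lifting_trivial: "regular_lifting P N (\<lambda>_. ()) (discrete_topology UNIV)"
  unfolding regular_lifting_def by auto

text \<open>The extension property of \<open>x0\<close> for the target
  \<open>Z = (X x {0}) \<union> ({x0} x [0,1])\<close> gives \<open>r\<close> from the cylinder to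
  \<open>Z\<close>. Together \<open>b\<close> on \<open>X x {0}\<close> and \<open>\<beta>\<close>
  on \<open>{x0} x [0,1]\<close> form the map \<open>E\<close>, and the lift is \<open>E\<close>
  after \<open>r\<close> at time \<open>w x\<close>. For \<open>w x = 0\<close> the point
  \<open>r (0, z)\<close> is \<open>(z, 0)\<close>, so \<open>b x\<close> is unchanged.\<close>

lemma regular_lifting_evaluation:
  fixes X :: "'a topology" and Y :: "'b topology" and P :: "'p topology"
  assumes X: "Hausdorff_space X" "compact_space X" and x0: "nondegenerate_basepoint X x0"
  shows "regular_lifting P (mapping_space X Y) (\<lambda>h. h x0) Y"
  unfolding regular_lifting_def
proof (intro allI impI, elim conjE)
  let ?S = "mapping_space X Y"
  fix b w \<beta>
  assume b: "continuous_map P ?S b" and w: "continuous_map P unit_interval w"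
    and \<beta>: "continuous_map (prod_topology P unit_interval) Y \<beta>" and \<beta>b: "\<forall>x\<in>topspace P. \<beta> (x, 0) = b x x0"
  have x0X: "x0 \<in> topspace X" using x0 by (simp add: nondegenerate_basepoint_def)
  define Z where "Z = subtopology (prod_topology X euclideanreal) (topspace X \<times> {0} \<union> {x0} \<times> {0..1})"
  have topZ: "topspace Z = topspace X \<times> {0} \<union> {x0} \<times> {0..1}" using x0X by (auto simp: Z_def)
  have "continuous_map X Z (\<lambda>z. (z, 0)) \<and> pathin Z (\<lambda>t. (x0, t)) \<and> (x0, 0) = (x0, 0::real)"
  proof (intro conjI refl)
    show "continuous_map X Z (\<lambda>z. (z, 0))"
      unfolding Z_def by (intro continuous_map_into_subtopology continuous_map_pairedI) auto
    show "pathin Z (\<lambda>t. (x0, t))"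
      unfolding pathin_def Z_def
      by (intro continuous_map_into_subtopology continuous_map_pairedI)
         (use x0X in \<open>auto simp: continuous_map_from_subtopology\<close>)
  qed
  from x0[unfolded nondegenerate_basepoint_def, THEN conjunct2, THEN spec, THEN spec, THEN spec, THEN mp,
      of Z "\<lambda>z. (z, 0)" "\<lambda>t. (x0, t)", OF this]
  obtain r where r: "continuous_map (prod_topology unit_interval X) Z r"
    and r0': "\<forall>x\<in>topspace X. r (0, x) = (x, 0)" and rx0': "\<forall>t\<in>{0..1}. r (t, x0) = (x0, t)"
    by (elim exE conjE)
  note r0 = r0'[rule_format] and rx0 = rx0'[rule_format]
  let ?PZ = "prod_topology P Z"
  define E where "E y = (if y \<in> {y \<in> topspace ?PZ. snd (snd y) \<in> {0}} then b (fst y) (fst (snd y)) else \<beta> (fst y, snd (snd y)))"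
    for y :: "'p \<times> 'a \<times> real"
  have c1: "continuous_map ?PZ X (\<lambda>y. fst (snd y))" and c2: "continuous_map ?PZ euclideanreal (\<lambda>y. snd (snd y))"
  proof -
    have c: "continuous_map ?PZ (prod_topology X euclideanreal) (\<lambda>y. snd y)"
      unfolding Z_def by (rule continuous_map_into_fulltopology[OF continuous_map_snd])
    show "continuous_map ?PZ X (\<lambda>y. fst (snd y))" "continuous_map ?PZ euclideanreal (\<lambda>y. snd (snd y))"
      by (rule continuous_map_fst'[OF c] continuous_map_snd'[OF c])+
  qed
  have "continuous_map ?PZ Y E"
    unfolding E_def[abs_def]
  proof (rule continuous_map_pasting2[where T = "{y \<in> topspace ?PZ. fst (snd y) \<in> {x0}}"])
    show "closedin ?PZ {y \<in> topspace ?PZ. snd (snd y) \<in> {0}}"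
      by (rule closedin_continuous_map_preimage[OF c2]) simp
    show "closedin ?PZ {y \<in> topspace ?PZ. fst (snd y) \<in> {x0}}"
      by (rule closedin_continuous_map_preimage[OF c1]) (use X(1) x0X in \<open>simp add: closedin_Hausdorff_singleton\<close>)
    show "topspace ?PZ \<subseteq> {y \<in> topspace ?PZ. snd (snd y) \<in> {0}} \<union> {y \<in> topspace ?PZ. fst (snd y) \<in> {x0}}"
      by (auto simp: topZ)
    have "continuous_map ?PZ Y (\<lambda>y. b (fst y) (fst (snd y)))"
      using continuous_map_compose'[OF continuous_map_pairedI[OF continuous_map_compose'[OF continuous_map_fst b] c1]
          continuous_map_evaluation_compact[OF X]] by simp
    then show "continuous_map (subtopology ?PZ {y \<in> topspace ?PZ. snd (snd y) \<in> {0}}) Y (\<lambda>y. b (fst y) (fst (snd y)))"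
      by (rule continuous_map_from_subtopology)
    show "continuous_map (subtopology ?PZ {y \<in> topspace ?PZ. fst (snd y) \<in> {x0}}) Y (\<lambda>y. \<beta> (fst y, snd (snd y)))"
      by (intro continuous_map_compose'[OF _ \<beta>] continuous_map_pairedI continuous_map_into_unit
          continuous_map_from_subtopology c2 continuous_map_fst) (auto simp: topZ)
    show "b (fst y) (fst (snd y)) = \<beta> (fst y, snd (snd y))"
      if "y \<in> {y \<in> topspace ?PZ. snd (snd y) \<in> {0}}" "y \<in> {y \<in> topspace ?PZ. fst (snd y) \<in> {x0}}" for y
      using that \<beta>b by (auto simp: mem_Times_iff)
  qed
  moreover have "continuous_map (prod_topology P X) ?PZ (\<lambda>y. (fst y, r (w (fst y), snd y)))"
    by (intro continuous_map_pairedI continuous_map_fst continuous_map_compose'[OF _ r] continuous_map_snd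
        continuous_map_compose'[OF continuous_map_fst w])
  ultimately have cE: "continuous_map (prod_topology P X) Y (\<lambda>y. E (fst y, r (w (fst y), snd y)))"
    by (rule continuous_map_compose'[rotated])
  define L where "L x = (\<lambda>z\<in>topspace X. E (x, r (w x, z)))" for x
  have cL: "continuous_map P ?S L"
    using continuous_map_curry[OF cE] unfolding L_def[abs_def] fst_conv snd_conv .
  have w01: "w x \<in> {0..1}" if "x \<in> topspace P" for x using continuous_map_mem[OF w that] by simp
  show "\<exists>L. continuous_map P ?S L \<and> (\<forall>x\<in>topspace P. L x x0 = \<beta> (x, w x) \<and> (w x = 0 \<longrightarrow> L x = b x))"
  proof (intro exI[of _ L] conjI ballI impI cL)
    fix x assume x: "x \<in> topspace P"
    show "L x x0 = \<beta> (x, w x)"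
      using x x0X rx0[OF w01[OF x]] \<beta>b w01[OF x] by (auto simp: L_def E_def topZ)
    assume w0: "w x = 0"
    have "L x = (\<lambda>z\<in>topspace X. b x z)"
      unfolding L_def by (rule restrict_ext) (use x w0 r0 in \<open>simp add: E_def topZ\<close>)
    also have "\<dots> = b x"
      by (rule maps_extensional[of _ X Y]) (use continuous_map_mem[OF b x] in simp)
    finally show "L x = b x" .
  qed
qed

section \<open>Equivalence relations on components and fibrations\<close>

text \<open>The conditions on the homotopies hold in particular at their initial maps
  \<open>k \<circ> h\<close> and \<open>h \<circ> k\<close>, which forces \<open>k\<close> to be
  based and over the base.\<close>

lemma fibre_homotopy_equivalence_inverse:
  assumes E: "fibre_homotopy_equivalence E1 e1 p1 E2 e2 p2 h"
  obtains k where "continuous_map E2 E1 k" "k e2 = e1" "\<forall>y\<in>topspace E2. p1 (k y) = p2 y"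
    "homotopic_with (vertical_based E1 e1 p1) E1 E1 (k \<circ> h) id"
    "homotopic_with (vertical_based E2 e2 p2) E2 E2 (h \<circ> k) id"
proof -
  obtain k where h: "h e1 = e2" "\<forall>x\<in>topspace E1. p2 (h x) = p1 x" and k: "continuous_map E2 E1 k"
    and 1: "homotopic_with (vertical_based E1 e1 p1) E1 E1 (k \<circ> h) id"
    and 2: "homotopic_with (vertical_based E2 e2 p2) E2 E2 (h \<circ> k) id"
    using E unfolding fibre_homotopy_equivalence_def by blast
  have ke: "k e2 = e1" using homotopic_with_imp_property[OF 1] h(1) by simp
  have kp: "p1 (k y) = p2 y" if "y \<in> topspace E2" for y
  proof -
    have "p2 (h (k y)) = p2 y" using homotopic_with_imp_property[OF 2] that by simp
    then show ?thesis using h(2) continuous_map_mem[OF k that] by metis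
  qed
  show ?thesis by (rule that[OF k ke _ 1 2]) (use kp in blast)
qed

lemma fibre_homotopy_equivalence_sym:
  assumes E: "fibre_homotopy_equivalence E1 e1 p1 E2 e2 p2 h"
  shows "\<exists>k. fibre_homotopy_equivalence E2 e2 p2 E1 e1 p1 k"
proof -
  obtain k where "continuous_map E2 E1 k" "k e2 = e1" "\<forall>y\<in>topspace E2. p1 (k y) = p2 y"
    "homotopic_with (vertical_based E1 e1 p1) E1 E1 (k \<circ> h) id"
    "homotopic_with (vertical_based E2 e2 p2) E2 E2 (h \<circ> k) id"
    by (rule fibre_homotopy_equivalence_inverse[OF E])
  moreover have "continuous_map E1 E2 h" using E by (simp add: fibre_homotopy_equivalence_def)
  ultimately have "fibre_homotopy_equivalence E2 e2 p2 E1 e1 p1 k"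
    unfolding fibre_homotopy_equivalence_def by blast
  then show ?thesis by (rule exI[of _ k])
qed

text \<open>The core of transitivity: a homotopy contracting the inner composite is sandwiched
  between \<open>k\<close> and \<open>h\<close>, and what remains is
  \<open>k \<circ> h\<close>.\<close>

lemma vertical_based_conjugate:
  assumes F: "homotopic_with (vertical_based E2 e2 p2) E2 E2 F id"
    and h: "continuous_map E1 E2 h" "h e1 = e2" "\<And>x. x \<in> topspace E1 \<Longrightarrow> p2 (h x) = p1 x"
    and k: "continuous_map E2 E1 k" "k e2 = e1" "\<And>y. y \<in> topspace E2 \<Longrightarrow> p1 (k y) = p2 y"
    and kh: "homotopic_with (vertical_based E1 e1 p1) E1 E1 (k \<circ> h) id"
  shows "homotopic_with (vertical_based E1 e1 p1) E1 E1 (k \<circ> F \<circ> h) id"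
proof -
  have 1: "homotopic_with (\<lambda>j. vertical_based E2 e2 p2 j \<and> (\<forall>y\<in>topspace E2. j y \<in> topspace E2)) E2 E2 F id"
    by (rule homotopic_with_mono[OF F]) (auto dest: continuous_map_mem)
  have 2: "homotopic_with (\<lambda>j. j e2 = e1 \<and> (\<forall>y\<in>topspace E2. p1 (j y) = p2 y)) E2 E1 (k \<circ> F) (k \<circ> id)"
    by (rule homotopic_with_compose_continuous_map_left[OF 1 k(1)]) (use k in auto)
  have "homotopic_with (vertical_based E1 e1 p1) E1 E1 (k \<circ> F \<circ> h) (k \<circ> id \<circ> h)"
    by (rule homotopic_with_compose_continuous_map_right[OF 2 h(1)])
       (use h continuous_map_mem[OF h(1)] in auto)
  then have "homotopic_with (vertical_based E1 e1 p1) E1 E1 (k \<circ> F \<circ> h) (k \<circ> h)" by simp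
  then show ?thesis by (rule homotopic_with_trans[OF _ kh])
qed

lemma fibre_homotopy_equivalence_trans:
  assumes h: "fibre_homotopy_equivalence E1 e1 p1 E2 e2 p2 h"
    and h': "fibre_homotopy_equivalence E2 e2 p2 E3 e3 p3 h'"
  shows "fibre_homotopy_equivalence E1 e1 p1 E3 e3 p3 (h' \<circ> h)"
proof -
  obtain k where k: "continuous_map E2 E1 k" "k e2 = e1" "\<forall>y\<in>topspace E2. p1 (k y) = p2 y"
    "homotopic_with (vertical_based E1 e1 p1) E1 E1 (k \<circ> h) id"
    "homotopic_with (vertical_based E2 e2 p2) E2 E2 (h \<circ> k) id"
    by (rule fibre_homotopy_equivalence_inverse[OF h])
  obtain k' where k': "continuous_map E3 E2 k'" "k' e3 = e2" "\<forall>y\<in>topspace E3. p2 (k' y) = p3 y"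
    "homotopic_with (vertical_based E2 e2 p2) E2 E2 (k' \<circ> h') id"
    "homotopic_with (vertical_based E3 e3 p3) E3 E3 (h' \<circ> k') id"
    by (rule fibre_homotopy_equivalence_inverse[OF h'])
  have c: "continuous_map E1 E2 h" "h e1 = e2" "\<And>x. x \<in> topspace E1 \<Longrightarrow> p2 (h x) = p1 x"
    using h by (simp_all add: fibre_homotopy_equivalence_def)
  have c': "continuous_map E2 E3 h'" "h' e2 = e3" "\<And>x. x \<in> topspace E2 \<Longrightarrow> p3 (h' x) = p2 x"
    using h' by (simp_all add: fibre_homotopy_equivalence_def)
  have 1: "homotopic_with (vertical_based E1 e1 p1) E1 E1 ((k \<circ> k') \<circ> (h' \<circ> h)) id"
    using vertical_based_conjugate[OF k'(4) c k(1,2) k(3)[rule_format] k(4)] by (simp only: comp_assoc)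
  have 2: "homotopic_with (vertical_based E3 e3 p3) E3 E3 ((h' \<circ> h) \<circ> (k \<circ> k')) id"
    using vertical_based_conjugate[OF k(5) k'(1,2) k'(3)[rule_format] c' k'(5)] by (simp only: comp_assoc)
  have "\<forall>x\<in>topspace E1. p3 ((h' \<circ> h) x) = p1 x"
    using c c' continuous_map_mem[OF c(1)] by simp
  then show ?thesis
    unfolding fibre_homotopy_equivalence_def
    using continuous_map_compose[OF c(1) c'(1)] continuous_map_compose[OF k'(1) k(1)] c(2) c'(2) 1 2 by auto
qed

text \<open>Over the one-point base \<open>unit\<close> every map is vertical; through this the
  fibrewise lemmas serve (B) too.\<close>

lemma based_homotopy_equivalent_iff:
  "based_homotopy_equivalent E1 e1 E2 e2 \<longleftrightarrow> (\<exists>h. fibre_homotopy_equivalence E1 e1 (\<lambda>_. ()) E2 e2 (\<lambda>_. ()) h)"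
    (is "?l \<longleftrightarrow> ?r")
proof
  assume ?l
  then show ?r unfolding based_homotopy_equivalent_def fibre_homotopy_equivalence_def by auto
next
  assume ?r
  then obtain h where h: "fibre_homotopy_equivalence E1 e1 (\<lambda>_. ()) E2 e2 (\<lambda>_. ()) h" ..
  obtain k where "continuous_map E2 E1 k" "k e2 = e1" 
    "homotopic_with (vertical_based E1 e1 (\<lambda>_. ())) E1 E1 (k \<circ> h) id"
    "homotopic_with (vertical_based E2 e2 (\<lambda>_. ())) E2 E2 (h \<circ> k) id"
    by (rule fibre_homotopy_equivalence_inverse[OF h])
  moreover have "continuous_map E1 E2 h" "h e1 = e2" using h by (simp_all add: fibre_homotopy_equivalence_def)
  ultimately show ?l unfolding based_homotopy_equivalent_def by auto
qed

lemma based_homotopy_equivalent_sym: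
  "based_homotopy_equivalent E1 e1 E2 e2 \<Longrightarrow> based_homotopy_equivalent E2 e2 E1 e1"
  unfolding based_homotopy_equivalent_def by blast

lemma based_homotopy_equivalent_trans:
  "based_homotopy_equivalent E1 e1 E2 e2 \<Longrightarrow> based_homotopy_equivalent E2 e2 E3 e3 \<Longrightarrow>
   based_homotopy_equivalent E1 e1 E3 e3"
  unfolding based_homotopy_equivalent_iff
  by (elim exE, rule exI, rule fibre_homotopy_equivalence_trans)

lemma Image_singleton_eq: "sym r \<Longrightarrow> trans r \<Longrightarrow> (x, y) \<in> r \<Longrightarrow> r `` {x} = r `` {y}"
  by (auto dest: symD transD)

lemma sym_trans_component_equiv: "sym (component_equiv X Y)" "trans (component_equiv X Y)"
proof -
  show "sym (component_equiv X Y)"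
  proof (rule symI)
    fix C D assume "(C, D) \<in> component_equiv X Y"
    then show "(D, C) \<in> component_equiv X Y"
      unfolding component_equiv_def mem_Collect_eq case_prod_conv
      by - (elim conjE, intro conjI, assumption, assumption, rule iffD1[OF homotopy_equivalent_space_sym])
  qed
  show "trans (component_equiv X Y)"
  proof (rule transI)
    fix C D F assume "(C, D) \<in> component_equiv X Y" "(D, F) \<in> component_equiv X Y"
    then show "(C, F) \<in> component_equiv X Y"
      unfolding component_equiv_def mem_Collect_eq case_prod_conv
      by - (elim conjE, intro conjI, assumption, assumption, rule homotopy_eqv_trans)
  qed
qed

lemma sym_trans_based_component_equiv:
  "sym (based_component_equiv X Y)" "trans (based_component_equiv X Y)"
proof -
  show "sym (based_component_equiv X Y)"
  proof (rule symI)
    fix a b assume ab: "(a, b) \<in> based_component_equiv X Y"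
    obtain C f D g where a: "a = (C, f)" and b: "b = (D, g)" by (cases a, cases b)
    show "(b, a) \<in> based_component_equiv X Y"
      using ab unfolding a b based_component_equiv_def mem_Collect_eq case_prod_conv
      by - (elim conjE, intro conjI, assumption, assumption, rule based_homotopy_equivalent_sym)
  qed
  show "trans (based_component_equiv X Y)"
  proof (rule transI)
    fix a b c assume ab: "(a, b) \<in> based_component_equiv X Y" and bc: "(b, c) \<in> based_component_equiv X Y"
    obtain C f D g F h where a: "a = (C, f)" and b: "b = (D, g)" and c: "c = (F, h)"
      by (cases a, cases b, cases c)
    show "(a, c) \<in> based_component_equiv X Y"
      using ab bc unfolding a b c based_component_equiv_def mem_Collect_eq case_prod_conv
      by - (elim conjE, intro conjI, assumption, assumption, rule based_homotopy_equivalent_trans)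
  qed
qed

lemma sym_trans_evaluation_fibration_equiv:
  "sym (evaluation_fibration_equiv X x0 Y)" "trans (evaluation_fibration_equiv X x0 Y)"
proof -
  show "sym (evaluation_fibration_equiv X x0 Y)"
  proof (rule symI)
    fix a b assume ab: "(a, b) \<in> evaluation_fibration_equiv X x0 Y"
    obtain E1 p1 E2 p2 where a: "a = (E1, p1)" and b: "b = (E2, p2)" by (cases a, cases b)
    have mem: "(E1, p1) \<in> evaluation_fibrations X x0 Y" "(E2, p2) \<in> evaluation_fibrations X x0 Y"
      and f12: "\<forall>e1\<in>topspace E1. \<exists>e2\<in>topspace E2. \<exists>h. fibre_homotopy_equivalence E1 e1 p1 E2 e2 p2 h"
      and b12: "\<forall>e2\<in>topspace E2. \<exists>e1\<in>topspace E1. \<exists>h. fibre_homotopy_equivalence E1 e1 p1 E2 e2 p2 h"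
      using ab unfolding a b evaluation_fibration_equiv_def by simp_all
    have "\<exists>e1\<in>topspace E1. \<exists>h. fibre_homotopy_equivalence E2 e2 p2 E1 e1 p1 h" if e2: "e2 \<in> topspace E2" for e2
    proof -
      obtain e1 h where "e1 \<in> topspace E1" "fibre_homotopy_equivalence E1 e1 p1 E2 e2 p2 h"
        using bspec[OF b12 e2] by (elim bexE exE)
      then show ?thesis by (intro bexI[of _ e1] fibre_homotopy_equivalence_sym)
    qed
    moreover have "\<exists>e2\<in>topspace E2. \<exists>h. fibre_homotopy_equivalence E2 e2 p2 E1 e1 p1 h" if e1: "e1 \<in> topspace E1" for e1
    proof -
      obtain e2 h where "e2 \<in> topspace E2" "fibre_homotopy_equivalence E1 e1 p1 E2 e2 p2 h"
        using bspec[OF f12 e1] by (elim bexE exE)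
      then show ?thesis by (intro bexI[of _ e2] fibre_homotopy_equivalence_sym)
    qed
    ultimately show "(b, a) \<in> evaluation_fibration_equiv X x0 Y"
      using mem unfolding a b evaluation_fibration_equiv_def by simp
  qed
  show "trans (evaluation_fibration_equiv X x0 Y)"
  proof (rule transI)
    fix a b c assume ab: "(a, b) \<in> evaluation_fibration_equiv X x0 Y" and bc: "(b, c) \<in> evaluation_fibration_equiv X x0 Y"
    obtain E1 p1 E2 p2 E3 p3 where a: "a = (E1, p1)" and b: "b = (E2, p2)" and c: "c = (E3, p3)"
      by (cases a, cases b, cases c)
    have mem: "(E1, p1) \<in> evaluation_fibrations X x0 Y" "(E3, p3) \<in> evaluation_fibrations X x0 Y"
      and f12: "\<forall>e1\<in>topspace E1. \<exists>e2\<in>topspace E2. \<exists>h. fibre_homotopy_equivalence E1 e1 p1 E2 e2 p2 h"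
      and b12: "\<forall>e2\<in>topspace E2. \<exists>e1\<in>topspace E1. \<exists>h. fibre_homotopy_equivalence E1 e1 p1 E2 e2 p2 h"
      and f23: "\<forall>e2\<in>topspace E2. \<exists>e3\<in>topspace E3. \<exists>h. fibre_homotopy_equivalence E2 e2 p2 E3 e3 p3 h"
      and b23: "\<forall>e3\<in>topspace E3. \<exists>e2\<in>topspace E2. \<exists>h. fibre_homotopy_equivalence E2 e2 p2 E3 e3 p3 h"
      using ab bc unfolding a b c evaluation_fibration_equiv_def by simp_all
    have "\<exists>e3\<in>topspace E3. \<exists>h. fibre_homotopy_equivalence E1 e1 p1 E3 e3 p3 h" if e1: "e1 \<in> topspace E1" for e1
    proof -
      obtain e2 h where e2: "e2 \<in> topspace E2" and h: "fibre_homotopy_equivalence E1 e1 p1 E2 e2 p2 h"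
        using bspec[OF f12 e1] by (elim bexE exE)
      obtain e3 h' where "e3 \<in> topspace E3" "fibre_homotopy_equivalence E2 e2 p2 E3 e3 p3 h'"
        using bspec[OF f23 e2] by (elim bexE exE)
      then show ?thesis by (intro bexI[of _ e3] exI[of _ "h' \<circ> h"] fibre_homotopy_equivalence_trans[OF h])
    qed
    moreover have "\<exists>e1\<in>topspace E1. \<exists>h. fibre_homotopy_equivalence E1 e1 p1 E3 e3 p3 h" if e3: "e3 \<in> topspace E3" for e3
    proof -
      obtain e2 h' where e2: "e2 \<in> topspace E2" and h': "fibre_homotopy_equivalence E2 e2 p2 E3 e3 p3 h'"
        using bspec[OF b23 e3] by (elim bexE exE)
      obtain e1 h where "e1 \<in> topspace E1" "fibre_homotopy_equivalence E1 e1 p1 E2 e2 p2 h"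
        using bspec[OF b12 e2] by (elim bexE exE)
      then show ?thesis by (intro bexI[of _ e1] exI[of _ "h' \<circ> h"] fibre_homotopy_equivalence_trans[OF _ h'])
    qed
    ultimately show "(a, c) \<in> evaluation_fibration_equiv X x0 Y"
      using mem unfolding a c evaluation_fibration_equiv_def by simp
  qed
qed

section \<open>The action on mapping spaces\<close>

lemma path_component_of_continuous_map:
  assumes F: "continuous_map S T F" and "path_component_of S x y"
  shows "path_component_of T (F x) (F y)"
proof -
  obtain g where "pathin S g" "g 0 = x" "g 1 = y" using assms(2) by (auto simp: path_component_of_set)
  moreover from this have "pathin T (\<lambda>t. F (g t))"
    unfolding pathin_def using continuous_map_compose'[OF _ F] by blast
  ultimately show ?thesis
    unfolding path_component_of_set by (intro exI[of _ "\<lambda>t. F (g t)"]) simp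
qed

lemma homotopic_imp_path_component:
  assumes "f \<in> maps X Y" "g \<in> maps X Y" "homotopic_with (\<lambda>_. True) X Y f g"
  shows "path_component_of (mapping_space X Y) f g"
proof -
  obtain H where H: "continuous_map (prod_topology unit_interval X) Y H" "\<forall>x. H (0, x) = f x" "\<forall>x. H (1, x) = g x"
    using assms(3) unfolding homotopic_with_def by auto
  have "pathin (mapping_space X Y) (\<lambda>t. \<lambda>x\<in>topspace X. H (t, x))"
    unfolding pathin_def by (rule continuous_map_curry[OF H(1)])
  then show ?thesis
    unfolding path_component_of_set
    by (intro exI[of _ "\<lambda>t. \<lambda>x\<in>topspace X. H (t, x)"])
       (simp add: H maps_extensional[OF assms(1)] maps_extensional[OF assms(2)])
qed

lemma homotopic_with_TrueI:
  assumes "continuous_map (prod_topology unit_interval X) Y H"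
    and "\<And>x. x \<in> topspace X \<Longrightarrow> H (0, x) = f x" "\<And>x. x \<in> topspace X \<Longrightarrow> H (1, x) = g x"
  shows "homotopic_with (\<lambda>_. True) X Y f g"
proof -
  have "homotopic_with (\<lambda>_. True) X Y (\<lambda>x. H (0, x)) (\<lambda>x. H (1, x))"
    unfolding homotopic_with_def using assms(1) by blast
  then show ?thesis by (rule homotopic_with_eq) (use assms in auto)
qed

lemma homotopic_with_pair:
  assumes "homotopic_with (\<lambda>_. True) X Y f f'" "homotopic_with (\<lambda>_. True) X Z g g'"
  shows "homotopic_with (\<lambda>_. True) X (prod_topology Y Z) (\<lambda>x. (f x, g x)) (\<lambda>x. (f' x, g' x))"
proof -
  have "homotopic_with (\<lambda>_. True) (prod_topology X X) (prod_topology Y Z)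
      (\<lambda>z. (f (fst z), g (snd z))) (\<lambda>z. (f' (fst z), g' (snd z)))"
    by (rule homotopic_with_prod_topology[OF assms]) simp
  from homotopic_with_compose_continuous_map_right[OF this, of X "\<lambda>x. (x, x)"]
  show ?thesis by (simp add: o_def continuous_map_pairedI)
qed

locale mapping_action =
  fixes X :: "'a topology" and x0 :: 'a and Y :: "'b topology" and y0 :: 'b
    and G :: "'g topology" and e :: 'g and m :: "'g \<times> 'g \<Rightarrow> 'g" and \<iota> :: "'g \<Rightarrow> 'g"
    and A :: "'g \<times> 'b \<Rightarrow> 'b"
  assumes HX: "Hausdorff_space X" and x0: "x0 \<in> topspace X"
    and GL: "group_like G e m \<iota>" and act: "homotopy_associative_action G e m Y y0 A"
begin

abbreviation S :: "('a \<Rightarrow> 'b) topology" where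
  "S \<equiv> mapping_space X Y"

abbreviation comp_space :: "('a \<Rightarrow> 'b) \<Rightarrow> ('a \<Rightarrow> 'b) topology" where
  "comp_space f \<equiv> subtopology S (map_component X Y f)"

definition translate :: "('a \<Rightarrow> 'g) \<Rightarrow> ('a \<Rightarrow> 'b) \<Rightarrow> ('a \<Rightarrow> 'b)" where
  "translate \<gamma> f = (\<lambda>x\<in>topspace X. A (\<gamma> x, f x))"

lemma unit_mem: "e \<in> topspace G"
  using GL by (simp add: group_like_def H_space_def)

lemma continuous_action: "continuous_map (prod_topology G Y) Y A"
  using act by (simp add: homotopy_associative_action_def)

lemma continuous_inverse: "continuous_map G G \<iota>" and inverse_unit: "\<iota> e = e"
  using GL by (simp_all add: group_like_def)

lemma homotopic_unit: "homotopic_with (\<lambda>_. True) Y Y (\<lambda>y. A (e, y)) id"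
  using act unfolding homotopy_associative_action_def by (blast intro: homotopic_with_mono)

lemma homotopic_action:
  "homotopic_with (\<lambda>_. True) (prod_topology G (prod_topology G Y)) Y
     (\<lambda>(a, b, y). A (a, A (b, y))) (\<lambda>(a, b, y). A (m (a, b), y))"
  using act unfolding homotopy_associative_action_def by (blast intro: homotopic_with_mono)

lemma translate_maps:
  assumes "continuous_map X G \<gamma>" "f \<in> maps X Y"
  shows "translate \<gamma> f \<in> maps X Y"
  unfolding translate_def
  by (intro maps_restrict continuous_map_compose'[OF _ continuous_action] continuous_map_pairedI assms maps_continuous)

lemma continuous_translate:
  assumes \<gamma>: "continuous_map X G \<gamma>"
  shows "continuous_map S S (translate \<gamma>)"
proof -
  \<comment> \<open>A one-point parameter space, to apply \<open>continuous_map_postcompose\<close>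
    to a single map.\<close>
  let ?P = "discrete_topology {()}"
  have "continuous_map (prod_topology ?P (prod_topology X Y)) Y (\<lambda>z. A (\<gamma> (fst (snd z)), snd (snd z)))"
    by (intro continuous_map_compose'[OF _ continuous_action] continuous_map_pairedI
        continuous_map_compose'[OF continuous_map_fst'[OF continuous_map_snd] \<gamma>] continuous_map_snd'[OF continuous_map_snd])
  from continuous_map_postcompose[OF HX this]
  have c1: "continuous_map (prod_topology ?P S) S (\<lambda>z. translate \<gamma> (snd z))"
    by (simp only: translate_def fst_conv snd_conv)
  have c2: "continuous_map S (prod_topology ?P S) (\<lambda>h. ((), h))"
    by (intro continuous_map_pairedI) auto
  show ?thesis using continuous_map_compose'[OF c2 c1] by (simp only: snd_conv)
qed

text \<open>Pointwise \<open>\<delta> (\<gamma> y) \<simeq> (\<delta> \<gamma>) y \<simeq> e y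
  \<simeq> y\<close>, by associativity, \<open>hom\<close> and the unit law. The homotopy lives on
  \<open>X x Y\<close>, so postcomposition applies it to all maps \<open>h\<close> at once, and its
  effect at \<open>x0\<close> depends on \<open>h x0\<close> alone.\<close>

lemma inverse_homotopy:
  assumes \<gamma>: "continuous_map X G \<gamma>" and \<delta>: "continuous_map X G \<delta>"
    and hom: "homotopic_with (\<lambda>_. True) X G (\<lambda>x. m (\<delta> x, \<gamma> x)) (\<lambda>_. e)"
  obtains \<theta> where "continuous_map (prod_topology unit_interval (prod_topology X Y)) Y \<theta>"
    "\<forall>z. \<theta> (0, z) = A (\<delta> (fst z), A (\<gamma> (fst z), snd z))" "\<forall>z. \<theta> (1, z) = snd z"
proof -
  let ?W = "prod_topology X Y"
  have c\<gamma>: "continuous_map ?W G (\<lambda>z. \<gamma> (fst z))" and c\<delta>: "continuous_map ?W G (\<lambda>z. \<delta> (fst z))"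
    by (rule continuous_map_compose'[OF continuous_map_fst \<gamma>] continuous_map_compose'[OF continuous_map_fst \<delta>])+
  have "continuous_map ?W (prod_topology G (prod_topology G Y)) (\<lambda>z. (\<delta> (fst z), \<gamma> (fst z), snd z))"
    by (intro continuous_map_pairedI c\<gamma> c\<delta> continuous_map_snd)
  from homotopic_with_compose_continuous_map_right[OF homotopic_action this, of "\<lambda>_. True"]
  have 1: "homotopic_with (\<lambda>_. True) ?W Y (\<lambda>z. A (\<delta> (fst z), A (\<gamma> (fst z), snd z))) (\<lambda>z. A (m (\<delta> (fst z), \<gamma> (fst z)), snd z))"
    by (simp add: o_def)
  have "homotopic_with (\<lambda>_. True) ?W (prod_topology G Y) (\<lambda>z. (m (\<delta> (fst z), \<gamma> (fst z)), id (snd z))) (\<lambda>z. (e, id (snd z)))"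
    by (rule homotopic_with_prod_topology[OF hom, of "\<lambda>_. True"]) simp_all
  from homotopic_with_compose_continuous_map_left[OF this continuous_action, of "\<lambda>_. True"]
  have 2: "homotopic_with (\<lambda>_. True) ?W Y (\<lambda>z. A (m (\<delta> (fst z), \<gamma> (fst z)), snd z)) (\<lambda>z. A (e, snd z))"
    by (simp add: o_def)
  from homotopic_with_compose_continuous_map_right[OF homotopic_unit continuous_map_snd, of "\<lambda>_. True" X]
  have 3: "homotopic_with (\<lambda>_. True) ?W Y (\<lambda>z. A (e, snd z)) snd"
    by (simp add: o_def)
  have "homotopic_with (\<lambda>_. True) ?W Y (\<lambda>z. A (\<delta> (fst z), A (\<gamma> (fst z), snd z))) snd"
    by (rule homotopic_with_trans[OF homotopic_with_trans[OF 1 2] 3])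
  then show ?thesis unfolding homotopic_with_def by (elim exE conjE) (rule that)
qed

lemma inverse_homotopy_component:
  assumes \<gamma>: "continuous_map X G \<gamma>" and \<delta>: "continuous_map X G \<delta>"
    and hom: "homotopic_with (\<lambda>_. True) X G (\<lambda>x. m (\<delta> x, \<gamma> x)) (\<lambda>_. e)"
  obtains \<Theta> \<alpha> where "continuous_map (prod_topology unit_interval (comp_space c)) (comp_space c) \<Theta>"
    "\<forall>h\<in>topspace (comp_space c). \<Theta> (0, h) = translate \<delta> (translate \<gamma> h)"
    "\<forall>h\<in>topspace (comp_space c). \<Theta> (1, h) = h"
    "continuous_map (prod_topology unit_interval Y) Y \<alpha>"
    "\<forall>y. \<alpha> (0, y) = A (\<delta> x0, A (\<gamma> x0, y))" "\<forall>y. \<alpha> (1, y) = y"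
    "\<forall>s. \<forall>h. \<Theta> (s, h) x0 = \<alpha> (s, h x0)"
proof -
  let ?C = "map_component X Y c"
  let ?M = "comp_space c"
  obtain \<theta> where \<theta>: "continuous_map (prod_topology unit_interval (prod_topology X Y)) Y \<theta>"
    "\<forall>z. \<theta> (0, z) = A (\<delta> (fst z), A (\<gamma> (fst z), snd z))" "\<forall>z. \<theta> (1, z) = snd z"
    by (rule inverse_homotopy[OF assms])
  define \<Theta> where "\<Theta> z = (\<lambda>x\<in>topspace X. \<theta> (fst z, x, snd z x))" for z :: "real \<times> ('a \<Rightarrow> 'b)"
  have c\<Theta>: "continuous_map (prod_topology unit_interval S) S \<Theta>"
    unfolding \<Theta>_def[abs_def] by (rule continuous_map_postcompose[OF HX \<theta>(1)])
  have \<Theta>0: "\<Theta> (0, h) = translate \<delta> (translate \<gamma> h)" for h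
    unfolding \<Theta>_def translate_def by (rule restrict_ext) (simp add: \<theta>(2))
  have \<Theta>1: "\<Theta> (1, h) = h" if "h \<in> maps X Y" for h
    using maps_extensional[OF that] by (simp add: \<Theta>_def \<theta>(3))
  have C: "h \<in> maps X Y" if "h \<in> ?C" for h
    using path_component_of_subset_topspace[of S c] that by auto
  \<comment> \<open>Only the end of the homotopy is known to be in the component, as
    \<open>\<Theta> (1, h) = h\<close>; hence the connecting path runs backwards from time
    \<open>1\<close>.\<close>
  have mem: "\<Theta> (s, h) \<in> ?C" if s: "s \<in> {0..1}" and h: "h \<in> ?C" for s h
  proof -
    have "continuous_map unit_interval unit_interval (\<lambda>t. 1 - t * (1 - s))"
    proof (rule continuous_map_into_unit)
      have "continuous_map unit_interval euclideanreal (\<lambda>t. t * (1 - s))"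
        by (rule continuous_map_from_unit[OF continuous_map_scale]) (use s in auto)
      then show "continuous_map unit_interval euclideanreal (\<lambda>t. 1 - t * (1 - s))"
        by (intro continuous_map_diff continuous_map_canonical_const)
    qed (use s in \<open>auto intro: mult_le_one\<close>)
    then have "continuous_map unit_interval S (\<lambda>t. \<Theta> (1 - t * (1 - s), h))"
      using C[OF h] by (intro continuous_map_compose'[OF _ c\<Theta>] continuous_map_pairedI) auto
    then have "path_component_of S (\<Theta> (1, h)) (\<Theta> (s, h))"
      unfolding path_component_of_def pathin_def by (intro exI[of _ "\<lambda>t. \<Theta> (1 - t * (1 - s), h)"]) simp
    then show ?thesis using path_component_of_trans[of S c h] h \<Theta>1[OF C[OF h]] by simp
  qed
  have c: "continuous_map (prod_topology unit_interval ?M) ?M \<Theta>"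
  proof (rule continuous_map_into_subtopology)
    have "continuous_map (prod_topology unit_interval ?M) (prod_topology unit_interval S) (\<lambda>z. z)"
      by (rule continuous_map_into_prod_fulltopology[where S = ?C]) simp
    then show "continuous_map (prod_topology unit_interval ?M) S \<Theta>" by (rule continuous_map_compose'[OF _ c\<Theta>])
  qed (use mem in auto)
  define \<alpha> where "\<alpha> z = \<theta> (fst z, x0, snd z)" for z
  have c\<alpha>: "continuous_map (prod_topology unit_interval Y) Y \<alpha>"
    unfolding \<alpha>_def
    by (intro continuous_map_compose'[OF _ \<theta>(1)] continuous_map_pairedI continuous_map_fst continuous_map_snd) (use x0 in simp)
  show ?thesis
  proof (rule that[OF c _ _ c\<alpha>])
    show "\<forall>h\<in>topspace ?M. \<Theta> (1, h) = h" using \<Theta>1 by simp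
    show "\<forall>s. \<forall>h. \<Theta> (s, h) x0 = \<alpha> (s, h x0)" using x0 by (simp add: \<Theta>_def \<alpha>_def)
  qed (simp_all add: \<Theta>0 \<alpha>_def \<theta>)
qed

lemma translate_component:
  assumes \<gamma>: "continuous_map X G \<gamma>"
  shows "continuous_map (comp_space f) (comp_space (translate \<gamma> f)) (translate \<gamma>)"
proof (rule continuous_map_into_subtopology)
  show "continuous_map (comp_space f) S (translate \<gamma>)"
    by (rule continuous_map_from_subtopology[OF continuous_translate[OF \<gamma>]])
  show "translate \<gamma> \<in> topspace (comp_space f) \<rightarrow> map_component X Y (translate \<gamma> f)"
    using path_component_of_continuous_map[OF continuous_translate[OF \<gamma>]] by auto
qed

lemma component_eq: "path_component_of S f g \<Longrightarrow> map_component X Y f = map_component X Y g"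
  by (auto simp: path_component_of_equiv)

section \<open>Translation by a based map and by its pointwise inverse\<close>

context
  fixes \<gamma> assumes \<gamma>: "\<gamma> \<in> based_maps X x0 G e"
begin

abbreviation (input) "\<delta> \<equiv> \<lambda>x. \<iota> (\<gamma> x)"

lemma c\<gamma>: "continuous_map X G \<gamma>" and map_basepoint: "\<gamma> x0 = e"
  using \<gamma> by (simp_all add: based_maps_def maps_def)

lemma c\<delta>: "continuous_map X G \<delta>"
  by (rule continuous_map_compose'[OF c\<gamma> continuous_inverse])

lemma homotopic_left_inverse: "homotopic_with (\<lambda>_. True) X G (\<lambda>x. m (\<delta> x, \<gamma> x)) (\<lambda>_. e)"
  and homotopic_right_inverse: "homotopic_with (\<lambda>_. True) X G (\<lambda>x. m (\<gamma> x, \<delta> x)) (\<lambda>_. e)"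
proof -
  have 1: "based_homotopic G e G e (\<lambda>g. m (\<iota> g, g)) (\<lambda>_. e)" and 2: "based_homotopic G e G e (\<lambda>g. m (g, \<iota> g)) (\<lambda>_. e)"
    using GL by (simp_all add: group_like_def)
  from homotopic_with_compose_continuous_map_right[OF 1 c\<gamma>, of "\<lambda>_. True"]
  show "homotopic_with (\<lambda>_. True) X G (\<lambda>x. m (\<delta> x, \<gamma> x)) (\<lambda>_. e)" by (simp add: o_def)
  from homotopic_with_compose_continuous_map_right[OF 2 c\<gamma>, of "\<lambda>_. True"]
  show "homotopic_with (\<lambda>_. True) X G (\<lambda>x. m (\<gamma> x, \<delta> x)) (\<lambda>_. e)" by (simp add: o_def)
qed

text \<open>The homotopy \<open>\<Theta>\<close> stays in the component of \<open>f\<close>, so its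
  initial value at \<open>f\<close> lies there.\<close>

lemma translate_inverse_component:
  assumes f: "f \<in> maps X Y"
  shows "map_component X Y (translate \<delta> (translate \<gamma> f)) = map_component X Y f"
proof -
  obtain \<Theta> \<alpha> where \<Theta>: "continuous_map (prod_topology unit_interval (comp_space f)) (comp_space f) \<Theta>"
    "\<forall>h\<in>topspace (comp_space f). \<Theta> (0, h) = translate \<delta> (translate \<gamma> h)"
    by (rule inverse_homotopy_component[OF c\<gamma> c\<delta> homotopic_left_inverse])
  have fM: "f \<in> topspace (comp_space f)" using f by (simp add: path_component_of_refl)
  then have "\<Theta> (0, f) \<in> topspace (comp_space f)" by (intro continuous_map_mem[OF \<Theta>(1)]) simp
  then have "path_component_of S f (translate \<delta> (translate \<gamma> f))" using \<Theta>(2) fM by simp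
  then show ?thesis using component_eq by simp
qed

lemma translate_back:
  assumes f: "f \<in> maps X Y"
  shows "continuous_map (comp_space (translate \<gamma> f)) (comp_space f) (translate \<delta>)"
  using translate_component[OF c\<delta>, of "translate \<gamma> f"] unfolding translate_inverse_component[OF f] .

lemma homotopy_equivalent_translate:
  assumes f: "f \<in> maps X Y"
  shows "comp_space f homotopy_equivalent_space comp_space (translate \<gamma> f)"
proof -
  obtain \<Theta> \<alpha> where \<Theta>: "continuous_map (prod_topology unit_interval (comp_space f)) (comp_space f) \<Theta>"
    "\<forall>h\<in>topspace (comp_space f). \<Theta> (0, h) = translate \<delta> (translate \<gamma> h)"
    "\<forall>h\<in>topspace (comp_space f). \<Theta> (1, h) = h"
    by (rule inverse_homotopy_component[OF c\<gamma> c\<delta> homotopic_left_inverse])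
  let ?g = "translate \<gamma> f"
  obtain \<Xi> \<alpha>' where \<Xi>: "continuous_map (prod_topology unit_interval (comp_space ?g)) (comp_space ?g) \<Xi>"
    "\<forall>h\<in>topspace (comp_space ?g). \<Xi> (0, h) = translate \<gamma> (translate \<delta> h)"
    "\<forall>h\<in>topspace (comp_space ?g). \<Xi> (1, h) = h"
    by (rule inverse_homotopy_component[OF c\<delta> c\<gamma> homotopic_right_inverse])
  have "homotopic_with (\<lambda>_. True) (comp_space f) (comp_space f) (translate \<delta> \<circ> translate \<gamma>) id"
    by (rule homotopic_with_TrueI[OF \<Theta>(1)]) (use \<Theta> in auto)
  moreover have "homotopic_with (\<lambda>_. True) (comp_space ?g) (comp_space ?g) (translate \<gamma> \<circ> translate \<delta>) id"
    by (rule homotopic_with_TrueI[OF \<Xi>(1)]) (use \<Xi> in auto)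
  ultimately show ?thesis
    unfolding homotopy_equivalent_space_def
    using translate_component[OF c\<gamma>] translate_back[OF f] by blast
qed

text \<open>Stated for an arbitrary projection \<open>p\<close> in order to serve (B), where
  \<open>p\<close> is constant, and (C), where it evaluates at \<open>x0\<close>. The hypothesis
  \<open>track\<close> turns the motion \<open>\<alpha>\<close> of the values at \<open>x0\<close>
  into a loop \<open>\<beta>\<close> over the base, as Dold's theorem requires. The second
  conclusion exchanges \<open>\<gamma>\<close> and \<open>\<delta>\<close>, to allow a base point
  prescribed in the target component.\<close>

lemma fibre_homotopy_equivalence_translate:
  fixes p :: "('a \<Rightarrow> 'b) \<Rightarrow> 'c" and B :: "'c topology"
  assumes f: "f \<in> maps X Y"
    and wp: "\<And>h. h \<in> maps X Y \<Longrightarrow> well_pointed S h"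
    and reg: "\<And>M :: ('a \<Rightarrow> 'b) topology. regular_lifting (prod_topology (prod_topology unit_interval unit_interval) M) S p B"
    and p: "continuous_map S B p"
    and p\<gamma>: "\<And>h. h \<in> maps X Y \<Longrightarrow> p (translate \<gamma> h) = p h" and p\<delta>: "\<And>h. h \<in> maps X Y \<Longrightarrow> p (translate \<delta> h) = p h"
    and track: "\<forall>\<Theta> \<alpha>. (\<forall>s h. \<Theta> (s, h) x0 = \<alpha> (s, h x0)) \<and>
         continuous_map (prod_topology unit_interval Y) Y \<alpha> \<and>
         (\<forall>y. \<alpha> (0, y) = A (e, A (e, y))) \<and> (\<forall>y. \<alpha> (1, y) = y) \<longrightarrow>
       (\<exists>\<beta>. continuous_map (prod_topology unit_interval B) B \<beta> \<and> (\<forall>b\<in>topspace B. \<beta> (0, b) = b) \<and>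
         (\<forall>b\<in>topspace B. \<beta> (1, b) = b) \<and> (\<forall>s\<in>{0..1}. \<forall>h\<in>maps X Y. p (\<Theta> (s, h)) = \<beta> (s, p h)))"
  shows "h \<in> topspace (comp_space f) \<Longrightarrow>
       fibre_homotopy_equivalence (comp_space f) h p (comp_space (translate \<gamma> f)) (translate \<gamma> h) p (translate \<gamma>)"
    and "h \<in> topspace (comp_space (translate \<gamma> f)) \<Longrightarrow>
       fibre_homotopy_equivalence (comp_space (translate \<gamma> f)) h p (comp_space f) (translate \<delta> h) p (translate \<delta>)"
proof -
  let ?g = "translate \<gamma> f"
  let ?M = "comp_space f" and ?N = "comp_space ?g"
  obtain \<Theta> \<alpha> where \<Theta>: "continuous_map (prod_topology unit_interval ?M) ?M \<Theta>"
    "\<forall>h\<in>topspace ?M. \<Theta> (0, h) = translate \<delta> (translate \<gamma> h)" "\<forall>h\<in>topspace ?M. \<Theta> (1, h) = h"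
    and \<alpha>: "continuous_map (prod_topology unit_interval Y) Y \<alpha>"
    "\<forall>y. \<alpha> (0, y) = A (\<delta> x0, A (\<gamma> x0, y))" "\<forall>y. \<alpha> (1, y) = y" "\<forall>s. \<forall>h. \<Theta> (s, h) x0 = \<alpha> (s, h x0)"
    by (rule inverse_homotopy_component[OF c\<gamma> c\<delta> homotopic_left_inverse])
  obtain \<Xi> \<alpha>' where \<Xi>: "continuous_map (prod_topology unit_interval ?N) ?N \<Xi>"
    "\<forall>h\<in>topspace ?N. \<Xi> (0, h) = translate \<gamma> (translate \<delta> h)" "\<forall>h\<in>topspace ?N. \<Xi> (1, h) = h"
    and \<alpha>': "continuous_map (prod_topology unit_interval Y) Y \<alpha>'"
    "\<forall>y. \<alpha>' (0, y) = A (\<gamma> x0, A (\<delta> x0, y))" "\<forall>y. \<alpha>' (1, y) = y" "\<forall>s. \<forall>h. \<Xi> (s, h) x0 = \<alpha>' (s, h x0)"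
    by (rule inverse_homotopy_component[OF c\<delta> c\<gamma> homotopic_right_inverse])
  obtain \<beta> where \<beta>: "continuous_map (prod_topology unit_interval B) B \<beta>" "\<forall>b\<in>topspace B. \<beta> (0, b) = b"
    "\<forall>b\<in>topspace B. \<beta> (1, b) = b" "\<forall>s\<in>{0..1}. \<forall>h\<in>maps X Y. p (\<Theta> (s, h)) = \<beta> (s, p h)"
    using track[THEN spec[of _ \<Theta>], THEN spec[of _ \<alpha>], THEN mp,
        OF conjI[OF \<alpha>(4) conjI[OF \<alpha>(1) conjI[OF \<alpha>(2)[unfolded map_basepoint inverse_unit] \<alpha>(3)]]]] by (elim exE conjE)
  obtain \<beta>' where \<beta>': "continuous_map (prod_topology unit_interval B) B \<beta>'" "\<forall>b\<in>topspace B. \<beta>' (0, b) = b"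
    "\<forall>b\<in>topspace B. \<beta>' (1, b) = b" "\<forall>s\<in>{0..1}. \<forall>h\<in>maps X Y. p (\<Xi> (s, h)) = \<beta>' (s, p h)"
    using track[THEN spec[of _ \<Xi>], THEN spec[of _ \<alpha>'], THEN mp,
        OF conjI[OF \<alpha>'(4) conjI[OF \<alpha>'(1) conjI[OF \<alpha>'(2)[unfolded map_basepoint inverse_unit] \<alpha>'(3)]]]] by (elim exE conjE)
  have maps: "h \<in> maps X Y" if "h \<in> topspace (comp_space c)" for h c using that by simp
  have pc: "continuous_map (comp_space c) B p" for c by (rule continuous_map_from_subtopology[OF p])
  have rl: "relative_lifting (comp_space c) h (comp_space c') p B" if h: "h \<in> topspace (comp_space c)" for h c c'
  proof -
    have "well_pointed (comp_space c) h"
      using h by (intro well_pointed_path_component wp) auto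
    from relative_lifting_path_component[OF relative_lifting_well_pointed[OF this reg]] show ?thesis .
  qed
  note c\<Phi> = translate_component[OF c\<gamma>, of f] and c\<Gamma> = translate_back[OF f]
  show "fibre_homotopy_equivalence ?M h p ?N (translate \<gamma> h) p (translate \<gamma>)" if h: "h \<in> topspace ?M"
  proof (rule fibre_homotopy_equivalence_Dold[OF h c\<Phi> c\<Gamma> pc pc _ _ refl \<Theta>(1) _ _ \<beta>(1) _ _ _ \<Xi>(1) _ _ \<beta>'(1)])
    have gh: "translate \<gamma> h \<in> topspace ?N" by (rule continuous_map_mem[OF c\<Phi> h])
    show "relative_lifting ?N (translate \<gamma> h) ?M p B" "relative_lifting ?M h ?M p B"
      "relative_lifting ?M h ?N p B" "relative_lifting ?N (translate \<gamma> h) ?N p B"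
      by (rule rl[OF gh] rl[OF h])+
  qed (use \<Theta>(2,3) \<Xi>(2,3) \<beta>(2-4) \<beta>'(2-4) p\<gamma> p\<delta> maps in blast)+
  show "fibre_homotopy_equivalence ?N h p ?M (translate \<delta> h) p (translate \<delta>)" if h: "h \<in> topspace ?N"
  proof (rule fibre_homotopy_equivalence_Dold[OF h c\<Gamma> c\<Phi> pc pc _ _ refl \<Xi>(1) _ _ \<beta>'(1) _ _ _ \<Theta>(1) _ _ \<beta>(1)])
    have gh: "translate \<delta> h \<in> topspace ?M" by (rule continuous_map_mem[OF c\<Gamma> h])
    show "relative_lifting ?M (translate \<delta> h) ?N p B" "relative_lifting ?N h ?N p B"
      "relative_lifting ?N h ?M p B" "relative_lifting ?M (translate \<delta> h) ?M p B"
      by (rule rl[OF gh] rl[OF h])+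
  qed (use \<Theta>(2,3) \<Xi>(2,3) \<beta>(2-4) \<beta>'(2-4) p\<gamma> p\<delta> maps in blast)+
qed

end

end

text \<open>Non-degeneracy of \<open>f\<close> extends a path from \<open>f\<close> to
  \<open>g\<close> to a homotopy of all of \<open>M\<close>. Its final map takes \<open>f\<close> to
  \<open>g\<close> and is homotopic to the identity; Dold's theorem over a point, with the identity
  as approximate inverse, makes it a based equivalence.\<close>

lemma based_homotopy_equivalent_same_space:
  assumes f: "well_pointed M f" and g: "well_pointed M g" and fg: "path_component_of M f g"
  shows "based_homotopy_equivalent M f M g"
proof -
  let ?B = "discrete_topology (UNIV :: unit set)" and ?II = "prod_topology unit_interval unit_interval"
  let ?p = "\<lambda>_. ()"
  obtain r where r: "pathin M r" "r 0 = f" "r 1 = g" using fg by (auto simp: path_component_of_set)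
  have cu: "continuous_map Z ?B ?p" for Z :: "'z topology" by simp
  have rl: "relative_lifting M h M ?p ?B" if "well_pointed M h" for h
    by (rule relative_lifting_well_pointed[OF that regular_lifting_trivial])
  obtain L where L: "continuous_map (prod_topology ?II M) M L"
    and LK: "\<forall>q\<in>{0..1}. \<forall>h\<in>topspace M. L ((q, 0), h) = snd (q, h)"
    and Ln: "\<forall>q\<in>{0..1}. \<forall>s\<in>{0..1}. L ((q, s), f) = r (snd (q, s))"
    and "\<forall>q\<in>{0..1}. \<forall>s\<in>{0..1}. \<forall>h\<in>topspace M. () = ()"
  proof (rule relative_liftingE[OF rl[OF f], where K = snd and \<beta> = "\<lambda>_. ()" and n = "\<lambda>z. r (snd z)"])
    show "continuous_map ?II M (\<lambda>z. r (snd z))"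
      using r(1) unfolding pathin_def by (rule continuous_map_compose'[OF continuous_map_snd])
  qed (auto simp: r continuous_map_snd)
  \<comment> \<open>Reversed in time, to lead from the moved map to the identity. Both composites
    with the identity are that moved map, so \<open>\<Theta>\<close> serves for both.\<close>
  define \<Theta> where "\<Theta> z = L ((0, 1 - fst z), snd z)" for z
  have c\<Theta>: "continuous_map (prod_topology unit_interval M) M \<Theta>"
  proof -
    have "continuous_map (prod_topology unit_interval M) unit_interval (\<lambda>z. 1 - fst z)"
      by (intro continuous_map_into_unit continuous_map_diff continuous_map_canonical_const
          continuous_map_from_unit[OF continuous_map_fst]) auto
    then show ?thesis
      unfolding \<Theta>_def by (intro continuous_map_compose'[OF _ L] continuous_map_pairedI continuous_map_snd) simp
  qed
  have \<Theta>1: "\<Theta> (1, x) = x" if "x \<in> topspace M" for x using LK that by (simp add: \<Theta>_def)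
  define F where "F x = \<Theta> (0, x)" for x
  have cF: "continuous_map M M F"
    unfolding F_def by (intro continuous_map_compose'[OF _ c\<Theta>] continuous_map_pairedI) auto
  have Ff: "F f = g" using Ln r(3) by (simp add: F_def \<Theta>_def)
  have fM: "f \<in> topspace M" using f by (simp add: well_pointed_def)
  have "fibre_homotopy_equivalence M f ?p M g ?p F"
  proof (rule fibre_homotopy_equivalence_Dold[where \<Gamma> = "\<lambda>x. x" and B = ?B and \<Theta> = \<Theta> and \<Xi> = \<Theta>
        and \<alpha> = "\<lambda>_. ()" and \<alpha>' = "\<lambda>_. ()"])
    show "relative_lifting M g M ?p ?B" "relative_lifting M f M ?p ?B"
      "relative_lifting M f M ?p ?B" "relative_lifting M g M ?p ?B"
      by (rule rl[OF g] rl[OF f])+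
  qed (simp_all add: fM cF Ff c\<Theta> \<Theta>1 F_def[symmetric])
  then show ?thesis unfolding based_homotopy_equivalent_iff by (rule exI[of _ F])
qed

section \<open>Orbits of homotopy classes and the surjections\<close>

lemma free_homotopyI:
  "f \<in> maps X Y \<Longrightarrow> g \<in> maps X Y \<Longrightarrow> homotopic_with (\<lambda>_. True) X Y f g \<Longrightarrow> (f, g) \<in> free_homotopy X Y"
  by (simp add: free_homotopy_def)

lemma equiv_free_homotopy: "equiv (maps X Y) (free_homotopy X Y)"
proof (rule equivI)
  show "free_homotopy X Y \<subseteq> maps X Y \<times> maps X Y" by (auto simp: free_homotopy_def)
  show "refl_on (maps X Y) (free_homotopy X Y)"
    by (intro refl_onI) (auto simp: free_homotopy_def maps_continuous)
  show "sym (free_homotopy X Y)"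
    by (intro symI) (auto simp: free_homotopy_def homotopic_with_sym)
  show "trans (free_homotopy X Y)"
    by (intro transI) (auto simp: free_homotopy_def intro: homotopic_with_trans)
qed

text \<open>In each part both sides are images of \<open>maps X Y\<close>, so the surjection exists
  as soon as maps with the same orbit have the same class.\<close>

lemma factor_through:
  assumes "\<And>f g. f \<in> I \<Longrightarrow> g \<in> I \<Longrightarrow> k f = k g \<Longrightarrow> F f = F g"
  shows "\<exists>\<Psi>. \<Psi> ` (k ` I) = F ` I \<and> (\<forall>f\<in>I. \<Psi> (k f) = F f)"
proof -
  let ?\<Psi> = "\<lambda>x. F (inv_into I k x)"
  have *: "?\<Psi> (k f) = F f" if f: "f \<in> I" for f
    by (rule assms) (use f in \<open>auto intro: inv_into_into f_inv_into_f\<close>)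
  then have "?\<Psi> ` (k ` I) = F ` I" by (simp add: image_image cong: image_cong)
  with * show ?thesis by blast
qed

context mapping_action
begin

abbreviation based_class :: "('a \<Rightarrow> 'g) \<Rightarrow> ('a \<Rightarrow> 'g) set" where
  "based_class \<gamma> \<equiv> based_homotopy X x0 G e `` {\<gamma>}"

abbreviation free_class :: "('a \<Rightarrow> 'b) \<Rightarrow> ('a \<Rightarrow> 'b) set" where
  "free_class f \<equiv> free_homotopy X Y `` {f}"

lemma translate_homotopic:
  assumes \<gamma>: "(\<gamma>, \<gamma>') \<in> based_homotopy X x0 G e" and f: "(f, f') \<in> free_homotopy X Y"
  shows "(translate \<gamma> f, translate \<gamma>' f') \<in> free_homotopy X Y"
proof (rule free_homotopyI)
  have c: "continuous_map X G \<gamma>" "continuous_map X G \<gamma>'"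
    using \<gamma> by (simp_all add: based_homotopy_def based_maps_def maps_continuous)
  have m: "f \<in> maps X Y" "f' \<in> maps X Y" using f by (simp_all add: free_homotopy_def)
  show "translate \<gamma> f \<in> maps X Y" "translate \<gamma>' f' \<in> maps X Y"
    by (rule translate_maps[OF c(1) m(1)] translate_maps[OF c(2) m(2)])+
  have "based_homotopic X x0 G e \<gamma> \<gamma>'" using \<gamma> by (simp add: based_homotopy_def)
  then have 1: "homotopic_with (\<lambda>_. True) X G \<gamma> \<gamma>'" by (rule homotopic_with_mono) simp
  have 2: "homotopic_with (\<lambda>_. True) X Y f f'" using f by (simp add: free_homotopy_def)
  from homotopic_with_compose_continuous_map_left[OF homotopic_with_pair[OF 1 2] continuous_action, of "\<lambda>_. True"]
  have "homotopic_with (\<lambda>_. True) X Y (\<lambda>x. A (\<gamma> x, f x)) (\<lambda>x. A (\<gamma>' x, f' x))" by (simp add: o_def)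
  then show "homotopic_with (\<lambda>_. True) X Y (translate \<gamma> f) (translate \<gamma>' f')"
    by (rule homotopic_with_eq) (simp_all add: translate_def)
qed

lemma based_homotopy_refl: "\<gamma> \<in> based_maps X x0 G e \<Longrightarrow> (\<gamma>, \<gamma>) \<in> based_homotopy X x0 G e"
  by (simp add: based_homotopy_def based_maps_def maps_continuous)

text \<open>\<open>class_action\<close> ranges over all representatives; by homotopy invariance all
  of them yield the same class.\<close>

lemma class_action_class:
  assumes \<gamma>: "\<gamma> \<in> based_maps X x0 G e" and f: "f \<in> maps X Y"
  shows "class_action X Y A (based_class \<gamma>) (free_class f) = free_class (translate \<gamma> f)"
proof -
  let ?T = "{\<lambda>x\<in>topspace X. A (\<gamma>' x, f' x) | \<gamma>' f'. \<gamma>' \<in> based_class \<gamma> \<and> f' \<in> free_class f}"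
  have "free_class f \<in> free_classes X Y" using f by (simp add: free_classes_def quotientI)
  then have "class_action X Y A (based_class \<gamma>) (free_class f) = free_homotopy X Y `` ?T"
    by (simp add: class_action_def)
  also have "\<dots> = free_class (translate \<gamma> f)"
  proof
    show "free_homotopy X Y `` ?T \<subseteq> free_class (translate \<gamma> f)"
    proof
      fix h assume "h \<in> free_homotopy X Y `` ?T"
      then obtain \<gamma>' f' where "(\<gamma>, \<gamma>') \<in> based_homotopy X x0 G e" "(f, f') \<in> free_homotopy X Y"
        and h: "(translate \<gamma>' f', h) \<in> free_homotopy X Y"
        unfolding translate_def by blast
      from translate_homotopic[OF this(1,2)] h
      show "h \<in> free_class (translate \<gamma> f)"
        using equivE[OF equiv_free_homotopy[of X Y]] by (meson Image_singleton_iff transD)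
    qed
    have "(f, f) \<in> free_homotopy X Y" using f by (simp add: free_homotopy_def maps_continuous)
    then have "translate \<gamma> f \<in> ?T"
      using based_homotopy_refl[OF \<gamma>] unfolding translate_def by blast
    then show "free_class (translate \<gamma> f) \<subseteq> free_homotopy X Y `` ?T" by blast
  qed
  finally show ?thesis .
qed

text \<open>By the homotopy unit law the constant map at \<open>e\<close> fixes the class of
  \<open>g\<close>, so this class is in its own orbit and hence in that of \<open>f\<close>.\<close>

lemma orbit_eqD:
  assumes f: "f \<in> maps X Y" and g: "g \<in> maps X Y"
    and eq: "orbit (class_group X x0 G e m) (class_action X Y A) (free_class f)
           = orbit (class_group X x0 G e m) (class_action X Y A) (free_class g)"
  obtains \<gamma> where "\<gamma> \<in> based_maps X x0 G e" "path_component_of S (translate \<gamma> f) g"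
proof -
  let ?XG = "class_group X x0 G e m" and ?act = "class_action X Y A"
  have carrier: "carrier ?XG = based_class ` based_maps X x0 G e"
    by (auto simp: class_group_def quotient_def)
  define \<epsilon> where "\<epsilon> = (\<lambda>x\<in>topspace X. e)"
  have \<epsilon>: "\<epsilon> \<in> based_maps X x0 G e"
    using x0 unit_mem by (simp add: \<epsilon>_def based_maps_def maps_restrict)
  have "(translate \<epsilon> g, g) \<in> free_homotopy X Y"
  proof (rule free_homotopyI[OF translate_maps g])
    show "continuous_map X G \<epsilon>" using \<epsilon> by (simp add: based_maps_def maps_continuous)
    from homotopic_with_compose_continuous_map_right[OF homotopic_unit maps_continuous[OF g], of "\<lambda>_. True"]
    have "homotopic_with (\<lambda>_. True) X Y (\<lambda>x. A (e, g x)) g" by (simp add: o_def)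
    then show "homotopic_with (\<lambda>_. True) X Y (translate \<epsilon> g) g"
      by (rule homotopic_with_eq) (simp_all add: translate_def \<epsilon>_def)
  qed (rule g)
  then have "?act (based_class \<epsilon>) (free_class g) = free_class g"
    unfolding class_action_class[OF \<epsilon> g] by (rule equiv_class_eq[OF equiv_free_homotopy])
  then have "free_class g \<in> orbit ?XG ?act (free_class g)"
    unfolding orbit_def carrier using \<epsilon> by force
  then have "free_class g \<in> orbit ?XG ?act (free_class f)" unfolding eq .
  then obtain \<gamma> where \<gamma>: "\<gamma> \<in> based_maps X x0 G e" and "free_class g = ?act (based_class \<gamma>) (free_class f)"
    unfolding orbit_def carrier by blast
  then have gf: "free_class g = free_class (translate \<gamma> f)" by (simp add: class_action_class[OF \<gamma> f])
  have "g \<in> free_class g" by (rule equiv_class_self[OF equiv_free_homotopy g])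
  then have "(translate \<gamma> f, g) \<in> free_homotopy X Y" unfolding gf by simp
  then have "path_component_of S (translate \<gamma> f) g"
    unfolding free_homotopy_def by (auto intro: homotopic_imp_path_component)
  with \<gamma> show ?thesis by (rule that)
qed

lemma orbits_eq:
  "orbits (class_group X x0 G e m) (free_classes X Y) (class_action X Y A)
   = (\<lambda>f. orbit (class_group X x0 G e m) (class_action X Y A) (free_class f)) ` maps X Y"
  unfolding orbits_def free_classes_def quotient_def by blast

end

theorem corollary2p5:
  fixes X :: "'a topology" and x0 :: 'a
    and Y :: "'b topology" and y0 :: 'b
    and G :: "'g topology" and e :: 'g and m :: "'g \<times> 'g \<Rightarrow> 'g" and \<iota> :: "'g \<Rightarrow> 'g"
    and A :: "'g \<times> 'b \<Rightarrow> 'b"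
  assumes "CW_complex X cX dX \<Phi>X" and "countable cX" and "connected_space X"
    and "nondegenerate_basepoint X x0"
    and "CW_complex Y cY dY \<Phi>Y" and "countable cY" and "connected_space Y"
    and "nondegenerate_basepoint Y y0"
    and "group_like G e m \<iota>"
    and "homotopy_associative_action G e m Y y0 A"
  shows
    "let XG = class_group X x0 G e m;
         act = class_action X Y A;
         cls = (\<lambda>f. free_homotopy X Y `` {f});
         \<O> = orbits XG (free_classes X Y) act
     in
       (\<exists>\<Psi>. \<Psi> ` \<O> = path_components_of (mapping_space X Y) // component_equiv X Y \<and>
          (\<forall>f\<in>maps X Y. \<Psi> (orbit XG act (cls f)) = component_equiv X Y `` {map_component X Y f}))
       \<and>
       (finite cX \<longrightarrow>
        (\<exists>\<Psi>. \<Psi> ` \<O> = based_components X Y // based_component_equiv X Y \<and>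
          (\<forall>f\<in>maps X Y. \<Psi> (orbit XG act (cls f)) =
             based_component_equiv X Y `` {(map_component X Y f, f)})))
       \<and>
       (finite cX \<and> strictly_unital e Y A \<longrightarrow>
        (\<exists>\<Psi>. \<Psi> ` \<O> = evaluation_fibrations X x0 Y // evaluation_fibration_equiv X x0 Y \<and>
          (\<forall>f\<in>maps X Y. \<Psi> (orbit XG act (cls f)) =
             evaluation_fibration_equiv X x0 Y `` {evaluation_fibration X x0 Y f})))"
proof -
  interpret CX: cw_complex X cX dX \<Phi>X by (unfold_locales) (rule assms(1))
  have CY: "cw_complex Y cY dY \<Phi>Y" by (unfold_locales) (rule assms(5))
  have HX: "Hausdorff_space X" by (rule CX.Hausdorff)
  have x0: "x0 \<in> topspace X" using assms(4) by (simp add: nondegenerate_basepoint_def)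
  interpret mapping_action X x0 Y y0 G e m \<iota> A
    by (unfold_locales) (rule HX x0 assms(9) assms(10))+
  let ?XG = "class_group X x0 G e m" and ?act = "class_action X Y A"
  let ?orb = "\<lambda>f. orbit ?XG ?act (free_class f)"
  have wp: "well_pointed S h" if "finite cX" "h \<in> maps X Y" for h
    using well_pointed_mapping_space[OF HX CX.compact_space_finite[OF that(1)] _ CY assms(6) that(2)] x0 by blast
  have mem: "f \<in> topspace (comp_space f)" if "f \<in> maps X Y" for f
    using that by (simp add: path_component_of_refl)
  have A: "\<exists>\<Psi>. \<Psi> ` (?orb ` maps X Y) = path_components_of S // component_equiv X Y \<and>
      (\<forall>f\<in>maps X Y. \<Psi> (?orb f) = component_equiv X Y `` {map_component X Y f})"
  proof -
    have quot: "path_components_of S // component_equiv X Y = (\<lambda>f. component_equiv X Y `` {map_component X Y f}) ` maps X Y"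
      by (auto simp: quotient_def path_components_of_def)
    show ?thesis
      unfolding quot
    proof (rule factor_through)
      fix f g assume f: "f \<in> maps X Y" and g: "g \<in> maps X Y" and "?orb f = ?orb g"
      then obtain \<gamma> where \<gamma>: "\<gamma> \<in> based_maps X x0 G e" and pc: "path_component_of S (translate \<gamma> f) g"
        by (rule orbit_eqD)
      have "(map_component X Y f, map_component X Y g) \<in> component_equiv X Y"
        using homotopy_equivalent_translate[OF \<gamma> f] f g
        by (simp add: component_equiv_def component_eq[OF pc] path_component_in_path_components_of)
      then show "component_equiv X Y `` {map_component X Y f} = component_equiv X Y `` {map_component X Y g}"
        by (rule Image_singleton_eq[OF sym_trans_component_equiv])
    qed
  qed
  have B: "\<exists>\<Psi>. \<Psi> ` (?orb ` maps X Y) = based_components X Y // based_component_equiv X Y \<and>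
      (\<forall>f\<in>maps X Y. \<Psi> (?orb f) = based_component_equiv X Y `` {(map_component X Y f, f)})"
    if fin: "finite cX"
  proof -
    have quot: "based_components X Y // based_component_equiv X Y
        = (\<lambda>f. based_component_equiv X Y `` {(map_component X Y f, f)}) ` maps X Y"
      by (auto simp: quotient_def based_components_def)
    show ?thesis
      unfolding quot
    proof (rule factor_through)
      fix f g assume f: "f \<in> maps X Y" and g: "g \<in> maps X Y" and "?orb f = ?orb g"
      then obtain \<gamma> where \<gamma>: "\<gamma> \<in> based_maps X x0 G e" and pc: "path_component_of S (translate \<gamma> f) g"
        by (rule orbit_eqD)
      let ?h = "translate \<gamma> f"
      have h: "?h \<in> maps X Y" by (rule translate_maps[OF c\<gamma>[OF \<gamma>] f])
      have "fibre_homotopy_equivalence (comp_space f) f (\<lambda>_. ()) (comp_space ?h) ?h (\<lambda>_. ()) (translate \<gamma>)"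
        by (rule fibre_homotopy_equivalence_translate(1)[OF \<gamma> f wp[OF fin] regular_lifting_trivial _ _ _ _ mem[OF f]])
           (auto intro!: exI[of _ "\<lambda>_. ()"])
      then have 1: "based_homotopy_equivalent (comp_space f) f (comp_space ?h) ?h"
        unfolding based_homotopy_equivalent_iff by (rule exI[of _ "translate \<gamma>"])
      \<comment> \<open>The orbit determines \<open>g\<close> only up to a free homotopy, so the
        base point must still be moved from \<open>?h\<close> to \<open>g\<close> within their
        common component.\<close>
      have 2: "based_homotopy_equivalent (comp_space ?h) ?h (comp_space ?h) g"
        by (rule based_homotopy_equivalent_same_space)
           (use wp[OF fin h] wp[OF fin g] h pc in
             \<open>auto intro: well_pointed_path_component path_component_of_aux simp: path_component_of_refl\<close>)
      have "((map_component X Y f, f), (map_component X Y g, g)) \<in> based_component_equiv X Y"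
        using based_homotopy_equivalent_trans[OF 1 2] f g
        by (auto simp: based_component_equiv_def based_components_def component_eq[OF pc])
      then show "based_component_equiv X Y `` {(map_component X Y f, f)} = based_component_equiv X Y `` {(map_component X Y g, g)}"
        by (rule Image_singleton_eq[OF sym_trans_based_component_equiv])
    qed
  qed
  have C: "\<exists>\<Psi>. \<Psi> ` (?orb ` maps X Y) = evaluation_fibrations X x0 Y // evaluation_fibration_equiv X x0 Y \<and>
      (\<forall>f\<in>maps X Y. \<Psi> (?orb f) = evaluation_fibration_equiv X x0 Y `` {evaluation_fibration X x0 Y f})"
    if fin: "finite cX" and su: "strictly_unital e Y A"
  proof -
    have quot: "evaluation_fibrations X x0 Y // evaluation_fibration_equiv X x0 Y
        = (\<lambda>f. evaluation_fibration_equiv X x0 Y `` {evaluation_fibration X x0 Y f}) ` maps X Y"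
      by (auto simp: quotient_def evaluation_fibrations_def)
    have unit: "A (e, y) = y" if "y \<in> topspace Y" for y using su that by (simp add: strictly_unital_def)
    show ?thesis
      unfolding quot
    proof (rule factor_through)
      fix f g assume f: "f \<in> maps X Y" and g: "g \<in> maps X Y" and "?orb f = ?orb g"
      then obtain \<gamma> where \<gamma>: "\<gamma> \<in> based_maps X x0 G e" and pc: "path_component_of S (translate \<gamma> f) g"
        by (rule orbit_eqD)
      let ?h = "translate \<gamma> f" and ?\<delta> = "\<lambda>x. \<iota> (\<gamma> x)" and ?p = "\<lambda>h. h x0"
      have h: "?h \<in> maps X Y" by (rule translate_maps[OF c\<gamma>[OF \<gamma>] f])
      have p\<gamma>: "translate \<gamma> k x0 = k x0" "translate ?\<delta> k x0 = k x0" if "k \<in> maps X Y" for k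
        using maps_mem[OF that x0] x0 by (simp_all add: translate_def map_basepoint[OF \<gamma>] inverse_unit unit)
      \<comment> \<open>The base is \<open>Y\<close> itself, so \<open>\<alpha>\<close> can be taken
        for \<open>\<beta>\<close>; strict unitality makes it start at the identity.\<close>
      have track: "\<forall>\<Theta> \<alpha>. (\<forall>s h. \<Theta> (s, h) x0 = \<alpha> (s, h x0)) \<and>
          continuous_map (prod_topology unit_interval Y) Y \<alpha> \<and>
          (\<forall>y. \<alpha> (0, y) = A (e, A (e, y))) \<and> (\<forall>y. \<alpha> (1, y) = y) \<longrightarrow>
        (\<exists>\<beta>. continuous_map (prod_topology unit_interval Y) Y \<beta> \<and> (\<forall>b\<in>topspace Y. \<beta> (0, b) = b) \<and>
          (\<forall>b\<in>topspace Y. \<beta> (1, b) = b) \<and> (\<forall>s\<in>{0..1}. \<forall>h\<in>maps X Y. \<Theta> (s, h) x0 = \<beta> (s, h x0)))"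
      proof (intro allI impI, elim conjE)
        fix \<Theta> :: "real \<times> ('a \<Rightarrow> 'b) \<Rightarrow> 'a \<Rightarrow> 'b" and \<alpha>
        assume "\<forall>s h. \<Theta> (s, h) x0 = \<alpha> (s, h x0)" "continuous_map (prod_topology unit_interval Y) Y \<alpha>"
          "\<forall>y. \<alpha> (0, y) = A (e, A (e, y))" "\<forall>y. \<alpha> (1, y) = y"
        then show "\<exists>\<beta>. continuous_map (prod_topology unit_interval Y) Y \<beta> \<and> (\<forall>b\<in>topspace Y. \<beta> (0, b) = b) \<and>
          (\<forall>b\<in>topspace Y. \<beta> (1, b) = b) \<and> (\<forall>s\<in>{0..1}. \<forall>h\<in>maps X Y. \<Theta> (s, h) x0 = \<beta> (s, h x0))"
          by (intro exI[of _ \<alpha>]) (simp add: unit)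
      qed
      note reg = regular_lifting_evaluation[OF HX CX.compact_space_finite[OF fin] assms(4), of _ Y]
      note fhe = fibre_homotopy_equivalence_translate[where p = ?p and B = Y, OF \<gamma> f wp[OF fin] reg continuous_map_evaluation_at[OF x0] p\<gamma> track]
      have fwd: "\<exists>k\<in>topspace (comp_space ?h). \<exists>F. fibre_homotopy_equivalence (comp_space f) l ?p (comp_space ?h) k ?p F"
        if l: "l \<in> topspace (comp_space f)" for l
        by (intro bexI[of _ "translate \<gamma> l"] exI[of _ "translate \<gamma>"] fhe(1) l continuous_map_mem[OF translate_component[OF c\<gamma>[OF \<gamma>]] l])
      \<comment> \<open>A prescribed \<open>l\<close> need not be of the form
        \<open>translate \<gamma> k\<close>. So the equivalence is built from \<open>l\<close> by
        translating with \<open>?\<delta>\<close>, and is inverted afterwards.\<close>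
      have bwd: "\<exists>k\<in>topspace (comp_space f). \<exists>F. fibre_homotopy_equivalence (comp_space f) k ?p (comp_space ?h) l ?p F"
        if l: "l \<in> topspace (comp_space ?h)" for l
        by (intro bexI[of _ "translate ?\<delta> l"] fibre_homotopy_equivalence_sym[OF fhe(2)] l continuous_map_mem[OF translate_back[OF \<gamma> f] l])
      have "(evaluation_fibration X x0 Y f, evaluation_fibration X x0 Y ?h) \<in> evaluation_fibration_equiv X x0 Y"
        using f h fwd bwd by (simp add: evaluation_fibration_equiv_def evaluation_fibration_def evaluation_fibrations_def)
      moreover have "evaluation_fibration X x0 Y ?h = evaluation_fibration X x0 Y g"
        by (simp add: evaluation_fibration_def component_eq[OF pc])
      ultimately have "(evaluation_fibration X x0 Y f, evaluation_fibration X x0 Y g) \<in> evaluation_fibration_equiv X x0 Y"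
        by simp
      then show "evaluation_fibration_equiv X x0 Y `` {evaluation_fibration X x0 Y f}
          = evaluation_fibration_equiv X x0 Y `` {evaluation_fibration X x0 Y g}"
        by (rule Image_singleton_eq[OF sym_trans_evaluation_fibration_equiv])
    qed
  qed
  show ?thesis
    unfolding Let_def orbits_eq using A B C by (intro conjI impI) (assumption | elim conjE)+
qed

end
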